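(* Let $(Y,S)$ and $(X,T)$ be minimal Cantor systems. The following are equivalent: (1) $(Y,S)$ is a speedup of $(X,T)$. (2) There exists an exhaustive epimorphism $\varphi:\mathcal{G}(Y,S)/\mathrm{Inf}(Y,S)\twoheadrightarrow\mathcal{G}(X,T)/\mathrm{Inf}(X,T)$ which preserves the distinguished order unit. (3) There exists a homeomorphism $F:X\rightarrow Y$ such that $F_{*}:M(X,T)\hookrightarrow M(Y,S)$ is an injection (i.e. $F_*\mu=\mu\circ F^{-1}$ defines an injective map from $M(X,T)$ into $M(Y,S)$).
   Context: A Cantor space is a nonempty compact, metrizable, perfect, zero-dimensional space. A minimal Cantor system $(X,T)$ is a Cantor space $X$ with a homeomorphism $T:X\to X$ all of whose orbits $\{T^n(x):n\in\mathbb{Z}\}$ are dense. $\mathbb{Z}^+$ denotes the positive integers. $M(X,T)$ is the set of $T$-invariant Borel probability measures on $X$. Speedup: $(Y,S)$ is a speedup of $(X,T)$ if there is a function $p:X\to\mathbb{Z}^+$ (no continuity assumed) such that $(Y,S)$ is topologically conjugate to $(X,T')$, where $T'(x)=T^{p(x)}(x)$ for all $x\in X$ (i.e. there is a homeomorphism $h:X\to Y$ with $hT'=Sh$). Groups: $C(X,\mathbb{Z})$ is the group of continuous integer-valued functions on $X$; $\mathrm{cob}(X,T)=\{f-f\circ T: f\in C(X,\mathbb{Z})\}$; $G(X,T)=C(X,\mathbb{Z})/\mathrm{cob}(X,T)$; $G(X,T)_+=\{[f]: f\in C(X,\mathbb{Z}), f\ge 0\}$; $\mathcal{G}(X,T)=(G(X,T),G(X,T)_+,[\mathbf{1}_X])$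 where $\mathbf 1_X$ is the constant function $1$. $\mathrm{Inf}(X,T)=\{f\in C(X,\mathbb{Z}): \int f\,d\mu=0 \text{ for all }\mu\in M(X,T)\}\supseteq\mathrm{cob}(X,T)$. $\mathcal{G}(X,T)/\mathrm{Inf}(X,T)$ denotes the quotient group $C(X,\mathbb{Z})/\mathrm{Inf}(X,T)$ with positive cone the set of classes of nonnegative functions and distinguished order unit the class of $\mathbf{1}_X$. In an ordered group with positive cone $G_+$: $a\le b$ means $b-a\in G_+$, and $a<b$ means $b-a\in G_+\setminus\{0\}$. An epimorphism of unital ordered groups $\varphi:(G,G_+,u)\to(H,H_+,v)$ preserving the distinguished order unit is a surjective group homomorphism with $\varphi(G_+)\subseteq H_+$ and $\varphi(u)=v$. It is exhaustive if for every $g\in G_+$ and $h\in H$ with $0<h<\varphi(g)$ there is $g'\in G$ with $\varphi(g')=h$ and $0<g'<g$. *)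

theory Defs
  imports "HOL-Probability.Probability_Measure" "HOL-Algebra.Coset"
begin

text \<open>A system is a self-map of a whole type with its ambient topology. The constant \<open>dim_le\<close>
  is the small inductive dimension; the empty space has dimension at most -1, so nonemptiness is a
  separate conjunct.\<close>

definition cantor_space :: "'a topology \<Rightarrow> bool" where
  "cantor_space X \<longleftrightarrow>
     topspace X \<noteq> {} \<and> compact_space X \<and> metrizable_space X \<and>
     (\<forall>x \<in> topspace X. \<not> openin X {x}) \<and> X dim_le 0"

text \<open>Backward iterates use \<open>inv_into UNIV T\<close>, since HOL-Algebra claims the syntax \<open>inv\<close>.\<close>

definition orbit :: "('a \<Rightarrow> 'a) \<Rightarrow> 'a \<Rightarrow> 'a set" where
  "orbit T x = range (\<lambda>n::nat. (T ^^ n) x) \<union> range (\<lambda>n::nat. (inv_into UNIV T ^^ n) x)"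

definition minimal_cantor_system :: "('a::topological_space \<Rightarrow> 'a) \<Rightarrow> bool" where
  "minimal_cantor_system T \<longleftrightarrow>
     cantor_space (euclidean :: 'a topology) \<and>
     homeomorphic_map euclidean euclidean T \<and>
     (\<forall>x. closure (orbit T x) = UNIV)"

definition topologically_conjugate ::
    "('a::topological_space \<Rightarrow> 'a) \<Rightarrow> ('b::topological_space \<Rightarrow> 'b) \<Rightarrow> bool" where
  "topologically_conjugate T S \<longleftrightarrow>
     (\<exists>h. homeomorphic_map euclidean euclidean h \<and> (\<forall>x. h (T x) = S (h x)))"

definition is_speedup_of ::
    "('b::topological_space \<Rightarrow> 'b) \<Rightarrow> ('a::topological_space \<Rightarrow> 'a) \<Rightarrow> bool" where
  "is_speedup_of S T \<longleftrightarrow>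
     (\<exists>p :: 'a \<Rightarrow> nat. (\<forall>x. p x > 0) \<and> topologically_conjugate (\<lambda>x. (T ^^ p x) x) S)"

definition invariant_measures :: "('a::topological_space \<Rightarrow> 'a) \<Rightarrow> 'a measure set" where
  "invariant_measures T = {\<mu>. prob_space \<mu> \<and> sets \<mu> = sets borel \<and> distr \<mu> borel T = \<mu>}"

text \<open>The underlying groups are written multiplicatively, following \<^theory>\<open>HOL-Algebra.Group\<close>:
  the difference \<open>b - a\<close> is \<open>b \<otimes> inv a\<close> and the zero element is \<open>\<one>\<close>.\<close>

record 'g unital_ordered_group = "'g monoid" +
  pos_cone :: "'g set"
  order_unit :: 'g

definition ordered_less :: "('g, 'm) unital_ordered_group_scheme \<Rightarrow> 'g \<Rightarrow> 'g \<Rightarrow> bool" where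
  "ordered_less G a b \<longleftrightarrow> b \<otimes>\<^bsub>G\<^esub> inv\<^bsub>G\<^esub> a \<in> pos_cone G - {\<one>\<^bsub>G\<^esub>}"

definition unital_ordered_epi ::
    "('g, 'm) unital_ordered_group_scheme \<Rightarrow> ('h, 'n) unital_ordered_group_scheme \<Rightarrow> ('g \<Rightarrow> 'h) set"
  where
  "unital_ordered_epi G H =
     {\<phi> \<in> epi G H. \<phi> ` pos_cone G \<subseteq> pos_cone H \<and> \<phi> (order_unit G) = order_unit H}"

definition exhaustive ::
    "('g, 'm) unital_ordered_group_scheme \<Rightarrow> ('h, 'n) unital_ordered_group_scheme \<Rightarrow> ('g \<Rightarrow> 'h) \<Rightarrow> bool"
  where
  "exhaustive G H \<phi> \<longleftrightarrow>
     (\<forall>g \<in> pos_cone G. \<forall>h \<in> carrier H.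
        ordered_less H \<one>\<^bsub>H\<^esub> h \<and> ordered_less H h (\<phi> g) \<longrightarrow>
        (\<exists>g' \<in> carrier G. \<phi> g' = h \<and> ordered_less G \<one>\<^bsub>G\<^esub> g' \<and> ordered_less G g' g))"

definition CZ :: "('a::topological_space \<Rightarrow> int) monoid" where
  "CZ = \<lparr>carrier = {f. continuous_on UNIV f}, mult = (\<lambda>f g x. f x + g x), one = (\<lambda>x. 0)\<rparr>"

definition Inf_subgroup :: "('a::topological_space \<Rightarrow> 'a) \<Rightarrow> ('a \<Rightarrow> int) set" where
  "Inf_subgroup T =
     {f \<in> carrier CZ. \<forall>\<mu> \<in> invariant_measures T. (\<integral>x. real_of_int (f x) \<partial>\<mu>) = 0}"

text \<open>Cosets of \<open>Inf_subgroup T\<close> in the group of continuous integer-valued functions. Coboundaries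
  have integral zero against every invariant measure, so first dividing by them would give the same
  ordered group.\<close>

definition G_mod_Inf ::
    "('a::topological_space \<Rightarrow> 'a) \<Rightarrow> ('a \<Rightarrow> int) set unital_ordered_group" where
  "G_mod_Inf T =
     \<lparr>carrier = carrier (CZ Mod Inf_subgroup T),
      mult = mult (CZ Mod Inf_subgroup T),
      one = one (CZ Mod Inf_subgroup T),
      pos_cone = {Inf_subgroup T #>\<^bsub>CZ\<^esub> f | f. f \<in> carrier CZ \<and> (\<forall>x. f x \<ge> 0)},
      order_unit = Inf_subgroup T #>\<^bsub>CZ\<^esub> (\<lambda>x. 1)\<rparr>"

end

theory Submission
  imports Defs
begin

text \<open>
Since \<open>T\<close> has no periodic points, \<open>x \<mapsto> T\<^sup>p x\<close> with variable \<open>p > 0\<close> is piecewise a power of \<open>T\<close> on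
countably many closed sets, so a speedup preserves all \<open>T\<close>-invariant measures; this gives (1) to (3).
An embedding \<open>F\<close> as in (3) induces \<open>f \<mapsto> f \<circ> F\<close> on the level of functions. Conversely an exhaustive
epimorphism prescribes the measures of clopen sets, and a back-and-forth between the clopen algebras
produces \<open>F\<close>. Both directions use that functions with \<open>\<integral>f < \<integral>g\<close> for all invariant measures admit
\<open>f' \<le> g\<close> cohomologous to \<open>f\<close>.

For (3) to (1), pull \<open>S\<close> back to a homeomorphism \<open>\<sigma>\<close> of \<open>X\<close> preserving every \<open>T\<close>-invariant measure.
Between clopen sets of equal measure there are homeomorphisms moving points forward along \<open>T\<close>-orbits.
They allow us to conjugate \<open>\<sigma>\<close>, by conjugacies that preserve more and more clopen sets, into
homeomorphisms which move points forward outside a neighbourhood of a point \<open>x1\<close>. The neighbourhoods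
shrink to \<open>x1\<close>, the conjugacies converge, and \<open>x1 \<mapsto> T x1\<close> is arranged beforehand.
\<close>

section \<open>Clopen sets and partial homeomorphisms\<close>

text \<open>Bracket matching along orbits has bounded times and rests on strict inequality of
  measures, which compactness turns into one length \<open>N\<close> good for all points. For clopen
  sets of equal measure there is no slack, and one pair of points has to absorb the defect: this is
  the origin of \<open>a0\<close>, \<open>d0\<close> and \<open>x1\<close>. The conjugacies have the
  form \<open>\<tau>^m \<sigma>^(-m)\<close> with an integer height \<open>m\<close> that grows by 1
  along \<open>\<sigma>\<close>. On a compact space no continuous height can do so everywhere, since
  it would be bounded. It is therefore reset on a small clopen set around \<open>x1\<close>, and
  there the conjugated map stays uncontrolled until a later stage. In the passage from (2) to (3)
  the two sides differ. A clopen subset of \<open>X\<close> of prescribed mass is cut out by the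
  dynamics of \<open>T\<close>; for a clopen subset of \<open>Y\<close> the prescribed class has to
  be lifted through the epimorphism below a given bound, and this is what exhaustiveness says. In
  the converse direction \<open>M(Y,S)\<close> may be larger than the image of
  \<open>M(X,T)\<close>, so the inequalities in \<open>Y\<close> are obtained pointwise and not from
  integrals.\<close>

definition clopen :: "'a::topological_space set \<Rightarrow> bool" where
  "clopen U \<longleftrightarrow> open U \<and> closed U"

abbreviation cts :: "('a::topological_space \<Rightarrow> 'b::topological_space) \<Rightarrow> bool" where
  "cts f \<equiv> continuous_on UNIV f"

lemma clopen_simps [simp]: "clopen {}" "clopen UNIV"
  by (auto simp: clopen_def)

lemma clopen_Compl [simp]: "clopen (- U) \<longleftrightarrow> clopen U"
  by (auto simp: clopen_def closed_def)

lemma clopen_Int [simp, intro]: "clopen U \<Longrightarrow> clopen V \<Longrightarrow> clopen (U \<inter> V)"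
  by (auto simp: clopen_def)

lemma clopen_Un [simp, intro]: "clopen U \<Longrightarrow> clopen V \<Longrightarrow> clopen (U \<union> V)"
  by (auto simp: clopen_def)

lemma clopen_Diff [simp, intro]: "clopen U \<Longrightarrow> clopen V \<Longrightarrow> clopen (U - V)"
  by (auto simp: clopen_def)

lemma clopen_UN: "finite I \<Longrightarrow> (\<And>i. i \<in> I \<Longrightarrow> clopen (U i)) \<Longrightarrow> clopen (\<Union>i\<in>I. U i)"
  by (auto simp: clopen_def)

lemma clopen_INT: "finite I \<Longrightarrow> (\<And>i. i \<in> I \<Longrightarrow> clopen (U i)) \<Longrightarrow> clopen (\<Inter>i\<in>I. U i)"
  by (auto simp: clopen_def)

lemma clopen_vimage_discrete:
  fixes f :: "'a::topological_space \<Rightarrow> 'b::discrete_topology"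
  assumes "cts f"
  shows "clopen (f -` A)"
  using assms by (auto simp: clopen_def open_discrete closed_def
      intro!: continuous_open_vimage continuous_closed_vimage continuous_on_imp_continuous_within
      simp: vimage_Compl[symmetric] continuous_on_open_vimage)

lemma continuous_discreteI:
  fixes f :: "'a::topological_space \<Rightarrow> 'b::topological_space"
  assumes "\<And>k. open (f -` {k})"
  shows "cts f"
proof -
  have "open (f -` A)" for A
  proof -
    have "f -` A = (\<Union>k\<in>A. f -` {k})" by auto
    then show ?thesis using assms by auto
  qed
  then show ?thesis by (simp add: continuous_on_open_vimage)
qed

lemma continuous_discrete_comp:
  fixes f :: "'a::topological_space \<Rightarrow> 'b::discrete_topology"
    and g :: "'b \<Rightarrow> 'c::topological_space"
  assumes "cts f"
  shows "cts (\<lambda>x. g (f x))"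
proof (rule continuous_discreteI)
  fix k
  have "(\<lambda>x. g (f x)) -` {k} = f -` (g -` {k})" by auto
  then show "open ((\<lambda>x. g (f x)) -` {k})"
    using clopen_vimage_discrete[OF assms] by (metis clopen_def)
qed

lemma continuous_discrete_comp2:
  fixes f :: "'a::topological_space \<Rightarrow> 'b::discrete_topology"
    and f' :: "'a::topological_space \<Rightarrow> 'd::discrete_topology"
    and g :: "'b \<Rightarrow> 'd \<Rightarrow> 'c::topological_space"
  assumes "cts f" "cts f'"
  shows "cts (\<lambda>x. g (f x) (f' x))"
proof (rule continuous_discreteI)
  fix k
  have "(\<lambda>x. g (f x) (f' x)) -` {k} = (\<Union>l\<in>UNIV. \<Union>m\<in>{m. g l m = k}. f -` {l} \<inter> f' -` {m})" by auto
  moreover have "open (f -` {l} \<inter> f' -` {m})" for l m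
    using clopen_vimage_discrete[OF assms(1)] clopen_vimage_discrete[OF assms(2)] by (auto simp: clopen_def)
  ultimately show "open ((\<lambda>x. g (f x) (f' x)) -` {k})"
    by (metis (no_types, lifting) open_UN)
qed

lemma continuous_of_bool:
  assumes "clopen U"
  shows "cts (\<lambda>x. of_bool (x \<in> U) :: 'b::{zero_neq_one,discrete_topology})"
proof (rule continuous_discreteI)
  fix k :: 'b
  have "(\<lambda>x. of_bool (x \<in> U)) -` {k} = (if k = 1 then U else if k = 0 then - U else {})"
    by auto
  then show "open ((\<lambda>x. of_bool (x \<in> U)) -` {k})"
    using assms by (auto simp: clopen_def)
qed

section \<open>Compactness and zero-dimensionality: clopen bases, countability, finite
  ranges\<close>

locale cantor_type =
  fixes ty :: "'a::topological_space itself"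
  assumes cantor: "cantor_space (euclidean :: 'a topology)"
begin

lemma compact_UNIV: "compact (UNIV :: 'a set)"
  using cantor unfolding cantor_space_def compact_space_def by simp

lemma clopen_compact: "clopen (U::'a set) \<Longrightarrow> compact U"
  using compact_Int_closed[OF compact_UNIV, of U] by (simp add: clopen_def)

lemma not_open_singleton: "\<not> open {x::'a}"
  using cantor unfolding cantor_space_def by auto

lemma clopen_base:
  assumes "open V" "(x::'a) \<in> V"
  obtains U where "clopen U" "x \<in> U" "U \<subseteq> V"
proof -
  have "neighbourhood_base_of (\<lambda>U. closedin euclidean U \<and> openin euclidean U) (euclidean :: 'a topology)"
    using cantor unfolding cantor_space_def dimension_le_0_neighbourhood_base_of_clopen by blast
  then have "\<forall>x::'a. \<forall>W. open W \<and> x \<in> W \<longrightarrow> (\<exists>U C. open U \<and> (closed C \<and> open C) \<and> x \<in> U \<and> U \<subseteq> C \<and> C \<subseteq> W)"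
    by (simp add: neighbourhood_base_of closed_closedin[symmetric])
  from this[rule_format, of V x] obtain C where "open C" "closed C" "x \<in> C" "C \<subseteq> V"
    using assms by auto
  then have "clopen C" "x \<in> C" "C \<subseteq> V" by (simp_all add: clopen_def)
  then show ?thesis using that by auto
qed

lemma clopen_separate:
  assumes "(x::'a) \<noteq> y"
  obtains U where "clopen U" "x \<in> U" "y \<notin> U"
proof -
  have "Hausdorff_space (euclidean :: 'a topology)"
    using cantor metrizable_imp_Hausdorff_space unfolding cantor_space_def by auto
  then obtain V where "open V" "x \<in> V" "y \<notin> V"
    using assms unfolding Hausdorff_space_def by (metis UNIV_I disjnt_iff open_openin topspace_euclidean)
  then show ?thesis using clopen_base that by blast
qed

text \<open>Finite clopen covers at the scales \<open>1 / Suc n\<close> together form a countable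
  base \<open>CC\<close>; a clopen set is compact, hence a finite union of members of
  \<open>CC\<close>.\<close>

lemma countable_clopen: "countable {U :: 'a set. clopen U}"
proof -
  have "metrizable_space (euclidean :: 'a topology)"
    using cantor unfolding cantor_space_def by auto
  then obtain M d where Md: "Metric_space M d" and top: "euclidean = Metric_space.mtopology M (d :: 'a \<Rightarrow> 'a \<Rightarrow> real)"
    unfolding metrizable_space_def by auto
  interpret Metric_space M d by fact
  have MU: "M = UNIV" using top topspace_mtopology by (metis topspace_euclidean)
  have opb: "open (mball x r)" for x r
    by (metis open_openin openin_mball top)
  have "\<exists>F. finite F \<and> UNIV = \<Union>F \<and> (\<forall>C\<in>F. clopen C \<and> (\<exists>y. C \<subseteq> mball y (1 / Suc n)))" for n
  proof -
    define G where "G = {C. clopen C \<and> (\<exists>y. C \<subseteq> mball y (1 / Suc n))}"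
    have "UNIV \<subseteq> \<Union>G"
    proof
      fix x :: 'a
      have "x \<in> mball x (1 / Suc n)" by (intro centre_in_mball_iff[THEN iffD2]) (auto simp: MU)
      then obtain C where "clopen C" "x \<in> C" "C \<subseteq> mball x (1 / Suc n)"
        using clopen_base[OF opb[of x "1 / Suc n"]] by blast
      then show "x \<in> \<Union>G" by (auto simp: G_def)
    qed
    moreover have "\<forall>C\<in>G. open C" by (auto simp: G_def clopen_def)
    ultimately obtain F where "F \<subseteq> G" "finite F" "UNIV \<subseteq> \<Union>F"
      using compact_UNIV unfolding compact_eq_Heine_Borel by metis
    then show ?thesis unfolding G_def by (intro exI[of _ F]) auto
  qed
  then obtain F where F: "\<And>n. finite (F n)" "\<And>n. UNIV = \<Union>(F n)"
    "\<And>n C. C \<in> F n \<Longrightarrow> clopen C \<and> (\<exists>y. C \<subseteq> mball y (1 / Suc n))"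
    by metis
  define CC where "CC = (\<Union>n. F n)"
  have cCC: "countable CC" unfolding CC_def using F(1) by (auto intro: countable_finite)
  have small: "\<exists>C\<in>CC. x \<in> C \<and> C \<subseteq> U" if op: "open U" and xU: "x \<in> U" for x U
  proof -
    have "openin mtopology U" using op top open_openin by metis
    from this[unfolded openin_mtopology, THEN conjunct2, rule_format, OF xU]
    obtain r where r: "r > 0" "mball x r \<subseteq> U" by auto
    \<comment> \<open>A cover member lies in a ball of radius \<open>1 / Suc n\<close> whose centre
      is unknown, so its points are only known to be within \<open>2 / Suc n\<close> of each
      other.\<close>
    obtain n where n: "2 / real (Suc n) < r"
    proof -
      obtain n where "inverse (real (Suc n)) < r / 2" using reals_Archimedean[of "r / 2"] r(1) by auto
      then show ?thesis using that[of n] by (simp add: field_simps)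
    qed
    obtain C where C: "C \<in> F n" "x \<in> C" using F(2) by blast
    obtain y where y: "C \<subseteq> mball y (1 / Suc n)" using F(3) C(1) by blast
    have "C \<subseteq> mball x r"
    proof
      fix z assume "z \<in> C"
      then have "d y z < 1 / Suc n" "d y x < 1 / Suc n" using y C(2) by auto
      then have "d x z < 2 / Suc n" using triangle[of x y z] by (simp add: MU commute)
      then have "d x z < r" using n by linarith
      then show "z \<in> mball x r" unfolding in_mball by (simp add: MU)
    qed
    then show ?thesis using C r(2) CC_def by blast
  qed
  have "{U :: 'a set. clopen U} \<subseteq> Union ` {G. finite G \<and> G \<subseteq> CC}"
  proof
    fix U :: "'a set" assume "U \<in> {U. clopen U}"
    then have U: "clopen U" by simp
    have op: "\<forall>C\<in>{C\<in>CC. C \<subseteq> U}. open C" using F(3) by (auto simp: CC_def clopen_def)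
    have cov: "U \<subseteq> \<Union>{C\<in>CC. C \<subseteq> U}" using small U by (fastforce simp: clopen_def)
    obtain G where "G \<subseteq> {C\<in>CC. C \<subseteq> U}" "finite G" "U \<subseteq> \<Union>G"
      by (rule compactE[OF clopen_compact[OF U] cov]) (use op in auto)
    then have "U = \<Union>G" "finite G \<and> G \<subseteq> CC" by auto
    then show "U \<in> Union ` {G. finite G \<and> G \<subseteq> CC}" by blast
  qed
  then show ?thesis
    by (rule countable_subset[OF _ countable_image[OF countable_Collect_finite_subset[OF cCC]]])
qed

lemma enumerate_clopen:
  obtains c :: "nat \<Rightarrow> 'a set" where "range c = {U. clopen U}"
  using countable_clopen by (metis (mono_tags) clopen_simps(1) empty_Collect_eq range_from_nat_into)

lemma finite_range_discrete:
  fixes f :: "'a \<Rightarrow> 'b::discrete_topology"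
  assumes "cts f"
  shows "finite (range f)"
proof -
  have "compact (range f)" using compact_continuous_image[OF assms compact_UNIV] .
  moreover have "\<forall>A\<in>(\<lambda>k. {k}) ` range f. open A" by (auto simp: open_discrete)
  moreover have "range f \<subseteq> \<Union>((\<lambda>k. {k}) ` range f)" by auto
  ultimately obtain G where "G \<subseteq> (\<lambda>k. {k}) ` range f" "finite G" "range f \<subseteq> \<Union>G"
    unfolding compact_eq_Heine_Borel by metis
  moreover have "finite (\<Union>G)" using calculation by auto
  ultimately show ?thesis using finite_subset by blast
qed

lemma continuous_bounded:
  fixes f :: "'a \<Rightarrow> int"
  assumes "cts f"
  obtains K where "K \<ge> 0" "\<And>x. \<bar>f x\<bar> \<le> K"
proof -
  have "finite ((\<lambda>k. \<bar>k\<bar>) ` range f)" using finite_range_discrete[OF assms] by simp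
  then have "bdd_above ((\<lambda>k. \<bar>k\<bar>) ` range f)" by simp
  then obtain K where K: "\<And>x. \<bar>f x\<bar> \<le> K" unfolding bdd_above_def by auto
  moreover have "K \<ge> 0" using K[of undefined] by linarith
  ultimately show ?thesis using that by blast
qed

lemma clopen_cover_finite:
  assumes "\<And>x::'a. \<exists>n::nat. x \<in> U n" "\<And>n. open (U n)"
  obtains N where "\<And>x. \<exists>n\<le>N. x \<in> U n"
proof -
  have "\<forall>A\<in>range U. open A" "UNIV \<subseteq> \<Union>(range U)" using assms by auto
  then obtain G where "G \<subseteq> range U" "finite G" "UNIV \<subseteq> \<Union>G"
    using compact_UNIV unfolding compact_eq_Heine_Borel by metis
  then obtain I where I: "finite I" "UNIV \<subseteq> (\<Union>n\<in>I. U n)"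
    by (metis finite_subset_image)
  have "\<exists>n\<le>Max (insert 0 I). x \<in> U n" for x
    using I by (meson Max_ge UNIV_I UN_E finite_insert insertI2 subset_iff)
  then show ?thesis using that by blast
qed

end

text \<open>Openness refers to the ambient space, so this describes a homeomorphism of subspaces
  when \<open>A\<close> is open, and then \<open>B\<close> is open too. Keeping \<open>g\<close>
  total allows maps on disjoint pieces to be glued by a case distinction.\<close>

definition phomeo :: "'a::topological_space set \<Rightarrow> 'b::topological_space set \<Rightarrow> ('a \<Rightarrow> 'b) \<Rightarrow> bool" where
  "phomeo A B g \<longleftrightarrow> bij_betw g A B \<and> (\<forall>U\<subseteq>A. open (g ` U) \<longleftrightarrow> open U)"

abbreviation homeo :: "('a::topological_space \<Rightarrow> 'b::topological_space) \<Rightarrow> bool" where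
  "homeo \<equiv> phomeo UNIV UNIV"

lemma homeomorphic_map_euclidean_iff:
  "homeomorphic_map euclidean euclidean F \<longleftrightarrow> homeo F"
proof
  assume F: "homeomorphic_map euclidean euclidean F"
  then have bij: "bij F" by (simp add: homeomorphic_eq_everything_map bij_def)
  have "open (F ` U)" if "open U" for U
    using homeomorphic_imp_open_map[OF F] that unfolding open_map_def by auto
  moreover have "open U" if "open (F ` U)" for U
  proof -
    have "cts F" using homeomorphic_imp_continuous_map[OF F] by simp
    then have "open (F -` (F ` U))" using that by (simp add: continuous_on_open_vimage)
    then show ?thesis using bij by (simp add: bij_is_inj inj_vimage_image_eq)
  qed
  ultimately have "open (F ` U) \<longleftrightarrow> open U" for U by metis
  then show "homeo F" using bij by (simp add: phomeo_def)
next
  assume F: "homeo F"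
  then have bij: "bij F" and op: "\<And>U. open (F ` U) \<longleftrightarrow> open U" unfolding phomeo_def by auto
  have "open (F -` U)" if "open U" for U
    using op[of "F -` U"] that bij by (simp add: bij_is_surj surj_image_vimage_eq)
  then have "cts F" by (simp add: continuous_on_open_vimage)
  then show "homeomorphic_map euclidean euclidean F"
    using bij op by (intro bijective_open_imp_homeomorphic_map) (auto simp: open_map_def bij_def)
qed

lemma phomeoD:
  assumes "phomeo A B g"
  shows "bij_betw g A B" "inj_on g A" "g ` A = B" "\<And>U. U \<subseteq> A \<Longrightarrow> open (g ` U) \<longleftrightarrow> open U"
  using assms by (auto simp: phomeo_def bij_betw_def)

lemma phomeo_id: "phomeo A A (\<lambda>x. x)"
  by (auto simp: phomeo_def bij_betw_def)

lemma phomeo_comp: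
  assumes "phomeo A B g" "phomeo B C h"
  shows "phomeo A C (h \<circ> g)"
  unfolding phomeo_def
proof safe
  show "bij_betw (h \<circ> g) A C" by (rule bij_betw_trans[OF phomeoD(1)[OF assms(1)] phomeoD(1)[OF assms(2)]])
next
  fix U assume U: "U \<subseteq> A"
  then have "g ` U \<subseteq> B" using assms(1) by (auto simp: phomeo_def bij_betw_def)
  then have "open (h ` (g ` U)) \<longleftrightarrow> open U" using assms U by (simp add: phomeoD(4))
  then show "open ((h \<circ> g) ` U) \<Longrightarrow> open U" "open U \<Longrightarrow> open ((h \<circ> g) ` U)"
    by (simp_all add: image_comp)
qed

lemma phomeo_inv:
  assumes "phomeo A B g"
  shows "phomeo B A (inv_into A g)"
  unfolding phomeo_def
proof safe
  show "bij_betw (inv_into A g) B A" by (rule bij_betw_inv_into[OF phomeoD(1)[OF assms]])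
next
  fix U assume U: "U \<subseteq> B"
  have "inv_into A g ` U \<subseteq> A" using U phomeoD(3)[OF assms] by (auto intro: inv_into_into)
  then have "open (g ` inv_into A g ` U) \<longleftrightarrow> open (inv_into A g ` U)" using assms by (simp add: phomeoD(4))
  moreover have "g ` inv_into A g ` U = U"
    using U phomeoD(3)[OF assms] by (simp add: image_inv_into_cancel)
  ultimately show "open (inv_into A g ` U) \<Longrightarrow> open U" "open U \<Longrightarrow> open (inv_into A g ` U)" by auto
qed

lemma phomeo_subset:
  assumes "phomeo A B g" "U \<subseteq> A"
  shows "phomeo U (g ` U) g"
  using assms by (auto simp: phomeo_def bij_betw_def inj_on_subset)

lemma phomeo_cong:
  assumes "phomeo A B g" "\<And>x. x \<in> A \<Longrightarrow> g x = h x"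
  shows "phomeo A B h"
proof -
  have "g ` U = h ` U" if "U \<subseteq> A" for U using that assms(2) by (intro image_cong) auto
  then show ?thesis using assms unfolding phomeo_def
    by (metis (no_types, lifting) bij_betw_cong)
qed

text \<open>Disjoint targets give injectivity; since the sources and hence the targets are open,
  openness may be tested on each piece.\<close>

lemma phomeo_Un:
  assumes 1: "phomeo A1 B1 g" and 2: "phomeo A2 B2 g"
    and disj: "B1 \<inter> B2 = {}" and op: "open A1" "open A2"
  shows "phomeo (A1 \<union> A2) (B1 \<union> B2) g"
  unfolding phomeo_def
proof (intro conjI allI impI)
  show bij: "bij_betw g (A1 \<union> A2) (B1 \<union> B2)"
    by (rule bij_betw_combine[OF phomeoD(1)[OF 1] phomeoD(1)[OF 2] disj])
  fix U assume U: "U \<subseteq> A1 \<union> A2"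
  have opB: "open B1" "open B2" using 1 2 op by (metis order_refl phomeoD(3) phomeoD(4))+
  have "g ` A1 = B1" "g ` A2 = B2" using 1 2 by (auto simp: phomeoD(3))
  then have eq: "g ` (U \<inter> A1) = g ` U \<inter> B1" "g ` (U \<inter> A2) = g ` U \<inter> B2"
    using U disj by blast+
  have "open (g ` (U \<inter> A1)) \<longleftrightarrow> open (U \<inter> A1)" "open (g ` (U \<inter> A2)) \<longleftrightarrow> open (U \<inter> A2)"
    using 1 2 by (auto simp: phomeoD(4))
  then have iff: "open (g ` U \<inter> B1) \<longleftrightarrow> open (U \<inter> A1)" "open (g ` U \<inter> B2) \<longleftrightarrow> open (U \<inter> A2)"
    by (simp_all add: eq)
  have un: "(U \<inter> A1) \<union> (U \<inter> A2) = U" "(g ` U \<inter> B1) \<union> (g ` U \<inter> B2) = g ` U"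
    using U bij by (auto simp: bij_betw_def)
  show "open (g ` U) \<longleftrightarrow> open U"
  proof
    assume "open (g ` U)"
    then have "open (U \<inter> A1)" "open (U \<inter> A2)" using opB iff by auto
    then show "open U" using un(1) by (metis open_Un)
  next
    assume "open U"
    then have "open (g ` U \<inter> B1)" "open (g ` U \<inter> B2)" using op iff by auto
    then show "open (g ` U)" using un(2) by (metis open_Un)
  qed
qed

lemma phomeo_clopen_image:
  assumes "phomeo A B g" "clopen A" "clopen B" "clopen U" "U \<subseteq> A"
  shows "clopen (g ` U)"
proof -
  have "g ` (A - U) = B - g ` U" "g ` U \<subseteq> B"
    using inj_on_image_set_diff[OF phomeoD(2)[OF assms(1)], of A U] phomeoD(3)[OF assms(1)] assms(5) by auto
  then have "g ` U = B - g ` (A - U)" by blast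
  moreover have "open (g ` (A - U))" "open (g ` U)"
    using assms by (auto simp: phomeoD(4) clopen_def)
  ultimately show ?thesis using assms(3) by (metis clopen_def closed_Diff)
qed

lemma phomeo_UNIV:
  assumes "homeo g"
  shows "bij g" "cts g" "\<And>U. clopen (g ` U) \<longleftrightarrow> clopen U" "\<And>U. clopen (g -` U) \<longleftrightarrow> clopen U"
proof -
  show bij: "bij g" using assms by (rule phomeoD)
  show cl: "clopen (g ` U) \<longleftrightarrow> clopen U" for U
    using assms bij by (simp add: clopen_def closed_def phomeoD(4) bij_image_Compl_eq[symmetric])
  show "clopen (g -` U) \<longleftrightarrow> clopen U" for U
    using cl[of "g -` U"] bij by (simp add: bij_is_surj surj_image_vimage_eq)
  have "open (g -` U)" if "open U" for U
    using assms phomeoD(4)[of UNIV UNIV g "g -` U"] bij that by (simp add: bij_is_surj surj_image_vimage_eq)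
  then show "cts g" by (simp add: continuous_on_open_vimage)
qed

lemma phomeo_funpow:
  fixes g :: "'a::topological_space \<Rightarrow> 'a"
  assumes "homeo g"
  shows "homeo (g ^^ n)"
proof (induction n)
  case 0
  show ?case by (simp add: id_def phomeo_id)
next
  case (Suc n)
  show ?case using phomeo_comp[OF Suc assms] by (simp add: comp_def)
qed

text \<open>The indexed families list the clopen sets, repetitions allowed. Because each finite
  pattern of memberships realised in one space is realised in the other,
  \<open>U i \<mapsto> V i\<close> is a well-defined isomorphism of the clopen algebras, and
  compactness turns it into a map of points. No operations on indices have to be tracked, which
  suits back-and-forth constructions.\<close>

lemma Stone_duality:
  fixes U :: "'i \<Rightarrow> 'a::topological_space set" and V :: "'i \<Rightarrow> 'b::topological_space set"
  assumes "cantor_space (euclidean :: 'a topology)" "cantor_space (euclidean :: 'b topology)"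
    and cl: "\<And>i. clopen (U i)" "\<And>i. clopen (V i)"
    and all: "\<And>W. clopen W \<Longrightarrow> W \<in> range U" "\<And>W. clopen W \<Longrightarrow> W \<in> range V"
    and fin: "\<And>J x. finite J \<Longrightarrow> \<exists>y. \<forall>i\<in>J. x \<in> U i \<longleftrightarrow> y \<in> V i"
      "\<And>J y. finite J \<Longrightarrow> \<exists>x. \<forall>i\<in>J. x \<in> U i \<longleftrightarrow> y \<in> V i"
  obtains F where "homeo F" "\<And>i x. F x \<in> V i \<longleftrightarrow> x \<in> U i"
proof -
  interpret X: cantor_type "TYPE('a)" by unfold_locales fact
  interpret Y: cantor_type "TYPE('b)" by unfold_locales fact
  have "\<exists>y. \<forall>i. y \<in> V i \<longleftrightarrow> x \<in> U i" for x
  proof -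
    \<comment> \<open>The sets prescribed for the image of \<open>x\<close>. Finitely many of them
      meet by \<open>fin\<close>, so all of them have a common point.\<close>
    define f where "f i = (if x \<in> U i then V i else - V i)" for i
    have "UNIV \<inter> (\<Inter>i\<in>UNIV. f i) \<noteq> {}"
    proof (rule compact_imp_fip_image[OF Y.compact_UNIV])
      show "closed (f i)" for i using cl(2)[of i] by (auto simp: f_def clopen_def closed_def)
      fix J :: "'i set" assume "finite J"
      then obtain y where "\<forall>i\<in>J. x \<in> U i \<longleftrightarrow> y \<in> V i" using fin(1) by blast
      then show "UNIV \<inter> (\<Inter>i\<in>J. f i) \<noteq> {}" by (auto simp: f_def)
    qed
    then obtain y where y: "\<And>i. y \<in> f i" by auto
    have "y \<in> V i \<longleftrightarrow> x \<in> U i" for i using y[of i] by (auto simp: f_def split: if_splits)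
    then show ?thesis by blast
  qed
  then obtain F where F: "\<And>i x. F x \<in> V i \<longleftrightarrow> x \<in> U i" by metis
  have "inj F"
  proof (rule injI, rule ccontr)
    fix x y assume "F x = F y" "x \<noteq> y"
    then show False using X.clopen_separate[of x y] all(1) F by (metis rangeE)
  qed
  moreover have "surj F"
  proof (unfold surj_def, rule allI)
    fix y
    define f where "f i = (if y \<in> V i then U i else - U i)" for i
    have "UNIV \<inter> (\<Inter>i\<in>UNIV. f i) \<noteq> {}"
    proof (rule compact_imp_fip_image[OF X.compact_UNIV])
      show "closed (f i)" for i using cl(1)[of i] by (auto simp: f_def clopen_def closed_def)
      fix J :: "'i set" assume "finite J"
      then obtain x where "\<forall>i\<in>J. x \<in> U i \<longleftrightarrow> y \<in> V i" using fin(2) by blast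
      then show "UNIV \<inter> (\<Inter>i\<in>J. f i) \<noteq> {}" by (auto simp: f_def)
    qed
    then obtain x where x: "\<And>i. x \<in> f i" by auto
    have "F x = y"
    proof (rule ccontr)
      assume "F x \<noteq> y"
      then obtain i where "F x \<in> V i" "y \<notin> V i"
        using Y.clopen_separate all(2) by (metis rangeE)
      then show False using F x[of i] by (auto simp: f_def split: if_splits)
    qed
    then show "\<exists>x. y = F x" by auto
  qed
  ultimately have bij: "bij F" by (simp add: bij_def)
  have im: "F ` U i = V i" for i
    using F bij by (auto simp: bij_def surj_def) (metis imageI)
  have "open (F ` W) \<longleftrightarrow> open W" for W
  proof
    assume W: "open W"
    show "open (F ` W)"
    proof (subst open_subopen, safe)
      fix x assume "x \<in> W"
      then obtain i where "x \<in> U i" "U i \<subseteq> W" using W X.clopen_base all(1) by (metis rangeE)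
      then show "\<exists>Z. open Z \<and> F x \<in> Z \<and> Z \<subseteq> F ` W"
        using im F cl(2) by (metis clopen_def image_mono)
    qed
  next
    assume W: "open (F ` W)"
    show "open W"
    proof (subst open_subopen, safe)
      fix x assume "x \<in> W"
      then obtain i where "F x \<in> V i" "V i \<subseteq> F ` W"
        using W Y.clopen_base[of "F ` W" "F x"] all(2) by (metis imageI rangeE)
      moreover from this have "U i \<subseteq> W" using im bij by (metis bij_def inj_image_subset_iff)
      ultimately show "\<exists>Z. open Z \<and> x \<in> Z \<and> Z \<subseteq> W"
        using F cl(1) by (metis clopen_def)
    qed
  qed
  then have "homeo F" using bij by (simp add: phomeo_def)
  then show ?thesis using F that by blast
qed

section \<open>Integrals of integer-valued functions and invariant measures\<close>

definition borel_prob :: "'a::topological_space measure \<Rightarrow> bool" where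
  "borel_prob \<mu> \<longleftrightarrow> prob_space \<mu> \<and> sets \<mu> = sets borel"

definition integral_Z :: "'a measure \<Rightarrow> ('a \<Rightarrow> int) \<Rightarrow> real" where
  "integral_Z \<mu> f = (\<integral>x. real_of_int (f x) \<partial>\<mu>)"

lemma borel_prob_space: "borel_prob \<mu> \<Longrightarrow> space \<mu> = UNIV"
  unfolding borel_prob_def by (metis sets_eq_imp_space_eq space_borel)

lemma clopen_sets: "borel_prob \<mu> \<Longrightarrow> clopen A \<Longrightarrow> A \<in> sets \<mu>"
  by (auto simp: borel_prob_def clopen_def)

lemma continuous_measurable_Z:
  fixes f :: "'a::topological_space \<Rightarrow> int"
  assumes "cts f" "borel_prob \<mu>"
  shows "(\<lambda>x. real_of_int (f x)) \<in> borel_measurable \<mu>"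
proof -
  have "cts (\<lambda>x. real_of_int (f x))"
    by (rule continuous_discrete_comp[OF assms(1)])
  then show ?thesis
    using assms(2) borel_measurable_continuous_onI measurable_cong_sets[of \<mu> borel borel borel]
    unfolding borel_prob_def by blast
qed

context cantor_type
begin

lemma integrable_Z:
  fixes f :: "'a \<Rightarrow> int"
  assumes "cts f" "borel_prob \<mu>"
  shows "integrable \<mu> (\<lambda>x. real_of_int (f x))"
proof -
  interpret prob_space \<mu> using assms(2) by (simp add: borel_prob_def)
  obtain K where "\<And>x. \<bar>f x\<bar> \<le> K" using continuous_bounded[OF assms(1)] by blast
  then have "\<And>x. norm (real_of_int (f x)) \<le> real_of_int K" by (simp flip: of_int_abs)
  then show ?thesis
    using continuous_measurable_Z[OF assms] by (intro integrable_const_bound[where B = "real_of_int K"]) auto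
qed

lemma integral_Z_add:
  fixes f g :: "'a \<Rightarrow> int"
  assumes "cts f" "cts g" "borel_prob \<mu>"
  shows "integral_Z \<mu> (\<lambda>x. f x + g x) = integral_Z \<mu> f + integral_Z \<mu> g"
  using integrable_Z assms by (simp add: integral_Z_def)

lemma integral_Z_diff:
  fixes f g :: "'a \<Rightarrow> int"
  assumes "cts f" "cts g" "borel_prob \<mu>"
  shows "integral_Z \<mu> (\<lambda>x. f x - g x) = integral_Z \<mu> f - integral_Z \<mu> g"
  using integrable_Z assms by (simp add: integral_Z_def)

lemma integral_Z_minus:
  fixes f :: "'a \<Rightarrow> int"
  shows "integral_Z \<mu> (\<lambda>x. - f x) = - integral_Z \<mu> f"
  by (simp add: integral_Z_def)

lemma integral_Z_sum:
  fixes f :: "'i \<Rightarrow> 'a \<Rightarrow> int"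
  assumes "\<And>i. i \<in> I \<Longrightarrow> cts (f i)" "borel_prob \<mu>"
  shows "integral_Z \<mu> (\<lambda>x. \<Sum>i\<in>I. f i x) = (\<Sum>i\<in>I. integral_Z \<mu> (f i))"
  using integrable_Z assms by (simp add: integral_Z_def)

lemma integral_Z_mono:
  fixes f g :: "'a \<Rightarrow> int"
  assumes "cts f" "cts g" "borel_prob \<mu>" "\<And>x. f x \<le> g x"
  shows "integral_Z \<mu> f \<le> integral_Z \<mu> g"
  unfolding integral_Z_def using integrable_Z assms by (intro integral_mono) auto

lemma integral_Z_const:
  assumes "borel_prob (\<mu> :: 'a measure)"
  shows "integral_Z \<mu> (\<lambda>x. c) = real_of_int c"
proof -
  interpret prob_space \<mu> using assms by (simp add: borel_prob_def)
  show ?thesis by (simp add: integral_Z_def prob_space)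
qed

lemma integral_Z_of_bool:
  assumes "borel_prob (\<mu> :: 'a measure)" "clopen A"
  shows "integral_Z \<mu> (\<lambda>x. of_bool (x \<in> A)) = measure \<mu> A"
proof -
  interpret prob_space \<mu> using assms by (simp add: borel_prob_def)
  have "(\<lambda>x. real_of_int (of_bool (x \<in> A))) = indicator A" by (auto simp: indicator_def)
  then show ?thesis using clopen_sets[OF assms] by (simp add: integral_Z_def)
qed

text \<open>A continuous integer function takes finitely many values, so its integral only sees
  measures of clopen sets; this is how limits of empirical measures reach integrals.\<close>

lemma integral_Z_range:
  fixes f :: "'a \<Rightarrow> int"
  assumes "cts f" "borel_prob \<mu>"
  shows "integral_Z \<mu> f = (\<Sum>k\<in>range f. of_int k * measure \<mu> (f -` {k}))"
proof -
  interpret prob_space \<mu> using assms by (simp add: borel_prob_def)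
  have fin: "finite (range f)" using finite_range_discrete assms(1) by blast
  have S: "f -` {k} \<in> sets \<mu>" for k using clopen_sets[OF assms(2) clopen_vimage_discrete[OF assms(1)]] .
  have "real_of_int (f x) = (\<Sum>k\<in>range f. of_int k * indicator (f -` {k}) x)" for x
  proof -
    have "(\<Sum>k\<in>range f. of_int k * indicator (f -` {k}) x) = (\<Sum>k\<in>range f. if k = f x then real_of_int k else 0)"
      by (intro sum.cong) (auto simp: indicator_def)
    then show ?thesis using fin by simp
  qed
  then have "integral_Z \<mu> f = (\<integral>x. (\<Sum>k\<in>range f. of_int k * indicator (f -` {k}) x) \<partial>\<mu>)"
    by (simp add: integral_Z_def)
  also have "\<dots> = (\<Sum>k\<in>range f. of_int k * measure \<mu> (f -` {k}))"
    using S by (subst Bochner_Integration.integral_sum) (auto simp: borel_prob_space[OF assms(2)] emeasure_eq_measure)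
  finally show ?thesis .
qed

text \<open>There are only countably many clopen sets, so each open set is a countable union of
  them.\<close>

lemma sets_borel_clopen: "sets (borel :: 'a measure) = sigma_sets UNIV {U. clopen U}"
proof -
  have "sigma_sets UNIV {S :: 'a set. open S} = sigma_sets UNIV {U. clopen U}"
  proof (rule sigma_sets_eqI)
    fix V :: "'a set" assume V: "V \<in> {S. open S}"
    have "V = \<Union>{U. clopen U \<and> U \<subseteq> V}"
      using clopen_base V by (auto; metis)
    moreover have "countable {U. clopen U \<and> U \<subseteq> V}"
      using countable_clopen by (rule countable_subset[rotated]) auto
    ultimately show "V \<in> sigma_sets UNIV {U. clopen U}"
      by (metis (no_types, lifting) mem_Collect_eq sigma_sets.Basic sigma_sets_UNION)
  next
    fix U :: "'a set" assume "U \<in> {U. clopen U}"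
    then show "U \<in> sigma_sets UNIV {S. open S}" by (auto simp: clopen_def)
  qed
  then show ?thesis by (simp add: borel_def)
qed

lemma borel_prob_eqI:
  fixes \<mu> \<nu> :: "'a measure"
  assumes "borel_prob \<mu>" "borel_prob \<nu>" "\<And>U. clopen U \<Longrightarrow> measure \<mu> U = measure \<nu> U"
  shows "\<mu> = \<nu>"
proof (rule measure_eqI_generator_eq[where E = "{U. clopen U}" and \<Omega> = UNIV and A = "\<lambda>_. UNIV"])
  interpret m: prob_space \<mu> using assms by (simp add: borel_prob_def)
  interpret n: prob_space \<nu> using assms by (simp add: borel_prob_def)
  show "Int_stable {U :: 'a set. clopen U}" by (auto simp: Int_stable_def)
  show "emeasure \<mu> X = emeasure \<nu> X" if "X \<in> {U. clopen U}" for X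
    using that assms(3) by (simp add: m.emeasure_eq_measure n.emeasure_eq_measure)
  show "sets \<mu> = sigma_sets UNIV {U. clopen U}" "sets \<nu> = sigma_sets UNIV {U. clopen U}"
    using assms sets_borel_clopen by (simp_all add: borel_prob_def)
  show "emeasure \<mu> UNIV \<noteq> \<infinity>" by simp
qed auto

text \<open>Compactness makes every finitely additive function on the clopen algebra countably additive.\<close>

lemma clopen_premeasure_extends:
  fixes m :: "'a set \<Rightarrow> real"
  assumes nonneg: "\<And>A. m A \<ge> 0" and one: "m UNIV = 1"
    and add: "\<And>A B. clopen A \<Longrightarrow> clopen B \<Longrightarrow> A \<inter> B = {} \<Longrightarrow> m (A \<union> B) = m A + m B"
  obtains \<mu> where "borel_prob \<mu>" "\<And>A. clopen A \<Longrightarrow> measure \<mu> A = m A"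
proof -
  let ?C = "{U :: 'a set. clopen U}"
  interpret C: ring_of_sets UNIV ?C
    by (rule ring_of_setsI) auto
  have m0: "m {} = 0" using add[of "{}" "{}"] by simp
  have "\<exists>\<mu>. (\<forall>s\<in>?C. \<mu> s = ennreal (m s)) \<and> measure_space UNIV (sigma_sets UNIV ?C) \<mu>"
  proof (rule C.caratheodory_empty_continuous)
    show "positive ?C (\<lambda>s. ennreal (m s))" by (simp add: positive_def m0)
    show "additive ?C (\<lambda>s. ennreal (m s))" using add nonneg by (auto simp: additive_def)
    fix A :: "nat \<Rightarrow> 'a set" assume A: "range A \<subseteq> ?C" "decseq A" "(\<Inter>i. A i) = {}"
    have cl: "clopen (A i)" for i using A(1) by auto
    have "\<exists>n. x \<in> - A n" for x using A(3) by auto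
    moreover have "open (- A n)" for n using cl[of n] by (auto simp: clopen_def)
    ultimately obtain N where N: "\<And>x. \<exists>n\<le>N. x \<in> - A n" using clopen_cover_finite[of "\<lambda>n. - A n"] by metis
    have "A n = {}" if "n \<ge> N" for n
      using N A(2) that unfolding decseq_def by (metis Compl_iff all_not_in_conv order_trans subset_iff)
    then show "(\<lambda>i. ennreal (m (A i))) \<longlonglongrightarrow> 0"
      by (intro tendsto_eventually eventually_sequentiallyI[of N]) (simp add: m0)
  qed simp
  then obtain \<mu>' where \<mu>': "\<And>s. clopen s \<Longrightarrow> \<mu>' s = ennreal (m s)"
    and ms: "measure_space UNIV (sets (borel :: 'a measure)) \<mu>'"
    by (auto simp: sets_borel_clopen)
  define \<mu> where "\<mu> = measure_of UNIV (sets (borel :: 'a measure)) \<mu>'"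
  have em: "emeasure \<mu> A = \<mu>' A" if "A \<in> sets borel" for A
    unfolding \<mu>_def using ms that by (intro emeasure_measure_of_sigma) (auto simp: measure_space_def)
  have sets: "sets \<mu> = sets borel" unfolding \<mu>_def
    by (metis sets.sets_measure_of_eq space_borel)
  have sp: "space \<mu> = UNIV" unfolding \<mu>_def by simp
  have clb: "A \<in> sets borel" if "clopen A" for A :: "'a set" using that by (auto simp: clopen_def)
  have "prob_space \<mu>"
    by (rule prob_spaceI) (use em[OF clb] \<mu>' one in \<open>simp add: sp\<close>)
  then have "borel_prob \<mu>" using sets by (simp add: borel_prob_def)
  moreover have "measure \<mu> A = m A" if "clopen A" for A
    using em[OF clb[OF that]] \<mu>'[OF that] nonneg by (simp add: measure_def)
  ultimately show ?thesis using that by blast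
qed

end

lemma continuous_Z_sum:
  fixes f :: "'i \<Rightarrow> 'a::topological_space \<Rightarrow> int"
  assumes "finite I" "\<And>i. i \<in> I \<Longrightarrow> cts (f i)"
  shows "cts (\<lambda>x. \<Sum>i\<in>I. f i x)"
  using assms
proof (induction I rule: finite_induct)
  case (insert i I)
  then have "cts (\<lambda>x. f i x + (\<Sum>i\<in>I. f i x))"
    by (intro continuous_discrete_comp2[where g = "(+)"]) simp_all
  then show ?case using insert by simp
qed simp

lemma continuous_Z_add:
  fixes f g :: "'a::topological_space \<Rightarrow> int"
  assumes "cts f" "cts g"
  shows "cts (\<lambda>x. f x + g x)"
  by (rule continuous_discrete_comp2[OF assms])

lemma continuous_Z_diff:
  fixes f g :: "'a::topological_space \<Rightarrow> int"
  assumes "cts f" "cts g"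
  shows "cts (\<lambda>x. f x - g x)"
  by (rule continuous_discrete_comp2[OF assms])

lemma continuous_Z_Max:
  fixes f :: "nat \<Rightarrow> 'a::topological_space \<Rightarrow> int"
  assumes "\<And>i. cts (f i)"
  shows "cts (\<lambda>x. Max ((\<lambda>n. f n x) ` {..N}))"
proof (induction N)
  case 0
  then show ?case using assms by simp
next
  case (Suc N)
  have "cts (\<lambda>x. max (f (Suc N) x) (Max ((\<lambda>n. f n x) ` {..N})))"
    by (rule continuous_discrete_comp2[OF assms Suc])
  moreover have "max (f (Suc N) x) (Max ((\<lambda>n. f n x) ` {..N})) = Max ((\<lambda>n. f n x) ` {..Suc N})" for x
    by (simp add: atMost_Suc)
  ultimately show ?case by simp
qed

lemma continuous_comp_UNIV:
  assumes "cts f" "cts g"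
  shows "cts (\<lambda>x. f (g x))"
  using continuous_on_compose2[OF assms] by simp

lemma borel_prob_measurable:
  fixes g :: "'a::topological_space \<Rightarrow> 'b::topological_space"
  assumes "cts g" "borel_prob \<mu>"
  shows "g \<in> measurable \<mu> borel"
  using assms(2) borel_measurable_continuous_onI[OF assms(1)] measurable_cong_sets[of \<mu> borel borel borel]
  unfolding borel_prob_def by blast

lemma borel_prob_distr:
  fixes g :: "'a::topological_space \<Rightarrow> 'b::topological_space"
  assumes "g \<in> measurable \<mu> borel" "borel_prob \<mu>"
  shows "borel_prob (distr \<mu> borel g)"
  using assms by (simp add: borel_prob_def prob_space.prob_space_distr)

lemma measure_distr_borel:
  fixes g :: "'a::topological_space \<Rightarrow> 'b::topological_space"
  assumes "g \<in> measurable \<mu> borel" "borel_prob \<mu>" "clopen A"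
  shows "measure (distr \<mu> borel g) A = measure \<mu> (g -` A)"
  using assms by (subst measure_distr) (auto simp: clopen_def borel_prob_space)

lemma integral_Z_distr:
  assumes "cts f" "g \<in> measurable \<mu> borel"
  shows "integral_Z (distr \<mu> borel g) f = integral_Z \<mu> (\<lambda>x. f (g x))"
  unfolding integral_Z_def
proof (rule integral_distr[OF assms(2)])
  have "cts (\<lambda>x. real_of_int (f x))"
    by (rule continuous_discrete_comp[OF assms(1)])
  then show "(\<lambda>x. real_of_int (f x)) \<in> borel_measurable borel"
    by (rule borel_measurable_continuous_onI)
qed

lemma bij_inv_funpow:
  assumes "bij f"
  shows "(f ^^ n) ((inv_into UNIV f ^^ n) x) = x" "(inv_into UNIV f ^^ n) ((f ^^ n) x) = x"
proof -
  show "(f ^^ n) ((inv_into UNIV f ^^ n) x) = x" for x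
    using inv_fn[OF assms, of n] bij_fn[OF assms, of n] by (metis bij_is_surj surj_f_inv_f)
  show "(inv_into UNIV f ^^ n) ((f ^^ n) x) = x" for x
    using inv_fn[OF assms, of n] bij_fn[OF assms, of n] by (metis bij_is_inj inv_f_f)
qed

section \<open>Minimal systems: aperiodicity, return times and invariant measures\<close>

locale minimal_cantor =
  fixes T :: "'a::topological_space \<Rightarrow> 'a"
  assumes minimal: "minimal_cantor_system T"
begin

sublocale cantor_type "TYPE('a)"
  using minimal by unfold_locales (simp add: minimal_cantor_system_def)

lemma T_phomeo: "homeo T"
  using minimal by (simp add: minimal_cantor_system_def homeomorphic_map_euclidean_iff)

lemma bij_T: "bij T" and T_continuous: "cts T"
  using phomeo_UNIV[OF T_phomeo] by auto

lemma Tn_bij: "bij (T ^^ n)" and Tn_continuous: "cts (T ^^ n)"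
  using phomeo_UNIV[OF phomeo_funpow[OF T_phomeo]] by auto

lemma Tn_add: "(T ^^ m) ((T ^^ n) x) = (T ^^ (m + n)) x"
  by (simp add: funpow_add)

lemma orbit_meets:
  assumes "open U" "U \<noteq> {}"
  obtains n where "(T ^^ n) x \<in> U \<or> (inv_into UNIV T ^^ n) x \<in> U"
proof -
  have "U \<inter> orbit T x \<noteq> {}"
    using minimal assms open_Int_closure_eq_empty[OF assms(1), of "orbit T x"]
    by (simp add: minimal_cantor_system_def)
  then show ?thesis using that unfolding orbit_def by auto
qed

lemma clopen_avoid_finite:
  assumes "finite O'" "(z::'a) \<notin> O'"
  obtains U where "clopen U" "z \<in> U" "U \<inter> O' = {}"
proof -
  have "\<forall>y\<in>O'. \<exists>U. clopen U \<and> z \<in> U \<and> y \<notin> U"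
    using assms(2) clopen_separate by metis
  then obtain U where "\<And>y. y \<in> O' \<Longrightarrow> clopen (U y) \<and> z \<in> U y \<and> y \<notin> U y" by metis
  then show ?thesis using that[of "\<Inter>y\<in>O'. U y"] clopen_INT[OF assms(1), of U] by auto
qed

lemma infinite_UNIV: "infinite (UNIV :: 'a set)"
proof
  assume fin: "finite (UNIV :: 'a set)"
  fix x :: 'a
  obtain U where "clopen U" "x \<in> U" "U \<inter> (UNIV - {x}) = {}"
    using clopen_avoid_finite[of "UNIV - {x}" x] fin by (metis Diff_iff finite_Diff insertI1)
  moreover from this have "U = {x}" by auto
  ultimately show False using not_open_singleton[of x] by (simp add: clopen_def)
qed

text \<open>A periodic point has a finite two-sided orbit. Finite sets are closed, so density would
  make the whole space finite, which a perfect space is not.\<close>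

lemma aperiodic:
  assumes "n > 0"
  shows "(T ^^ n) x \<noteq> x"
proof
  assume per: "(T ^^ n) x = x"
  define O' where "O' = (\<lambda>i. (T ^^ i) x) ` {..<n}"
  have fwd: "(T ^^ k) x \<in> O'" for k
    using funpow_mod_eq[OF per, of k] assms unfolding O'_def by (metis image_eqI lessThan_iff mod_less_divisor)
  \<comment> \<open>A multiple of the period that is at least \<open>k\<close> turns a backward
    iterate into a forward one, so \<open>O'\<close> contains the backward orbit as well.\<close>
  have "(T ^^ (n * k)) x = x" for k
    using funpow_mod_eq[OF per, of "n * k"] by simp
  then have "(inv_into UNIV T ^^ k) x = (inv_into UNIV T ^^ k) ((T ^^ k) ((T ^^ (n * k - k)) x))" for k
    using assms by (simp add: Tn_add)
  then have bwd: "(inv_into UNIV T ^^ k) x \<in> O'" for k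
    using fwd by (simp add: bij_inv_funpow[OF bij_T])
  have "O' = UNIV"
  proof (rule ccontr)
    assume "O' \<noteq> UNIV"
    then obtain z where "z \<notin> O'" by auto
    then obtain U where U: "clopen U" "z \<in> U" "U \<inter> O' = {}"
      using clopen_avoid_finite[of O' z] unfolding O'_def by (metis finite_imageI finite_lessThan)
    then obtain k where "(T ^^ k) x \<in> U \<or> (inv_into UNIV T ^^ k) x \<in> U"
      using orbit_meets[of U x] unfolding clopen_def by (metis empty_iff)
    then show False using U(3) fwd bwd by blast
  qed
  then show False using infinite_UNIV by (simp add: O'_def) (metis finite_imageI finite_lessThan)
qed

lemma Tn_inj: "(T ^^ m) x = (T ^^ n) x \<Longrightarrow> m = n"
proof (induction m n rule: linorder_wlog)
  case (le m n)
  have "(T ^^ m) ((T ^^ (n - m)) x) = (T ^^ m) x" using le by (simp add: Tn_add)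
  then have "(T ^^ (n - m)) x = x" using Tn_bij by (metis bij_def injD)
  then show ?case using aperiodic[of "n - m" x] le by (metis diff_is_0_eq gr0I le_antisym)
qed simp

text \<open>Density of the two-sided orbit gives a hit at a time of either sign, and compactness
  bounds its absolute value by \<open>N\<close>. Applied to the point \<open>(T ^^ N) x\<close>,
  this becomes a hit of the orbit of \<open>x\<close> at a time between 0 and
  \<open>2 * N\<close>.\<close>

lemma visits:
  assumes "open U" "U \<noteq> {}"
  obtains N where "\<And>x. \<exists>i\<le>N. (T ^^ i) x \<in> U"
proof -
  define W where "W n = (T ^^ n) -` U \<union> (T ^^ n) ` U" for n
  have "\<exists>n. x \<in> W n" for x
  proof -
    obtain n where "(T ^^ n) x \<in> U \<or> (inv_into UNIV T ^^ n) x \<in> U" using orbit_meets[OF assms] by blast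
    then show ?thesis unfolding W_def using bij_inv_funpow(1)[OF bij_T, of n x]
      by (metis UnCI image_eqI vimageI)
  qed
  moreover have "open (W n)" for n
    using assms(1) phomeoD(4)[OF phomeo_funpow[OF T_phomeo], of U n] Tn_continuous
    by (auto simp: W_def continuous_on_open_vimage)
  ultimately obtain N where N: "\<And>x. \<exists>n\<le>N. x \<in> W n" using clopen_cover_finite[of W] by metis
  have "\<exists>i\<le>2*N. (T ^^ i) x \<in> U" for x
  proof -
    obtain n where n: "n \<le> N" "(T ^^ N) x \<in> W n" using N by blast
    consider "(T ^^ n) ((T ^^ N) x) \<in> U" | y where "y \<in> U" "(T ^^ N) x = (T ^^ n) y"
      using n(2) unfolding W_def by auto
    then show ?thesis
    proof cases
      case 1
      then show ?thesis using n(1) by (intro exI[of _ "n + N"]) (simp add: Tn_add)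
    next
      case 2
      have "(T ^^ n) ((T ^^ (N - n)) x) = (T ^^ n) y" using 2 n(1) by (simp add: Tn_add)
      then have "(T ^^ (N - n)) x = y" using Tn_bij by (metis bij_def injD)
      then show ?thesis using 2(1) n(1) by (intro exI[of _ "N - n"]) simp
    qed
  qed
  then show ?thesis using that by blast
qed

abbreviation M where "M \<equiv> invariant_measures T"

lemma M_borel_prob: "\<mu> \<in> M \<Longrightarrow> borel_prob \<mu>"
  by (simp add: invariant_measures_def borel_prob_def)

lemma M_integral_of_bool:
  "\<mu> \<in> M \<Longrightarrow> clopen A \<Longrightarrow> integral_Z \<mu> (\<lambda>x. of_bool (x \<in> A)) = measure \<mu> A"
  by (simp add: M_borel_prob integral_Z_of_bool)

lemma M_integral_Tn:
  assumes "\<mu> \<in> M" "cts f"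
  shows "integral_Z \<mu> (\<lambda>x. f ((T ^^ n) x)) = integral_Z \<mu> f"
  using assms(2)
proof (induction n arbitrary: f)
  case (Suc n)
  have "integral_Z \<mu> (\<lambda>x. f (T x)) = integral_Z (distr \<mu> borel T) f"
    using Suc.prems borel_prob_measurable[OF T_continuous M_borel_prob[OF assms(1)]] by (simp add: integral_Z_distr)
  then have "integral_Z \<mu> (\<lambda>x. f (T x)) = integral_Z \<mu> f"
    using assms(1) by (simp add: invariant_measures_def)
  moreover have "integral_Z \<mu> (\<lambda>x. f (T ((T ^^ n) x))) = integral_Z \<mu> (\<lambda>x. f (T x))"
    by (rule Suc.IH) (rule continuous_comp_UNIV[OF Suc.prems T_continuous])
  ultimately show ?case by simp
qed simp

lemma continuous_birkhoff:
  fixes f :: "'a \<Rightarrow> int"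
  assumes "cts f"
  shows "cts (\<lambda>x. \<Sum>i<n. f ((T ^^ i) x))"
  by (rule continuous_Z_sum) (auto intro: continuous_comp_UNIV[OF assms Tn_continuous])

lemma M_integral_birkhoff:
  assumes "\<mu> \<in> M" "cts f"
  shows "integral_Z \<mu> (\<lambda>x. \<Sum>i<n. f ((T ^^ i) x)) = real n * integral_Z \<mu> f"
proof -
  have "integral_Z \<mu> (\<lambda>x. \<Sum>i<n. f ((T ^^ i) x)) = (\<Sum>i<n. integral_Z \<mu> (\<lambda>x. f ((T ^^ i) x)))"
    using assms by (intro integral_Z_sum continuous_comp_UNIV[OF assms(2) Tn_continuous] M_borel_prob)
  then show ?thesis using M_integral_Tn[OF assms] by simp
qed

lemma M_measure_vimage:
  assumes "\<mu> \<in> M" "A \<in> sets borel"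
  shows "measure \<mu> ((T ^^ n) -` A) = measure \<mu> A"
  using assms(2)
proof (induction n arbitrary: A)
  case (Suc n)
  have "measure (distr \<mu> borel T) A = measure \<mu> (T -` A)"
    using Suc.prems borel_prob_measurable[OF T_continuous M_borel_prob[OF assms(1)]]
    by (simp add: measure_distr borel_prob_space[OF M_borel_prob[OF assms(1)]])
  then have 1: "measure \<mu> (T -` A) = measure \<mu> A" using assms(1) by (simp add: invariant_measures_def)
  have "T -` A \<in> sets borel"
    using measurable_sets[OF borel_measurable_continuous_onI[OF T_continuous] Suc.prems] by simp
  from Suc.IH[OF this] 1 show ?case by (simp add: vimage_def funpow_swap1)
qed simp

text \<open>A limit, along a filter finer than \<open>sequentially\<close>, of the empirical measures of orbit segments.\<close>

lemma invariant_measure_from_orbits: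
  fixes f :: "'a \<Rightarrow> int"
  assumes f: "cts f" and le: "\<And>N. (\<Sum>i<N. f ((T ^^ i) (x N))) \<le> 0"
  obtains \<mu> where "\<mu> \<in> M" "integral_Z \<mu> f \<le> 0"
proof -
  \<comment> \<open>The empirical measure of the first \<open>N\<close> points of the orbit of
    \<open>x N\<close>. For \<open>N = 0\<close> division by zero gives 0, so the total mass is 1
    only eventually.\<close>
  define e where "e N B = (\<Sum>i<N. of_bool ((T ^^ i) (x N) \<in> B)) / real N" for N and B :: "'a set"
  have e01: "0 \<le> e N B" "e N B \<le> 1" for N B
  proof -
    have "(\<Sum>i<N. of_bool ((T ^^ i) (x N) \<in> B)) \<le> (\<Sum>i<N. 1 :: real)" by (intro sum_mono) auto
    then show "0 \<le> e N B" "e N B \<le> 1" by (auto simp: e_def divide_le_eq_1 intro!: divide_nonneg_nonneg sum_nonneg)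
  qed
  \<comment> \<open>All values \<open>e N B\<close> together form a point of a product of unit
    intervals indexed by the subsets of the space. The index set is uncountable, so compactness
    gives a cluster point but no convergent subsequence; hence the filter \<open>F\<close>
    below.\<close>
  have "compactin (product_topology (\<lambda>_. euclidean) UNIV) (PiE UNIV (\<lambda>_ :: 'a set. {0..1::real}))"
    unfolding compactin_PiE by auto
  then have "compact (PiE UNIV (\<lambda>_ :: 'a set. {0..1::real}))"
    by (simp add: euclidean_product_topology)
  moreover have "eventually (\<lambda>y. y \<in> PiE UNIV (\<lambda>_ :: 'a set. {0..1::real})) (filtermap e sequentially)"
    using e01 unfolding eventually_filtermap by (intro always_eventually) auto
  moreover have "filtermap e sequentially \<noteq> bot" by (simp add: filtermap_bot_iff)
  ultimately obtain m where m: "inf (nhds m) (filtermap e sequentially) \<noteq> bot"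
    unfolding compact_filter by blast
  \<comment> \<open>Its members are sets of indices \<open>N\<close> that contain all large
    \<open>N\<close> for which \<open>e N\<close> is close enough to the cluster point.\<close>
  define F where "F = inf sequentially (filtercomap e (nhds m))"
  have F: "F \<noteq> bot"
  proof
    assume "F = bot"
    then have "eventually (\<lambda>_. False) F" by simp
    then obtain P Q where P: "eventually P sequentially" and Q: "eventually Q (filtercomap e (nhds m))"
      and PQ: "\<And>n. P n \<Longrightarrow> Q n \<Longrightarrow> False"
      unfolding F_def eventually_inf by auto
    obtain R where R: "eventually R (nhds m)" "\<And>n. R (e n) \<Longrightarrow> Q n"
      using Q unfolding eventually_filtercomap by auto
    have "eventually (\<lambda>y. \<not> R y) (filtermap e sequentially)"
      unfolding eventually_filtermap using P by (rule eventually_mono) (use PQ R(2) in auto)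
    then have "eventually (\<lambda>_. False) (inf (nhds m) (filtermap e sequentially))"
      unfolding eventually_inf using R(1) by blast
    then show False using m by (simp add: eventually_False)
  qed
  have Fseq: "F \<le> sequentially" by (simp add: F_def)
  have "filterlim e (nhds m) F"
    unfolding F_def by (rule filterlim_mono[OF filterlim_filtercomap order_refl]) simp
  then have lim: "((\<lambda>N. e N B) \<longlongrightarrow> m B) F" for B
    using continuous_on_tendsto_compose[OF continuous_on_product_coordinates[of B], of e m F] by simp
  have m0: "m B \<ge> 0" for B
    using tendsto_lowerbound[OF lim _ F] e01 by simp
  have "((\<lambda>N. e N UNIV) \<longlongrightarrow> 1) F"
  proof (rule tendsto_mono[OF Fseq], rule tendsto_eventually)
    show "eventually (\<lambda>N. e N UNIV = 1) sequentially"
      using eventually_gt_at_top[of 0] by (rule eventually_mono) (simp add: e_def)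
  qed
  then have m1: "m UNIV = 1" using tendsto_unique[OF F lim] by blast
  have add: "m (A \<union> B) = m A + m B" if "A \<inter> B = {}" for A B
  proof -
    have "e N (A \<union> B) = e N A + e N B" for N
    proof -
      have "of_bool (y \<in> A \<union> B) = (of_bool (y \<in> A) + of_bool (y \<in> B) :: real)" for y using that by auto
      then show ?thesis by (simp add: e_def sum.distrib add_divide_distrib)
    qed
    then have "((\<lambda>N. e N (A \<union> B)) \<longlongrightarrow> m A + m B) F" using tendsto_add[OF lim lim] by simp
    then show ?thesis using tendsto_unique[OF F lim] by blast
  qed
  obtain \<mu> where \<mu>: "borel_prob \<mu>" "\<And>A. clopen A \<Longrightarrow> measure \<mu> A = m A"
    using clopen_premeasure_extends[OF m0 m1 add] by blast
  have inv: "m (T -` B) = m B" for B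
  proof -
    \<comment> \<open>Shifting an orbit segment by one step only exchanges its end points, at a cost
      of at most \<open>1 / N\<close>.\<close>
    have diff: "e N (T -` B) - e N B = (of_bool ((T ^^ N) (x N) \<in> B) - of_bool (x N \<in> B)) / real N" for N
    proof -
      have "(\<Sum>i<N. of_bool ((T ^^ Suc i) (x N) \<in> B)) - (\<Sum>i<N. of_bool ((T ^^ i) (x N) \<in> B) :: real)
        = of_bool ((T ^^ N) (x N) \<in> B) - of_bool (x N \<in> B)"
        unfolding sum_subtractf[symmetric] using sum_lessThan_telescope[of "\<lambda>i. of_bool ((T ^^ i) (x N) \<in> B) :: real" N] by simp
      then show ?thesis by (simp add: e_def diff_divide_distrib[symmetric])
    qed
    have "((\<lambda>N. e N (T -` B) - e N B) \<longlongrightarrow> 0) sequentially"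
    proof (rule tendsto_sandwich[where f = "\<lambda>N. - (1 / real N)" and h = "\<lambda>N. 1 / real N"])
      show "\<forall>\<^sub>F N in sequentially. - (1 / real N) \<le> e N (T -` B) - e N B"
        "\<forall>\<^sub>F N in sequentially. e N (T -` B) - e N B \<le> 1 / real N"
        unfolding diff by (auto simp: divide_simps of_bool_def intro!: always_eventually)
      show "(\<lambda>N. 1 / real N) \<longlonglongrightarrow> 0" by (rule lim_1_over_n)
      then show "(\<lambda>N. - (1 / real N)) \<longlonglongrightarrow> 0" using tendsto_minus by fastforce
    qed
    then have "((\<lambda>N. e N (T -` B) - e N B) \<longlongrightarrow> 0) F" by (rule tendsto_mono[OF Fseq])
    then have "m (T -` B) - m B = 0" using tendsto_unique[OF F tendsto_diff[OF lim lim]] by blast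
    then show ?thesis by simp
  qed
  have Tm: "T \<in> measurable \<mu> borel" by (rule borel_prob_measurable[OF T_continuous \<mu>(1)])
  have "distr \<mu> borel T = \<mu>"
  proof (rule borel_prob_eqI[OF borel_prob_distr[OF Tm \<mu>(1)] \<mu>(1)])
    fix U :: "'a set" assume U: "clopen U"
    then show "measure (distr \<mu> borel T) U = measure \<mu> U"
      using \<mu>(2)[OF U] \<mu>(2)[of "T -` U"] inv phomeo_UNIV(4)[OF T_phomeo]
      by (simp add: measure_distr_borel[OF Tm \<mu>(1) U])
  qed
  then have "\<mu> \<in> M" using \<mu>(1) by (simp add: invariant_measures_def borel_prob_def)
  moreover have "integral_Z \<mu> f \<le> 0"
  proof -
    have fin: "finite (range f)" by (rule finite_range_discrete[OF f])
    have L1: "(\<Sum>k\<in>range f. of_int k * e N (f -` {k})) \<le> 0" for N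
    proof -
      have "(\<Sum>k\<in>range f. of_int k * e N (f -` {k}))
        = (\<Sum>k\<in>range f. \<Sum>i<N. if k = f ((T ^^ i) (x N)) then of_int k else 0) / real N"
        by (simp add: e_def sum_divide_distrib sum_distrib_left of_bool_def if_distrib cong: if_cong)
           (intro sum.cong refl, auto)
      also have "\<dots> = (\<Sum>i<N. of_int (f ((T ^^ i) (x N)))) / real N"
        using fin by (subst sum.swap) simp
      also have "\<dots> = of_int (\<Sum>i<N. f ((T ^^ i) (x N))) / real N" by simp
      also have "\<dots> \<le> 0" using le[of N] by (intro divide_nonpos_nonneg) (simp_all only: of_int_le_0_iff of_nat_0_le_iff)
      finally show ?thesis .
    qed
    have L2: "((\<lambda>N. \<Sum>k\<in>range f. of_int k * e N (f -` {k})) \<longlongrightarrow> (\<Sum>k\<in>range f. of_int k * m (f -` {k}))) F"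
      by (intro tendsto_sum tendsto_mult tendsto_const lim)
    have "(\<Sum>k\<in>range f. of_int k * m (f -` {k})) \<le> 0"
      by (rule tendsto_upperbound[OF L2 _ F]) (simp add: L1)
    then show ?thesis
      unfolding integral_Z_range[OF f \<mu>(1)] using \<mu>(2) clopen_vimage_discrete[OF f] by simp
  qed
  ultimately show ?thesis using that by blast
qed

text \<open>If every length \<open>N\<close> had a point with nonpositive sum, the empirical
  measures along these segments would have an invariant limit with nonpositive integral. The gain is
  a single length \<open>N\<close> that serves all points.\<close>

lemma positive_birkhoff_sums:
  fixes f :: "'a \<Rightarrow> int"
  assumes "cts f" "\<And>\<mu>. \<mu> \<in> M \<Longrightarrow> integral_Z \<mu> f > 0"
  obtains N where "\<And>x. (\<Sum>i<N. f ((T ^^ i) x)) > 0"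
proof (rule ccontr)
  assume "\<not> thesis"
  then have "\<forall>N. \<exists>x. (\<Sum>i<N. f ((T ^^ i) x)) \<le> 0" using that by (metis not_less)
  then obtain x where "\<And>N. (\<Sum>i<N. f ((T ^^ i) (x N))) \<le> 0" by metis
  from invariant_measure_from_orbits[OF assms(1) this] assms(2) show False by (metis not_less)
qed

text \<open>Without invariant measures the hypothesis of \<open>positive_birkhoff_sums\<close> would
  hold vacuously for the constant -1, whose sums are never positive.\<close>

lemma M_nonempty: "M \<noteq> {}"
  using positive_birkhoff_sums[of "\<lambda>_. -1"] by (auto simp: sum_negf)

text \<open>Every orbit segment of a certain length visits \<open>E\<close>; integrating the number
  of visits gives a lower bound that is uniform in \<open>\<mu>\<close>.\<close>

lemma positive_measure:
  assumes "clopen E" "E \<noteq> {}"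
  obtains N :: nat where "\<And>\<mu>. \<mu> \<in> M \<Longrightarrow> 1 \<le> real N * measure \<mu> E"
proof -
  obtain N where N: "\<And>x. \<exists>i\<le>N. (T ^^ i) x \<in> E" using visits assms by (metis clopen_def)
  have "1 \<le> real (Suc N) * measure \<mu> E" if \<mu>: "\<mu> \<in> M" for \<mu>
  proof -
    let ?f = "\<lambda>x. of_bool (x \<in> E) :: int"
    have f: "cts ?f" by (rule continuous_of_bool[OF assms(1)])
    have "1 \<le> (\<Sum>i<Suc N. ?f ((T ^^ i) x))" for x
    proof -
      obtain i where "i < Suc N" "(T ^^ i) x \<in> E" using N[of x] by (auto simp: less_Suc_eq_le)
      then have "?f ((T ^^ i) x) \<le> (\<Sum>i<Suc N. ?f ((T ^^ i) x))" by (intro member_le_sum) auto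
      then show ?thesis using \<open>(T ^^ i) x \<in> E\<close> by simp
    qed
    then have "integral_Z \<mu> (\<lambda>x. 1) \<le> integral_Z \<mu> (\<lambda>x. \<Sum>i<Suc N. ?f ((T ^^ i) x))"
      by (intro integral_Z_mono continuous_birkhoff f M_borel_prob[OF \<mu>]) auto
    then show ?thesis
      unfolding M_integral_birkhoff[OF \<mu> f] integral_Z_const[OF M_borel_prob[OF \<mu>]]
        M_integral_of_bool[OF \<mu> assms(1)] by simp
  qed
  then show ?thesis using that by blast
qed

lemma positive_clopen:
  assumes "clopen E" "E \<noteq> {}" "\<mu> \<in> M"
  shows "measure \<mu> E > 0"
  using positive_measure[OF assms(1,2)] assms(3)
  by (metis measure_nonneg less_eq_real_def mult_zero_right not_one_le_zero)

lemma positive_integral: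
  fixes f :: "'a \<Rightarrow> int"
  assumes "cts f" "\<And>x. f x \<ge> 0" "f y \<noteq> 0" "\<mu> \<in> M"
  shows "integral_Z \<mu> f > 0"
proof -
  let ?E = "f -` {1..}"
  have E: "clopen ?E" by (rule clopen_vimage_discrete[OF assms(1)])
  have "f y \<ge> 1" using assms(2)[of y] assms(3) by linarith
  then have "?E \<noteq> {}" by auto
  then have "measure \<mu> ?E > 0" by (rule positive_clopen[OF E _ assms(4)])
  moreover have "measure \<mu> ?E \<le> integral_Z \<mu> f"
    unfolding M_integral_of_bool[OF assms(4) E, symmetric]
    using assms by (intro integral_Z_mono continuous_of_bool E M_borel_prob) auto
  ultimately show ?thesis by simp
qed

text \<open>By aperiodicity \<open>d\<close> has a neighbourhood \<open>W\<close> whose points do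
  not return to it within \<open>N\<close> steps. An orbit segment of length \<open>Suc N\<close>
  meets \<open>W\<close> at most once, so \<open>Suc N\<close> times its measure is at most 1, while
  with the \<open>N\<close> of \<open>positive_measure\<close> already \<open>N\<close> times the
  measure of \<open>E\<close> is at least 1.\<close>

lemma small_clopen:
  assumes "clopen E" "E \<noteq> {}"
  obtains W where "clopen W" "d \<in> W" "\<And>\<mu>. \<mu> \<in> M \<Longrightarrow> measure \<mu> W < measure \<mu> E"
proof -
  obtain N :: nat where N: "\<And>\<mu>. \<mu> \<in> M \<Longrightarrow> 1 \<le> real N * measure \<mu> E" using positive_measure[OF assms] by metis
  have "\<exists>G. clopen G \<and> d \<in> G \<and> (T ^^ i) -` G \<inter> G = {}" if i: "i > 0" for i
  proof -
    obtain G where G: "clopen G" "d \<in> G" "(T ^^ i) d \<notin> G"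
      using clopen_separate[of d "(T ^^ i) d"] aperiodic[OF i, of d] by metis
    then show ?thesis
      using phomeo_UNIV(4)[OF phomeo_funpow[OF T_phomeo], of i G]
      by (intro exI[of _ "G - (T ^^ i) -` G"]) auto
  qed
  then obtain G where G: "\<And>i. i > 0 \<Longrightarrow> clopen (G i) \<and> d \<in> G i \<and> (T ^^ i) -` G i \<inter> G i = {}" by metis
  define W where "W = (\<Inter>i\<in>{1..N}. G i)"
  have W: "clopen W" "d \<in> W" using G by (auto simp: W_def intro!: clopen_INT)
  have disj: "\<not> ((T ^^ i) x \<in> W \<and> (T ^^ j) x \<in> W)" if "i < j" "j \<le> N" for i j x
  proof
    assume a: "(T ^^ i) x \<in> W \<and> (T ^^ j) x \<in> W"
    have "j - i \<in> {1..N}" using that by auto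
    then have "(T ^^ i) x \<in> G (j - i)" "(T ^^ (j - i)) ((T ^^ i) x) \<in> G (j - i)"
      using a that by (auto simp: W_def Tn_add)
    then show False using G[of "j - i"] that by auto
  qed
  let ?f = "\<lambda>x. of_bool (x \<in> W) :: int"
  have f: "cts ?f" by (rule continuous_of_bool[OF W(1)])
  have le1: "(\<Sum>i<Suc N. ?f ((T ^^ i) x)) \<le> 1" for x
  proof (cases "\<exists>i<Suc N. (T ^^ i) x \<in> W")
    case True
    then obtain i where i: "i < Suc N" "(T ^^ i) x \<in> W" by blast
    have "?f ((T ^^ j) x) = (if j = i then 1 else 0)" if "j < Suc N" for j
      using disj[of i j x] disj[of j i x] i that by (cases i j rule: linorder_cases) auto
    then have "(\<Sum>j<Suc N. ?f ((T ^^ j) x)) = (\<Sum>j<Suc N. if j = i then 1 else 0)" by (intro sum.cong) auto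
    then show ?thesis using i by simp
  qed simp
  have "measure \<mu> W < measure \<mu> E" if \<mu>: "\<mu> \<in> M" for \<mu>
  proof -
    have "integral_Z \<mu> (\<lambda>x. \<Sum>i<Suc N. ?f ((T ^^ i) x)) \<le> integral_Z \<mu> (\<lambda>x. 1)"
      by (intro integral_Z_mono continuous_birkhoff f M_borel_prob[OF \<mu>] le1) auto
    then have "real (Suc N) * measure \<mu> W \<le> 1"
      unfolding M_integral_birkhoff[OF \<mu> f] integral_Z_const[OF M_borel_prob[OF \<mu>]]
        M_integral_of_bool[OF \<mu> W(1)] by simp
    then have 1: "real N * measure \<mu> W + measure \<mu> W \<le> real N * measure \<mu> E"
      using N[OF \<mu>] by (simp add: algebra_simps)
    have "measure \<mu> E > 0" by (rule positive_clopen[OF assms \<mu>])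
    show ?thesis
    proof (rule ccontr)
      assume "\<not> ?thesis"
      then have "real N * measure \<mu> E \<le> real N * measure \<mu> W" "measure \<mu> W > 0"
        using \<open>measure \<mu> E > 0\<close> by (auto intro: mult_left_mono)
      then show False using 1 by linarith
    qed
  qed
  then show ?thesis using W that by blast
qed

text \<open>\<open>q\<close> is the backlog of a queue with arrivals \<open>f\<close> and service capacity \<open>g\<close>, run along the
  orbit in reverse time; \<open>f'\<close> is the amount served.\<close>

lemma cohomologous_below:
  fixes f g :: "'a \<Rightarrow> int"
  assumes f: "cts f" "\<And>x. f x \<ge> 0" and g: "cts g" "\<And>x. g x \<ge> 0"
    and less: "\<And>\<mu>. \<mu> \<in> M \<Longrightarrow> integral_Z \<mu> f < integral_Z \<mu> g"
  obtains f' where "cts f'" "\<And>x. 0 \<le> f' x" "\<And>x. f' x \<le> g x"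
    "\<And>\<mu>. \<mu> \<in> M \<Longrightarrow> integral_Z \<mu> f' = integral_Z \<mu> f"
proof -
  let ?h = "\<lambda>x. f x - g x"
  have h: "cts ?h" by (rule continuous_Z_diff[OF f(1) g(1)])
  obtain N where N: "\<And>x. (\<Sum>i<N. g ((T ^^ i) x) - f ((T ^^ i) x)) > 0"
  proof (rule positive_birkhoff_sums[OF continuous_Z_diff[OF g(1) f(1)]])
    show "integral_Z \<mu> (\<lambda>x. g x - f x) > 0" if "\<mu> \<in> M" for \<mu>
      using less[OF that] integral_Z_diff[OF g(1) f(1) M_borel_prob[OF that]] by simp
  qed blast
  define s where "s n x = (\<Sum>i<n. ?h ((T ^^ i) x))" for n x
  have sN: "s N x < 0" for x using N[of x] by (simp add: s_def sum_subtractf)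
  have s0: "s 0 x = 0" for x by (simp add: s_def)
  have sS: "s (Suc n) x = ?h x + s n (T x)" for n x
    unfolding s_def by (subst sum.lessThan_Suc_shift) (simp add: funpow_swap1)
  have Npos: "N > 0" using sN s0 by (metis less_irrefl gr0I)
  \<comment> \<open>The largest partial sum, the empty one included, solves the recursion
    \<open>q_eq\<close>; the cut-off at \<open>N\<close> makes it continuous.\<close>
  define q where "q x = Max ((\<lambda>n. s n x) ` {..N})" for x
  have q_cont: "cts q"
    unfolding q_def s_def by (intro continuous_Z_Max continuous_birkhoff h)
  have q_ge: "s n x \<le> q x" if "n \<le> N" for n x using that by (auto simp: q_def)
  \<comment> \<open>The recursion at \<open>x\<close> uses one term beyond the cut-off. That term
    cannot be the maximum, because \<open>s N (T x) < 0\<close> puts it below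
    \<open>s 1 x\<close>.\<close>
  have q_ge': "s n x \<le> q x" if n: "n \<le> Suc N" for n x
  proof (cases "n = Suc N")
    case True
    have "s (Suc N) x < s 1 x" using sS[of N x] sS[of 0 x] sN[of "T x"] s0 by simp
    then show ?thesis using q_ge[of 1 x] Npos True by simp
  qed (use n q_ge in auto)
  have q_ex: "\<exists>n\<le>N. q x = s n x" for x
  proof -
    have "q x \<in> (\<lambda>n. s n x) ` {..N}" unfolding q_def by (intro Max_in) auto
    then show ?thesis by auto
  qed
  have q_eq: "q x = max 0 (?h x + q (T x))" for x
  proof (rule antisym)
    obtain n where n: "n \<le> N" "q x = s n x" using q_ex by blast
    show "q x \<le> max 0 (?h x + q (T x))"
    proof (cases n)
      case 0
      then show ?thesis using n s0 by simp
    next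
      case (Suc k)
      then show ?thesis using n sS[of k x] q_ge[of k "T x"] by simp
    qed
    obtain k where k: "k \<le> N" "q (T x) = s k (T x)" using q_ex by blast
    then show "max 0 (?h x + q (T x)) \<le> q x"
      using q_ge'[of 0 x] q_ge'[of "Suc k" x] sS[of k x] s0[of x] by simp
  qed
  have q_pos: "q x \<ge> 0" for x using q_eq[of x] by simp
  \<comment> \<open>Arrivals plus the backlog taken over from \<open>T x\<close>, minus the backlog
    passed on. This changes \<open>f\<close> by a coboundary, so invariant integrals stay the
    same.\<close>
  define f' where "f' x = f x + q (T x) - q x" for x
  have qT: "cts (\<lambda>x. q (T x))" by (rule continuous_comp_UNIV[OF q_cont T_continuous])
  have "cts f'"
    unfolding f'_def by (intro continuous_Z_diff continuous_Z_add f qT q_cont)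
  moreover have "0 \<le> f' x" "f' x \<le> g x" for x
    using q_eq[of x] q_pos[of "T x"] f(2)[of x] g(2)[of x] by (auto simp: f'_def)
  moreover have "integral_Z \<mu> f' = integral_Z \<mu> f" if \<mu>: "\<mu> \<in> M" for \<mu>
    unfolding f'_def
    using integral_Z_diff[OF continuous_Z_add[OF f(1) qT] q_cont M_borel_prob[OF \<mu>]]
      integral_Z_add[OF f(1) qT M_borel_prob[OF \<mu>]] M_integral_Tn[OF \<mu> q_cont, of 1] by simp
  ultimately show ?thesis using that by blast
qed

end

section \<open>Homeomorphisms moving points forward along orbits\<close>

definition forward :: "('a \<Rightarrow> 'a) \<Rightarrow> 'a \<Rightarrow> 'a \<Rightarrow> bool" where
  "forward T x y \<longleftrightarrow> (\<exists>n>0. y = (T ^^ n) x)"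

context minimal_cantor
begin

text \<open>Match visits to \<open>A\<close>, read as opening brackets, with visits to \<open>D\<close>, read as closing
  brackets, along each orbit.\<close>

lemma forward_matching:
  assumes A: "clopen A" and D: "clopen D"
    and less: "\<And>\<mu>. \<mu> \<in> M \<Longrightarrow> measure \<mu> A < measure \<mu> D"
  obtains g where "phomeo A (g ` A) g" "g ` A \<subseteq> D" "clopen (g ` A)" "\<And>x. x \<in> A \<Longrightarrow> forward T x (g x)"
proof -
  let ?a = "\<lambda>x. of_bool (x \<in> A) :: int" and ?d = "\<lambda>x. of_bool (x \<in> D) :: int"
  \<comment> \<open>Closing brackets are read one step ahead: \<open>s n x\<close> counts visits to
    \<open>D\<close> at times 1 to \<open>n\<close> against visits to \<open>A\<close> at times 0 to
    \<open>n - 1\<close>. A point of \<open>A \<inter> D\<close> is thus not matched with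
    itself.\<close>
  define h where "h x = ?d (T x) - ?a x" for x
  have a: "cts ?a" and d: "cts ?d"
    using A D by (auto intro: continuous_of_bool)
  have dT: "cts (\<lambda>x. ?d (T x))" by (rule continuous_comp_UNIV[OF d T_continuous])
  have h: "cts h" unfolding h_def by (rule continuous_Z_diff[OF dT a])
  obtain N where N: "\<And>x. (\<Sum>i<N. h ((T ^^ i) x)) > 0"
  proof (rule positive_birkhoff_sums[OF h])
    fix \<mu> assume \<mu>: "\<mu> \<in> M"
    show "integral_Z \<mu> h > 0"
      unfolding h_def
      using integral_Z_diff[OF dT a M_borel_prob[OF \<mu>]] M_integral_Tn[OF \<mu> d, of 1] less[OF \<mu>]
        M_integral_of_bool[OF \<mu>] A D by simp
  qed blast
  define s where "s n x = (\<Sum>i<n. h ((T ^^ i) x))" for n x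
  have s_cont: "cts (s n)" for n
    unfolding s_def by (rule continuous_birkhoff[OF h])
  have s_add: "s (m + n) x = s m x + s n ((T ^^ m) x)" for m n x
  proof (induction n)
    case (Suc n)
    have "s (m + Suc n) x = s (m + n) x + h ((T ^^ n) ((T ^^ m) x))"
      by (simp add: s_def Tn_add add.commute)
    then show ?case using Suc by (simp add: s_def)
  qed (simp add: s_def)
  have Npos: "N > 0" using N[of undefined] by (cases N) auto
  define p where "p x = (LEAST n. 0 < n \<and> s n x \<ge> 0)" for x
  have ex: "0 < N \<and> s N x \<ge> 0" for x using N[of x] Npos by (simp add: s_def)
  have p: "0 < p x" "s (p x) x \<ge> 0" for x
    using LeastI[of "\<lambda>n. 0 < n \<and> s n x \<ge> 0", OF ex] by (auto simp: p_def)
  have p_le: "p x \<le> N" for x unfolding p_def by (rule Least_le) (rule ex)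
  have p_least: "s n x < 0" if "0 < n" "n < p x" for n x
    using not_less_Least[of n "\<lambda>n. 0 < n \<and> s n x \<ge> 0"] that by (auto simp: p_def)
  have step: "s (p x) x = s (p x - 1) x + h ((T ^^ (p x - 1)) x)" for x
    using p(1)[of x] by (cases "p x") (auto simp: s_def)
  \<comment> \<open>For \<open>x\<close> in \<open>A\<close> the first term is at most 0 and all
    later terms are at most 1, so the first return to a nonnegative value ends exactly at 0, and its
    last step is a visit to \<open>D\<close>.\<close>
  have hit: "s (p x) x = 0 \<and> (T ^^ p x) x \<in> D" if "x \<in> A" for x
  proof -
    let ?y = "(T ^^ (p x - 1)) x"
    have y: "T ?y = (T ^^ p x) x" using p(1)[of x] by (cases "p x") auto
    show ?thesis
    proof (cases "p x = 1")
      case True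
      then have "h x \<ge> 0" "s (p x) x = h x" using step[of x] p(2)[of x] by (auto simp: s_def)
      then show ?thesis using that True by (auto simp: h_def of_bool_def split: if_splits)
    next
      case False
      then have "s (p x - 1) x < 0" using p(1)[of x] by (intro p_least) auto
      then have "h ?y > 0" "h ?y + s (p x - 1) x \<ge> 0" using step[of x] p(2)[of x] by auto
      then show ?thesis using \<open>s (p x - 1) x < 0\<close> y step[of x]
        by (auto simp: h_def of_bool_def split: if_splits)
    qed
  qed
  define g where "g x = (T ^^ p x) x" for x
  \<comment> \<open>Two points with the same partner lie on one orbit, \<open>y\<close> being
    \<open>?k\<close> steps after \<open>x\<close>. The sum from \<open>y\<close> to the partner
    vanishes, hence so does the sum from \<open>x\<close> to \<open>y\<close>, and \<open>x\<close>
    would have been matched earlier unless \<open>?k = 0\<close>.\<close>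
  have inj': "x = y" if "x \<in> A" "y \<in> A" "g x = g y" "p y \<le> p x" for x y
  proof -
    let ?k = "p x - p y"
    have "(T ^^ p y) ((T ^^ ?k) x) = (T ^^ p y) y" using that by (simp add: g_def Tn_add)
    then have k: "(T ^^ ?k) x = y" using Tn_bij by (metis bij_def injD)
    have "s (?k + p y) x = s ?k x + s (p y) y" using s_add[of ?k "p y" x] k by simp
    then have "s ?k x = 0" using hit that by simp
    moreover have "?k < p x" using p(1)[of y] p(1)[of x] by simp
    ultimately have "?k = 0" using p_least[of ?k x] by (metis gr0I less_irrefl)
    then show "x = y" using k by simp
  qed
  have inj: "inj_on g A"
    by (rule inj_onI) (metis inj' nle_le)
  have P_open: "clopen {x. p x = n}" for n
  proof -
    have "{x. p x = n} = (if n = 0 then {} else s n -` {0..} \<inter> (\<Inter>m\<in>{1..<n}. s m -` {..<0}))"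
    proof (cases "n = 0")
      case False
      have "p x = n \<longleftrightarrow> s n x \<ge> 0 \<and> (\<forall>m\<in>{1..<n}. s m x < 0)" for x
      proof
        assume "p x = n"
        then show "s n x \<ge> 0 \<and> (\<forall>m\<in>{1..<n}. s m x < 0)" using p[of x] p_least[of _ x] by auto
      next
        assume r: "s n x \<ge> 0 \<and> (\<forall>m\<in>{1..<n}. s m x < 0)"
        have "\<not> p x < n"
        proof
          assume "p x < n"
          then have "p x \<in> {1..<n}" using p(1)[of x] by auto
          then show False using r p(2)[of x] by (metis not_less)
        qed
        moreover have "\<not> n < p x" using p_least[of n x] False r by auto
        ultimately show "p x = n" by simp
      qed
      then show ?thesis using False by auto
    qed (use p(1) in force)
    then show ?thesis using clopen_vimage_discrete[OF s_cont] by (auto intro!: clopen_Int clopen_INT)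
  qed
  \<comment> \<open>\<open>p\<close> is bounded with clopen level sets, so \<open>g\<close> is a
    finite patchwork of powers of \<open>T\<close>.\<close>
  have im: "g ` U = (\<Union>n\<le>N. (T ^^ n) ` (U \<inter> {x. p x = n}))" for U
    using p_le by (auto simp: g_def)
  have "open (g ` U) \<longleftrightarrow> open U" if U: "U \<subseteq> A" for U
  proof
    assume "open U"
    then have "open ((T ^^ n) ` (U \<inter> {x. p x = n}))" for n
      using phomeoD(4)[OF phomeo_funpow[OF T_phomeo]] P_open[of n] by (auto simp: clopen_def)
    then show "open (g ` U)" unfolding im by auto
  next
    assume o: "open (g ` U)"
    have U_eq: "U = (\<Union>n\<le>N. A \<inter> {x. p x = n} \<inter> (T ^^ n) -` (g ` U))"
    proof (intro subset_antisym subsetI)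
      fix x assume "x \<in> U"
      then show "x \<in> (\<Union>n\<le>N. A \<inter> {x. p x = n} \<inter> (T ^^ n) -` (g ` U))"
        using p_le[of x] U by (auto simp: g_def)
    next
      fix x assume "x \<in> (\<Union>n\<le>N. A \<inter> {x. p x = n} \<inter> (T ^^ n) -` (g ` U))"
      then have "x \<in> A" "g x \<in> g ` U" by (auto simp: g_def)
      then show "x \<in> U" using inj U by (auto simp: inj_on_def)
    qed
    have "open (A \<inter> {x. p x = n} \<inter> (T ^^ n) -` (g ` U))" for n
      using o P_open[of n] A Tn_continuous[of n] by (auto simp: clopen_def continuous_on_open_vimage)
    then have "open (\<Union>n\<le>N. A \<inter> {x. p x = n} \<inter> (T ^^ n) -` (g ` U))" by blast
    then show "open U" by (subst U_eq)
  qed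
  then have ph: "phomeo A (g ` A) g" using inj by (simp add: phomeo_def bij_betw_def)
  have cl: "clopen (g ` A)"
    unfolding im using A P_open phomeo_UNIV(3)[OF phomeo_funpow[OF T_phomeo]]
    by (intro clopen_UN) auto
  have sub: "g ` A \<subseteq> D" using hit by (auto simp: g_def)
  show ?thesis
    by (rule that[OF ph sub cl]) (use p(1) in \<open>auto simp: forward_def g_def\<close>)
qed

text \<open>The time hidden in \<open>forward\<close> need not be continuous, so clopen pieces are
  not at hand. The pieces \<open>E n\<close> on which \<open>g\<close> equals the
  \<open>n\<close>-th power are closed because both maps are continuous, and disjoint because no
  point is periodic; countable additivity does the rest.\<close>

lemma forward_phomeo_preserves:
  assumes g: "phomeo A B g" and A: "clopen A" and U: "clopen U" "U \<subseteq> A"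
    and fw: "\<And>x. x \<in> A \<Longrightarrow> forward T x (g x)" and \<mu>: "\<mu> \<in> M"
  shows "measure \<mu> (g ` U) = measure \<mu> U"
proof -
  interpret prob_space \<mu> using \<mu> by (simp add: invariant_measures_def)
  have sets: "sets \<mu> = sets borel" using \<mu> by (simp add: invariant_measures_def)
  define E where "E n = {x\<in>U. g x = (T ^^ n) x}" for n
  have closedE: "closed (E n)" for n
  proof -
    have "open (- E n)"
    proof (subst open_subopen, safe)
      fix x assume x: "x \<notin> E n"
      show "\<exists>W. open W \<and> x \<in> W \<and> W \<subseteq> - E n"
      proof (cases "x \<in> U")
        case False
        then show ?thesis using U by (intro exI[of _ "- U"]) (auto simp: clopen_def E_def)
      next
        case True
        then have "g x \<noteq> (T ^^ n) x" using x by (simp add: E_def)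
        then obtain G where G: "clopen G" "g x \<in> G" "(T ^^ n) x \<notin> G" using clopen_separate by metis
        have "g ` U \<inter> G = g ` {y\<in>U. g y \<in> G}" by auto
        moreover have "open (g ` U \<inter> G)"
          using phomeoD(4)[OF g U(2)] U(1) G(1) by (auto simp: clopen_def)
        ultimately have 1: "open {y\<in>U. g y \<in> G}"
          using phomeoD(4)[OF g, of "{y\<in>U. g y \<in> G}"] U(2) by auto
        have "open (- G)" using G(1) by (simp add: clopen_def open_Compl)
        then have 2: "open ((T ^^ n) -` (- G))"
          using Tn_continuous[of n] by (simp add: continuous_on_open_vimage)
        show ?thesis
          by (rule exI[of _ "{y\<in>U. g y \<in> G} \<inter> (T ^^ n) -` (- G)"])
             (use 1 2 G True in \<open>auto simp: E_def\<close>)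
      qed
    qed
    then show ?thesis by (simp add: closed_def)
  qed
  then have Eset: "E n \<in> sets \<mu>" for n using sets by auto
  have Euniq: "m = n" if "x \<in> E m" "x \<in> E n" for x m n
    using that Tn_inj by (auto simp: E_def)
  have UE: "U = (\<Union>n. E n)" using U(2) fw unfolding E_def forward_def by blast
  have gE: "g ` E n = (T ^^ n) ` E n" for n by (auto simp: E_def)
  have vE: "(T ^^ n) ` E n = (inv_into UNIV (T ^^ n)) -` E n" for n
    using bij_vimage_eq_inv_image[OF bij_imp_bij_inv[OF Tn_bij[of n]], of "E n"] Tn_bij[of n]
    by (simp add: inv_inv_eq)
  have inv_cont: "cts (inv_into UNIV (T ^^ n))" for n
    by (rule phomeo_UNIV(2)[OF phomeo_inv[OF phomeo_funpow[OF T_phomeo]]])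
  have gEset: "g ` E n \<in> sets \<mu>" for n
    unfolding gE vE sets using inv_cont closedE by (auto simp: continuous_on_closed_vimage)
  have gEm: "measure \<mu> (g ` E n) = measure \<mu> (E n)" for n
    using M_measure_vimage[OF \<mu>, of "g ` E n" n] gEset[of n] sets Tn_bij[of n]
    unfolding gE by (simp add: bij_is_inj inj_vimage_image_eq)
  have "disjoint_family E" using Euniq by (auto simp: disjoint_family_on_def)
  then have "(\<lambda>n. measure \<mu> (E n)) sums measure \<mu> U"
    unfolding UE using Eset by (intro finite_measure_UNION) auto
  moreover have "(\<lambda>n. measure \<mu> (g ` E n)) sums measure \<mu> (g ` U)"
  proof -
    have "disjoint_family (\<lambda>n. g ` E n)"
      unfolding disjoint_family_on_def
    proof (intro ballI impI)
      fix m n :: nat assume "m \<noteq> n"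
      moreover have "x = y" if "x \<in> U" "y \<in> U" "g x = g y" for x y
        using that phomeoD(2)[OF g] U(2) by (auto simp: inj_on_def)
      ultimately show "g ` E m \<inter> g ` E n = {}" using Euniq by (auto simp: E_def) metis
    qed
    then show ?thesis
      unfolding UE image_UN using gEset by (intro finite_measure_UNION) auto
  qed
  ultimately show ?thesis unfolding gEm by (metis sums_unique2)
qed

end

text \<open>Time reversal is used to exchange sources and targets of forward maps, and to look back
  along an orbit for its last visit to a set.\<close>

lemma inverse_minimal_cantor_system:
  fixes T :: "'a::topological_space \<Rightarrow> 'a"
  assumes "minimal_cantor_system T"
  shows "minimal_cantor_system (inv_into UNIV T)"
proof -
  have T: "homeo T"
    using assms by (simp add: minimal_cantor_system_def homeomorphic_map_euclidean_iff)
  then have "inv_into UNIV (inv_into UNIV T) = T" using phomeo_UNIV(1) inv_inv_eq by blast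
  then have "orbit (inv_into UNIV T) x = orbit T x" for x by (auto simp: orbit_def)
  then show ?thesis
    using assms phomeo_inv[OF T] by (simp add: minimal_cantor_system_def homeomorphic_map_euclidean_iff)
qed

lemma inverse_invariant_measures:
  fixes T :: "'a::topological_space \<Rightarrow> 'a"
  assumes "minimal_cantor_system T"
  shows "invariant_measures (inv_into UNIV T) = invariant_measures T"
proof -
  have sub: "invariant_measures T \<subseteq> invariant_measures (inv_into UNIV T)"
    if "minimal_cantor_system T" for T :: "'a \<Rightarrow> 'a"
  proof
    fix \<mu> assume \<mu>: "\<mu> \<in> invariant_measures T"
    interpret T: minimal_cantor T by unfold_locales fact
    interpret T': minimal_cantor "inv_into UNIV T"
      by unfold_locales (rule inverse_minimal_cantor_system[OF that])
    have sets: "sets \<mu> = sets borel" using \<mu> by (simp add: invariant_measures_def)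
    have Tm: "T \<in> measurable \<mu> borel"
      by (rule borel_prob_measurable[OF T.T_continuous T.M_borel_prob[OF \<mu>]])
    have T'm: "inv_into UNIV T \<in> measurable borel borel"
      by (rule borel_measurable_continuous_onI[OF T'.T_continuous])
    have "distr \<mu> borel (inv_into UNIV T) = distr (distr \<mu> borel T) borel (inv_into UNIV T)"
      using \<mu> by (simp add: invariant_measures_def)
    also have "\<dots> = distr \<mu> borel (inv_into UNIV T \<circ> T)" by (rule distr_distr[OF T'm Tm])
    also have "inv_into UNIV T \<circ> T = (\<lambda>x. x)" using T.bij_T by (auto simp: bij_is_inj)
    also have "distr \<mu> borel (\<lambda>x. x) = \<mu>" by (rule distr_id2[OF sets[symmetric]])
    finally show "\<mu> \<in> invariant_measures (inv_into UNIV T)"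
      using \<mu> by (simp add: invariant_measures_def)
  qed
  have "bij T" using assms by (simp add: minimal_cantor_system_def homeomorphic_map_euclidean_iff phomeo_UNIV)
  then show ?thesis
    using sub[OF assms] sub[OF inverse_minimal_cantor_system[OF assms]] by (simp add: inv_inv_eq)
qed

text \<open>Off \<open>a0\<close> the sets \<open>A - A' n\<close> exhaust \<open>A\<close>, and
  openness can be tested on each of them. An open set containing \<open>a0\<close> contains some
  \<open>A' n\<close>, whose image \<open>D' n\<close> is a clopen neighbourhood of
  \<open>d0\<close>, and conversely.\<close>

lemma phomeo_limit:
  fixes A' :: "nat \<Rightarrow> 'a::topological_space set" and D' :: "nat \<Rightarrow> 'b::topological_space set"
  assumes bij: "bij_betw u A D" and im: "\<And>n. u ` A' n = D' n"
    and ph: "\<And>n. phomeo (A - A' n) (D - D' n) u"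
    and cl: "\<And>n. clopen (A' n)" "\<And>n. clopen (D' n)"
    and mem: "a0 \<in> A" "u a0 = d0" "\<And>n. A' n \<subseteq> A"
    and nbhd: "\<And>V. open V \<Longrightarrow> a0 \<in> V \<Longrightarrow> \<exists>n. A' n \<subseteq> V" "\<And>V. open V \<Longrightarrow> d0 \<in> V \<Longrightarrow> \<exists>n. D' n \<subseteq> V"
    and sep: "(\<Inter>n. A' n) = {a0}"
  shows "phomeo A D u"
proof -
  have inj: "inj_on u A" using bij by (simp add: bij_betw_def)
  have D'sub: "D' n \<subseteq> D" for n using im[of n] mem(3)[of n] bij by (auto simp: bij_betw_def)
  have imD: "u ` (U - A' n) = u ` U - D' n" if "U \<subseteq> A" for U n
    using inj_on_image_set_diff[OF inj, of U "A' n"] that mem(3)[of n] im[of n] by auto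
  have iff: "open (u ` U - D' n) \<longleftrightarrow> open (U - A' n)" if "U \<subseteq> A" for U n
    using phomeoD(4)[OF ph, of "U - A' n" n] that imD[OF that] by auto
  have un: "U = (\<Union>n. U - A' n)" "u ` U = (\<Union>n. u ` U - D' n)" if "U \<subseteq> A" "a0 \<notin> U" for U
  proof -
    have "\<exists>n. x \<notin> A' n" if "x \<noteq> a0" for x using sep that by (metis INT_iff UNIV_I singletonD INT_I)
    then show U: "U = (\<Union>n. U - A' n)" using \<open>a0 \<notin> U\<close> by (auto; metis)
    then have "u ` U = (\<Union>n. u ` (U - A' n))" by (metis image_UN)
    then show "u ` U = (\<Union>n. u ` U - D' n)" using imD[OF that(1)] by simp
  qed
  have "open (u ` U) \<longleftrightarrow> open U" if U: "U \<subseteq> A" for U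
  proof
    assume o: "open U"
    then have o': "open (u ` U - D' n)" for n using iff[OF U] cl(1) by (auto simp: clopen_def)
    show "open (u ` U)"
    proof (cases "a0 \<in> U")
      case True
      then obtain n where "A' n \<subseteq> U" using nbhd(1)[OF o] by blast
      then have "u ` U = (u ` U - D' n) \<union> D' n" using im by blast
      then show ?thesis using o'[of n] cl(2)[of n] by (metis clopen_def open_Un)
    next
      case False
      then show ?thesis using un(2)[OF U] o' by (metis (no_types, lifting) open_UN)
    qed
  next
    assume o: "open (u ` U)"
    then have o': "open (U - A' n)" for n using iff[OF U] cl(2) by (metis clopen_def open_Diff)
    show "open U"
    proof (cases "a0 \<in> U")
      case True
      then obtain n where "D' n \<subseteq> u ` U" using nbhd(2)[OF o] mem(2) by blast
      then have "A' n \<subseteq> U" using im[of n] mem(3)[of n] inj U by (auto simp: inj_on_def) blast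
      then have "U = (U - A' n) \<union> A' n" by blast
      then show ?thesis using o'[of n] cl(1)[of n] by (metis clopen_def open_Un)
    next
      case False
      then show ?thesis using un(1)[OF U] o' by (metis (no_types, lifting) open_UN)
    qed
  qed
  then show ?thesis using bij by (simp add: phomeo_def)
qed

section \<open>Exhausting clopen sets of equal measure by forward moves\<close>

context minimal_cantor
begin

lemma M_measure_Diff:
  assumes "\<mu> \<in> M" "clopen A" "clopen B" "B \<subseteq> A"
  shows "measure \<mu> (A - B) = measure \<mu> A - measure \<mu> B"
proof -
  interpret prob_space \<mu> using assms(1) by (simp add: invariant_measures_def)
  show ?thesis using assms clopen_sets[OF M_borel_prob] by (intro finite_measure_Diff) auto
qed

text \<open>\<open>forward_matching\<close> asks for strict inequality, but \<open>A\<close> and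
  \<open>D\<close> have equal measure. The slack comes from withholding \<open>A \<inter> V\<close>
  from the source and a neighbourhood \<open>W\<close> of \<open>d0\<close> of smaller measure from
  the target; the unmatched remainders still contain the two special points.\<close>

lemma shrink_source:
  assumes A: "clopen A" "a0 \<in> A" and D: "clopen D" "d0 \<in> D" and V: "clopen V" "a0 \<in> V"
    and eq: "\<And>\<mu>. \<mu> \<in> M \<Longrightarrow> measure \<mu> A = measure \<mu> D"
  obtains A' D' g where "clopen A'" "clopen D'" "a0 \<in> A'" "d0 \<in> D'" "A' \<subseteq> A \<inter> V" "D' \<subseteq> D"
    "phomeo (A - A') (D - D') g" "\<And>x. x \<in> A - A' \<Longrightarrow> forward T x (g x)"
proof -
  obtain W where W: "clopen W" "d0 \<in> W" "\<And>\<mu>. \<mu> \<in> M \<Longrightarrow> measure \<mu> W < measure \<mu> (A \<inter> V)"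
    using small_clopen[of "A \<inter> V"] A V by (metis Int_iff clopen_Int empty_iff)
  have less: "measure \<mu> (A - V) < measure \<mu> (D - W)" if \<mu>: "\<mu> \<in> M" for \<mu>
  proof -
    interpret prob_space \<mu> using \<mu> by (simp add: invariant_measures_def)
    have "measure \<mu> (D \<inter> W) \<le> measure \<mu> W"
      using clopen_sets[OF M_borel_prob[OF \<mu>] W(1)] by (intro finite_measure_mono) auto
    moreover have "A - V = A - A \<inter> V" "D - W = D - D \<inter> W" by auto
    ultimately show ?thesis
      using M_measure_Diff[OF \<mu>, of A "A \<inter> V"] M_measure_Diff[OF \<mu>, of D "D \<inter> W"] A D V W(1) W(3)[OF \<mu>] eq[OF \<mu>]
      by simp
  qed
  obtain g where g: "phomeo (A - V) (g ` (A - V)) g" "g ` (A - V) \<subseteq> D - W" "clopen (g ` (A - V))"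
    "\<And>x. x \<in> A - V \<Longrightarrow> forward T x (g x)"
    using forward_matching[of "A - V" "D - W"] A D V W less by (metis clopen_Diff)
  have "A - (A \<inter> V) = A - V" "D - (D - g ` (A - V)) = g ` (A - V)" "d0 \<notin> g ` (A - V)"
    using g(2) W(2) by auto
  then show ?thesis
    using that[of "A \<inter> V" "D - g ` (A - V)" g] A D V W g by auto
qed

text \<open>This is \<open>shrink_source\<close> for the inverse of \<open>T\<close> with the two
  sets exchanged: the inverse of a map that moves points backward moves them forward.\<close>

lemma shrink_target:
  assumes A: "clopen A" "a0 \<in> A" and D: "clopen D" "d0 \<in> D" and V: "clopen V" "d0 \<in> V"
    and eq: "\<And>\<mu>. \<mu> \<in> M \<Longrightarrow> measure \<mu> A = measure \<mu> D"
  obtains A' D' g where "clopen A'" "clopen D'" "a0 \<in> A'" "d0 \<in> D'" "A' \<subseteq> A" "D' \<subseteq> D \<inter> V"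
    "phomeo (A - A') (D - D') g" "\<And>x. x \<in> A - A' \<Longrightarrow> forward T x (g x)"
proof -
  interpret T': minimal_cantor "inv_into UNIV T"
    by unfold_locales (rule inverse_minimal_cantor_system[OF minimal])
  have M': "T'.M = M" by (rule inverse_invariant_measures[OF minimal])
  obtain A' D' g where *: "clopen A'" "clopen D'" "a0 \<in> A'" "d0 \<in> D'" "A' \<subseteq> A" "D' \<subseteq> D \<inter> V"
    and g: "phomeo (D - D') (A - A') g" "\<And>x. x \<in> D - D' \<Longrightarrow> forward (inv_into UNIV T) x (g x)"
    by (rule T'.shrink_source[OF D A V]) (use M' eq in auto)
  have "forward T x (inv_into (D - D') g x)" if "x \<in> A - A'" for x
  proof -
    let ?y = "inv_into (D - D') g x"
    have "?y \<in> D - D'" "g ?y = x"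
      using phomeoD(3)[OF g(1)] that by (metis inv_into_into) (metis phomeoD(3)[OF g(1)] that f_inv_into_f)
    then obtain n where "n > 0" "x = (inv_into UNIV T ^^ n) ?y" using g(2) unfolding forward_def by metis
    then show ?thesis unfolding forward_def using bij_inv_funpow(1)[OF bij_T] by metis
  qed
  then show ?thesis using that * phomeo_inv[OF g(1)] by blast
qed

text \<open>A state of the exhaustion: \<open>f\<close> is final off \<open>A'\<close>, while the
  remainders \<open>A'\<close> and \<open>D'\<close> around the two special points are still to be
  matched.\<close>

definition partial_forward :: "'a set \<Rightarrow> 'a set \<Rightarrow> 'a \<Rightarrow> 'a \<Rightarrow> 'a set \<times> 'a set \<times> ('a \<Rightarrow> 'a) \<Rightarrow> bool" where
  "partial_forward A D a0 d0 = (\<lambda>(A', D', f). clopen A' \<and> clopen D' \<and> a0 \<in> A' \<and> d0 \<in> D' \<and> A' \<subseteq> A \<and> D' \<subseteq> D \<and>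
     phomeo (A - A') (D - D') f \<and> (\<forall>x\<in>A - A'. forward T x (f x)))"

lemma partial_forward_extend:
  assumes P: "partial_forward A D a0 d0 (A', D', f)" and Q: "partial_forward A' D' a0 d0 (A'', D'', g)"
    and AD: "clopen A" "clopen D"
  shows "partial_forward A D a0 d0 (A'', D'', \<lambda>x. if x \<in> A' then g x else f x)"
proof -
  let ?h = "\<lambda>x. if x \<in> A' then g x else f x"
  have "phomeo (A - A') (D - D') ?h" "phomeo (A' - A'') (D' - D'') ?h"
    using P Q by (auto simp: partial_forward_def intro: phomeo_cong)
  then have "phomeo ((A - A') \<union> (A' - A'')) ((D - D') \<union> (D' - D'')) ?h"
    using P Q AD by (intro phomeo_Un) (auto simp: partial_forward_def clopen_def)
  moreover have "(A - A') \<union> (A' - A'') = A - A''" "(D - D') \<union> (D' - D'') = D - D''"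
    using P Q by (auto simp: partial_forward_def)
  ultimately show ?thesis using P Q by (auto simp: partial_forward_def)
qed

text \<open>Forward maps preserve invariant measures, so the remainders again have equal measure and
  the shrinking can be repeated.\<close>

lemma partial_forward_measure:
  assumes "partial_forward A D a0 d0 (A', D', f)" "clopen A" "clopen D" "\<mu> \<in> M" "measure \<mu> A = measure \<mu> D"
  shows "measure \<mu> A' = measure \<mu> D'"
proof -
  have P: "clopen A'" "clopen D'" "A' \<subseteq> A" "D' \<subseteq> D" "phomeo (A - A') (D - D') f" "\<And>x. x \<in> A - A' \<Longrightarrow> forward T x (f x)"
    using assms(1) by (auto simp: partial_forward_def)
  have "measure \<mu> (f ` (A - A')) = measure \<mu> (A - A')"
    using forward_phomeo_preserves[OF P(5), of "A - A'"] P assms by auto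
  then show ?thesis
    using M_measure_Diff[OF assms(4,2) P(1,3)] M_measure_Diff[OF assms(4,3) P(2,4)] phomeoD(3)[OF P(5)] assms(5) by simp
qed

text \<open>A single matching has no slack. Each stage matches all but small remainders around
  \<open>a0\<close> and \<open>d0\<close>, shrunk alternately on the source and on the target side,
  and in the limit \<open>a0\<close> goes to \<open>d0\<close>. These points are prescribed freely,
  so \<open>d0\<close> may lie off the forward orbit of \<open>a0\<close>, and this pair is exempt
  from \<open>forward\<close>.\<close>

lemma forward_homeomorphism:
  assumes A: "clopen A" "a0 \<in> A" and D: "clopen D" "d0 \<in> D"
    and eq: "\<And>\<mu>. \<mu> \<in> M \<Longrightarrow> measure \<mu> A = measure \<mu> D"
  obtains u where "phomeo A D u" "u a0 = d0" "\<And>x. x \<in> A \<Longrightarrow> x \<noteq> a0 \<Longrightarrow> forward T x (u x)"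
proof -
  obtain c :: "nat \<Rightarrow> 'a set" where c: "range c = {U. clopen U}" using enumerate_clopen by blast
  have cl_c: "clopen (c n)" for n using c by auto
  \<comment> \<open>Every clopen set containing \<open>z\<close> is one of these, so they shrink to
    \<open>z\<close>.\<close>
  define V where "V z n = (if z \<in> c n then c n else - c n)" for z n
  have V: "clopen (V z n)" "z \<in> V z n" for z n using cl_c by (auto simp: V_def)
  let ?P = "partial_forward A D a0 d0"
  let ?Q = "\<lambda>n (A1, D1, f1) (A2, D2, f2). A2 \<subseteq> A1 \<inter> V a0 n \<and> D2 \<subseteq> D1 \<inter> V d0 n \<and> (\<forall>x\<in>A - A1. f2 x = f1 x)"
  have step: "\<exists>y. ?P y \<and> ?Q n x y" if Px: "?P x" for x n
  proof -
    obtain A1 D1 f1 where x: "x = (A1, D1, f1)" by (cases x)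
    have P1: "clopen A1" "clopen D1" "a0 \<in> A1" "d0 \<in> D1" using Px x by (auto simp: partial_forward_def)
    have e1: "measure \<mu> A1 = measure \<mu> D1" if "\<mu> \<in> M" for \<mu>
      using partial_forward_measure[OF Px[unfolded x] A(1) D(1) that eq[OF that]] .
    obtain A2 D2 g where 2: "clopen A2" "clopen D2" "a0 \<in> A2" "d0 \<in> D2" "A2 \<subseteq> A1 \<inter> V a0 n" "D2 \<subseteq> D1"
      "phomeo (A1 - A2) (D1 - D2) g" "\<And>x. x \<in> A1 - A2 \<Longrightarrow> forward T x (g x)"
      by (rule shrink_source[OF P1(1,3,2,4) V(1)[of a0 n] V(2)[of a0 n] e1]) (assumption, (rule that; (assumption | simp)))
    define f2 where "f2 x = (if x \<in> A1 then g x else f1 x)" for x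
    have P2: "?P (A2, D2, f2)" unfolding f2_def
      by (rule partial_forward_extend[OF Px[unfolded x] _ A(1) D(1)]) (use 2 in \<open>auto simp: partial_forward_def\<close>)
    have e2: "measure \<mu> A2 = measure \<mu> D2" if "\<mu> \<in> M" for \<mu>
      using partial_forward_measure[OF P2 A(1) D(1) that eq[OF that]] .
    obtain A3 D3 g' where 3: "clopen A3" "clopen D3" "a0 \<in> A3" "d0 \<in> D3" "A3 \<subseteq> A2" "D3 \<subseteq> D2 \<inter> V d0 n"
      "phomeo (A2 - A3) (D2 - D3) g'" "\<And>x. x \<in> A2 - A3 \<Longrightarrow> forward T x (g' x)"
      by (rule shrink_target[OF 2(1,3,2,4) V(1)[of d0 n] V(2)[of d0 n] e2]) (assumption, (rule that; (assumption | simp)))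
    define f3 where "f3 x = (if x \<in> A2 then g' x else f2 x)" for x
    have P3: "?P (A3, D3, f3)" unfolding f3_def
      by (rule partial_forward_extend[OF P2 _ A(1) D(1)]) (use 3 in \<open>auto simp: partial_forward_def\<close>)
    have "f3 x = f1 x" if "x \<in> A - A1" for x using that 2(5) by (auto simp: f3_def f2_def)
    then have "?Q n x (A3, D3, f3)" using 2(5,6) 3(5,6) by (auto simp: x)
    then show ?thesis using P3 by blast
  qed
  have init: "?P (A, D, \<lambda>x. x)" using A D by (simp add: partial_forward_def phomeo_def bij_betw_def)
  have "\<exists>s. \<forall>n. ?P (s n) \<and> ?Q n (s n) (s (Suc n))"
  proof (rule dependent_nat_choice)
    show "\<exists>x. ?P x" using init by (rule exI)
    show "\<exists>y. ?P y \<and> ?Q n x y" if "?P x" for x n using that by (rule step)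
  qed
  then obtain s where s: "\<forall>n. ?P (s n) \<and> ?Q n (s n) (s (Suc n))" ..
  define A' D' f where "A' n = fst (s n)" and "D' n = fst (snd (s n))" and "f n = snd (snd (s n))" for n
  have sn: "s n = (A' n, D' n, f n)" for n by (simp add: A'_def D'_def f_def)
  have P: "clopen (A' n)" "clopen (D' n)" "a0 \<in> A' n" "d0 \<in> D' n" "A' n \<subseteq> A" "D' n \<subseteq> D"
    "phomeo (A - A' n) (D - D' n) (f n)" "\<And>x. x \<in> A - A' n \<Longrightarrow> forward T x (f n x)" for n
    using s[THEN spec, THEN conjunct1, of n] unfolding sn by (auto simp: partial_forward_def)
  have Q: "A' (Suc n) \<subseteq> A' n \<inter> V a0 n" "D' (Suc n) \<subseteq> D' n \<inter> V d0 n" "\<And>x. x \<in> A - A' n \<Longrightarrow> f (Suc n) x = f n x" for n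
    using s[THEN spec, THEN conjunct2, of n] unfolding sn by auto
  have antiA: "A' n \<subseteq> A' m" and antiD: "D' n \<subseteq> D' m" if "m \<le> n" for m n
    using that Q(1,2) by (induction rule: dec_induct) blast+
  have f_stable: "f n x = f m x" if "m \<le> n" "x \<in> A - A' m" for m n x
    using that(1)
  proof (induction rule: dec_induct)
    case (step n)
    then show ?case using Q(3)[of x n] antiA[of m n] that(2) by auto
  qed simp
  have nbhd: "\<exists>n. A' n \<subseteq> W" if W: "open W" "a0 \<in> W" for W
  proof -
    obtain n where n: "a0 \<in> c n" "c n \<subseteq> W"
      using clopen_base[OF W] c by (metis mem_Collect_eq rangeE)
    then have "V a0 n \<subseteq> W" by (simp add: V_def)
    then show ?thesis using Q(1)[of n] by blast
  qed
  have nbhd': "\<exists>n. D' n \<subseteq> W" if W: "open W" "d0 \<in> W" for W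
  proof -
    obtain n where n: "d0 \<in> c n" "c n \<subseteq> W"
      using clopen_base[OF W] c by (metis mem_Collect_eq rangeE)
    then have "V d0 n \<subseteq> W" by (simp add: V_def)
    then show ?thesis using Q(2)[of n] by blast
  qed
  have out: "\<exists>n. x \<notin> A' n" if "x \<noteq> a0" for x
    using clopen_separate[of a0 x] nbhd that by (metis clopen_def subsetD)
  have out': "\<exists>n. x \<notin> D' n" if "x \<noteq> d0" for x
    using clopen_separate[of d0 x] nbhd' that by (metis clopen_def subsetD)
  \<comment> \<open>The value at \<open>x\<close> is settled at the first stage whose remainder
    misses \<open>x\<close>.\<close>
  define u where "u x = (if x = a0 then d0 else f (LEAST n. x \<notin> A' n) x)" for x
  have u: "u x = f n x" if "x \<in> A - A' n" for x n
  proof -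
    have "x \<noteq> a0" using that P(3)[of n] by auto
    moreover have "x \<notin> A' (LEAST n. x \<notin> A' n)" "(LEAST n. x \<notin> A' n) \<le> n"
      using that LeastI[of "\<lambda>n. x \<notin> A' n" n] Least_le[of "\<lambda>n. x \<notin> A' n" n] by auto
    ultimately show ?thesis using that f_stable by (simp add: u_def)
  qed
  have u_ph: "phomeo (A - A' n) (D - D' n) u" for n
    by (rule phomeo_cong[OF P(7)]) (rule u[symmetric])
  have ua0: "u a0 = d0" by (simp add: u_def)
  have ne: "u x \<noteq> d0" if x: "x \<in> A" "x \<noteq> a0" for x
  proof -
    obtain n where "x \<notin> A' n" using out x(2) by blast
    then have "u x \<in> D - D' n" using x(1) phomeoD(3)[OF u_ph[of n]] by auto
    then show ?thesis using P(4)[of n] by auto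
  qed
  have inj: "inj_on u A"
  proof (rule inj_onI)
    fix x y assume xy: "x \<in> A" "y \<in> A" "u x = u y"
    show "x = y"
    proof (cases "x = a0 \<or> y = a0")
      case True
      then show ?thesis using ne xy ua0 by metis
    next
      case False
      then obtain m n where "x \<notin> A' m" "y \<notin> A' n" using out by metis
      then have "x \<in> A - A' (max m n)" "y \<in> A - A' (max m n)"
        using xy antiA[of m "max m n"] antiA[of n "max m n"] by auto
      then show ?thesis using phomeoD(2)[OF u_ph] xy(3) by (auto simp: inj_on_def)
    qed
  qed
  have surj: "u ` A = D"
  proof
    show "u ` A \<subseteq> D"
    proof
      fix y assume "y \<in> u ` A"
      then obtain x where x: "x \<in> A" "y = u x" by blast
      show "y \<in> D"
      proof (cases "x = a0")
        case True
        then show ?thesis using x D ua0 by simp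
      next
        case False
        then obtain n where "x \<notin> A' n" using out by blast
        then show ?thesis using x phomeoD(3)[OF u_ph[of n]] by blast
      qed
    qed
    show "D \<subseteq> u ` A"
    proof
      fix y assume y: "y \<in> D"
      show "y \<in> u ` A"
      proof (cases "y = d0")
        case True
        then show ?thesis using A ua0 by auto
      next
        case False
        then obtain n where "y \<notin> D' n" using out' by blast
        then show ?thesis using y phomeoD(3)[OF u_ph[of n]] by blast
      qed
    qed
  qed
  have im: "u ` A' n = D' n" for n
  proof -
    have "A' n = A - (A - A' n)" "D' n = D - (D - D' n)" using P(5,6) by auto
    then show ?thesis
      using inj_on_image_set_diff[OF inj, of A "A - A' n"] surj phomeoD(3)[OF u_ph[of n]] by auto
  qed
  have "phomeo A D u"
  proof (rule phomeo_limit[where A' = A' and D' = D' and ?a0.0 = a0 and ?d0.0 = d0])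
    show "(\<Inter>n. A' n) = {a0}" using P(3) out by blast
  qed (use inj surj im u_ph P A ua0 nbhd nbhd' in \<open>auto simp: bij_betw_def\<close>)
  moreover have "forward T x (u x)" if x: "x \<in> A" "x \<noteq> a0" for x
  proof -
    obtain n where "x \<notin> A' n" using out x(2) by blast
    then show ?thesis using P(8)[of x n] u[of x n] x(1) by simp
  qed
  ultimately show ?thesis using that ua0 by blast
qed

end

section \<open>Conjugating to a speedup\<close>

definition zpow :: "('a \<Rightarrow> 'a) \<Rightarrow> int \<Rightarrow> 'a \<Rightarrow> 'a" where
  "zpow f n = (if n \<ge> 0 then f ^^ nat n else inv_into UNIV f ^^ nat (- n))"

lemma zpow_0 [simp]: "zpow f 0 x = x"
  by (simp add: zpow_def)

lemma zpow_Suc: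
  assumes "bij f"
  shows "zpow f (n + 1) x = f (zpow f n x)" "zpow f (n + 1) x = zpow f n (f x)"
proof -
  have "zpow f (n + 1) x = f (zpow f n x) \<and> zpow f (n + 1) x = zpow f n (f x)"
  proof (cases "n \<ge> 0")
    case True
    then have "nat (n + 1) = Suc (nat n)" by simp
    then show ?thesis using True by (simp add: zpow_def funpow_swap1)
  next
    case False
    define k where "k = nat (- n - 1)"
    have n: "n = - int (Suc k)" using False by (simp add: k_def)
    have "nat (- n) = Suc k" using n by simp
    then have "zpow f n = inv_into UNIV f ^^ Suc k" using n unfolding zpow_def by simp
    moreover have "zpow f (n + 1) = inv_into UNIV f ^^ k" using n by (simp add: zpow_def)
    ultimately show ?thesis
      using bij_is_surj[OF assms] bij_is_inj[OF assms] by (simp add: surj_f_inv_f) (simp add: funpow_swap1)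
  qed
  then show "zpow f (n + 1) x = f (zpow f n x)" "zpow f (n + 1) x = zpow f n (f x)" by auto
qed

lemma phomeo_zpow:
  assumes "homeo f"
  shows "homeo (zpow f n)"
  using phomeo_funpow[OF assms] phomeo_funpow[OF phomeo_inv[OF assms]] by (simp add: zpow_def)

text \<open>Induction on \<open>n\<close> away from 0 in both directions; the backward step cancels
  the injective \<open>f\<close>. With \<open>n = - i\<close> it says that going back by
  \<open>g\<close> and forward by \<open>f\<close> maps \<open>Q\<close> onto itself, although the
  two maps may differ at every point. The window from \<open>-K\<close> to \<open>K\<close> keeps
  the number of required coincidences finite.\<close>

lemma zpow_image_track:
  assumes f: "bij f" and g: "bij g"
    and step: "\<And>i. - K \<le> i \<Longrightarrow> i \<le> K \<Longrightarrow> f ` zpow g i ` Q = g ` zpow g i ` Q"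
    and i: "- K \<le> i" "i \<le> K" and n: "- K \<le> i + n" "i + n \<le> K"
  shows "zpow f n ` zpow g i ` Q = zpow g (i + n) ` Q"
  using n
proof (induction n rule: int_induct[where k = 0])
  case base
  then show ?case by simp
next
  case (step1 n)
  have "zpow f (n + 1) ` zpow g i ` Q = f ` zpow f n ` zpow g i ` Q"
    by (simp add: image_image zpow_Suc(1)[OF f])
  also have "\<dots> = f ` zpow g (i + n) ` Q" using step1 i by simp
  also have "\<dots> = g ` zpow g (i + n) ` Q" using step1 i by (intro step) auto
  also have "\<dots> = zpow g (i + n + 1) ` Q" by (simp add: image_image zpow_Suc(1)[OF g])
  finally show ?case by (simp add: add.assoc)
next
  case (step2 n)
  have "f ` zpow f (n - 1) ` zpow g i ` Q = zpow f n ` zpow g i ` Q"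
    using zpow_Suc(1)[OF f, of "n - 1"] by (simp add: image_image)
  also have "\<dots> = zpow g (i + n) ` Q" using step2 i by simp
  also have "\<dots> = g ` zpow g (i + (n - 1)) ` Q"
    using zpow_Suc(1)[OF g, of "i + (n - 1)"] by (simp add: image_image add.assoc)
  also have "\<dots> = f ` zpow g (i + (n - 1)) ` Q" using step2 i by (intro step[symmetric]) auto
  finally show ?case using f by (simp add: bij_is_inj inj_image_eq_iff)
qed

section \<open>Homeomorphisms that preserve every invariant measure\<close>

context minimal_cantor
begin

text \<open>For a homeomorphism \<open>g\<close> this means that every measure in \<open>M\<close>
  is invariant under \<open>g\<close>: clopen sets generate the Borel sets.\<close>

definition preserves :: "('a \<Rightarrow> 'a) \<Rightarrow> bool" where
  "preserves g \<longleftrightarrow> (\<forall>U. clopen U \<longrightarrow> (\<forall>\<mu>\<in>M. measure \<mu> (g ` U) = measure \<mu> U))"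

lemma preservesD: "preserves g \<Longrightarrow> clopen U \<Longrightarrow> \<mu> \<in> M \<Longrightarrow> measure \<mu> (g ` U) = measure \<mu> U"
  by (simp add: preserves_def)

lemma preserves_id: "preserves (\<lambda>x. x)"
  by (simp add: preserves_def)

lemma preserves_comp:
  assumes "homeo g" "preserves g" "preserves h"
  shows "preserves (h \<circ> g)"
  using assms phomeo_UNIV(3)[OF assms(1)] unfolding preserves_def image_comp[symmetric] by simp

lemma preserves_inv:
  assumes "homeo g" "preserves g"
  shows "preserves (inv_into UNIV g)"
  unfolding preserves_def
proof (intro allI impI ballI)
  fix U :: "'a set" and \<mu> assume U: "clopen U" and \<mu>: "\<mu> \<in> M"
  have "clopen (inv_into UNIV g ` U)" using phomeo_UNIV(3)[OF phomeo_inv[OF assms(1)]] U by simp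
  moreover have "g ` inv_into UNIV g ` U = U"
    using phomeo_UNIV(1)[OF assms(1)] by (simp add: bij_is_surj image_f_inv_f)
  ultimately show "measure \<mu> (inv_into UNIV g ` U) = measure \<mu> U"
    using preservesD[OF assms(2) _ \<mu>] by metis
qed

lemma preserves_funpow:
  assumes "homeo g" "preserves g"
  shows "preserves (g ^^ n)"
proof (induction n)
  case 0
  then show ?case by (simp add: preserves_def)
next
  case (Suc n)
  then show ?case using preserves_comp[OF phomeo_funpow[OF assms(1)] Suc assms(2)] by (simp add: comp_def)
qed

lemma preserves_zpow:
  assumes "homeo g" "preserves g"
  shows "preserves (zpow g n)"
  using preserves_funpow[OF assms] preserves_funpow[OF phomeo_inv[OF assms(1)] preserves_inv[OF assms]]
  by (simp add: zpow_def)

lemma M_measure_Un: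
  assumes "\<mu> \<in> M" "clopen A" "clopen B" "A \<inter> B = {}"
  shows "measure \<mu> (A \<union> B) = measure \<mu> A + measure \<mu> B"
proof -
  interpret prob_space \<mu> using assms(1) by (simp add: invariant_measures_def)
  show ?thesis using assms clopen_sets[OF M_borel_prob] by (intro finite_measure_Union) auto
qed

lemma preserves_If:
  assumes A: "clopen A" and ph: "homeo (\<lambda>x. if x \<in> A then g x else h x)"
    and g: "\<And>U \<mu>. clopen U \<Longrightarrow> U \<subseteq> A \<Longrightarrow> \<mu> \<in> M \<Longrightarrow> measure \<mu> (g ` U) = measure \<mu> U"
    and h: "preserves h"
  shows "preserves (\<lambda>x. if x \<in> A then g x else h x)"
  unfolding preserves_def
proof (intro allI impI ballI)
  let ?k = "\<lambda>x. if x \<in> A then g x else h x"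
  fix U :: "'a set" and \<mu> assume U: "clopen U" and \<mu>: "\<mu> \<in> M"
  have im: "?k ` (U \<inter> A) = g ` (U \<inter> A)" "?k ` (U - A) = h ` (U - A)"
    by (rule image_cong; simp)+
  have "?k ` (U \<inter> A) \<inter> ?k ` (U - A) = {}"
    using image_Int[OF bij_is_inj[OF phomeo_UNIV(1)[OF ph]], of "U \<inter> A" "U - A"] by auto
  moreover have "clopen (?k ` (U \<inter> A))" "clopen (?k ` (U - A))"
    unfolding phomeo_UNIV(3)[OF ph] using U A by auto
  ultimately have "measure \<mu> (?k ` (U \<inter> A) \<union> ?k ` (U - A)) = measure \<mu> (?k ` (U \<inter> A)) + measure \<mu> (?k ` (U - A))"
    by (intro M_measure_Un[OF \<mu>])
  also have "\<dots> = measure \<mu> (U \<inter> A) + measure \<mu> (U - A)"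
    unfolding im using g[OF _ _ \<mu>, of "U \<inter> A"] preservesD[OF h _ \<mu>, of "U - A"] U A by simp
  also have "\<dots> = measure \<mu> ((U \<inter> A) \<union> (U - A))"
    using U A by (intro M_measure_Un[OF \<mu>, symmetric]) auto
  also have "(U \<inter> A) \<union> (U - A) = U" by auto
  also have "?k ` (U \<inter> A) \<union> ?k ` (U - A) = ?k ` U" by auto
  finally show "measure \<mu> (?k ` U) = measure \<mu> U" .
qed

text \<open>Since \<open>g k\<close> maps the level set of \<open>k\<close> onto itself, the pieces
  of \<open>\<psi>\<close> do not collide and \<open>m\<close> is invariant under
  \<open>\<psi>\<close>.\<close>

lemma piecewise_homeo:
  fixes m :: "'a \<Rightarrow> int"
  assumes m: "cts m"
    and g: "\<And>k. homeo (g k)" "\<And>k. preserves (g k)"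
    and lev: "\<And>k. k \<in> range m \<Longrightarrow> g k ` (m -` {k}) = m -` {k}"
  defines "\<psi> \<equiv> \<lambda>x. g (m x) x"
  shows "homeo \<psi>" "preserves \<psi>" "\<And>Q. (\<And>k. k \<in> range m \<Longrightarrow> g k ` Q = Q) \<Longrightarrow> \<psi> ` Q = Q"
proof -
  define L where "L k = m -` {k}" for k
  have L: "clopen (L k)" for k using clopen_vimage_discrete[OF m] by (simp add: L_def)
  have inj_g: "inj (g k)" for k using phomeo_UNIV(1)[OF g(1)] by (simp add: bij_is_inj)
  have fin: "finite (range m)" by (rule finite_range_discrete[OF m])
  have im: "\<psi> ` (U \<inter> L k) = g k ` (U \<inter> L k)" for U k
    by (intro image_cong) (auto simp: \<psi>_def L_def)
  have un: "U = (\<Union>k\<in>range m. U \<inter> L k)" for U by (auto simp: L_def)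
  have un': "\<psi> ` U = (\<Union>k\<in>range m. g k ` (U \<inter> L k))" for U
    unfolding im[symmetric] by (auto simp: L_def)
  have m\<psi>: "m (\<psi> x) = m x" for x
  proof -
    have "\<psi> x \<in> g (m x) ` L (m x)" by (auto simp: \<psi>_def L_def)
    then show ?thesis using lev[of "m x"] by (auto simp: L_def)
  qed
  have imQ: "\<psi> ` Q = Q" if Q: "\<And>k. k \<in> range m \<Longrightarrow> g k ` Q = Q" for Q
  proof -
    have "g k ` (Q \<inter> L k) = Q \<inter> L k" if "k \<in> range m" for k
      using image_Int[OF inj_g, of k Q "L k"] Q[OF that] lev[OF that] by (simp add: L_def)
    then have "\<psi> ` Q = (\<Union>k\<in>range m. Q \<inter> L k)" unfolding un' by auto
    then show ?thesis using un[of Q] by simp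
  qed
  then show "\<And>Q. (\<And>k. k \<in> range m \<Longrightarrow> g k ` Q = Q) \<Longrightarrow> \<psi> ` Q = Q" by blast
  have "inj \<psi>"
  proof (rule injI)
    fix x y assume xy: "\<psi> x = \<psi> y"
    then have "m x = m y" using m\<psi> by metis
    then show "x = y" using xy inj_g by (simp add: \<psi>_def inj_eq)
  qed
  moreover have "\<psi> ` UNIV = UNIV"
    by (rule imQ) (use phomeo_UNIV(1)[OF g(1)] in \<open>simp add: bij_is_surj\<close>)
  moreover have "open (\<psi> ` U) \<longleftrightarrow> open U" for U
  proof
    assume "open U"
    then have "open (g k ` (U \<inter> L k))" for k
      using phomeoD(4)[OF g(1)] L[of k] by (auto simp: clopen_def)
    then show "open (\<psi> ` U)" unfolding un' by blast
  next
    assume o: "open (\<psi> ` U)"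
    have "\<psi> ` U \<inter> L k = g k ` (U \<inter> L k)" for k
      using m\<psi> unfolding im[symmetric] by (auto simp: L_def)
    then have "open (g k ` (U \<inter> L k))" for k using o L[of k] by (metis clopen_def open_Int)
    then have "open (U \<inter> L k)" for k using phomeoD(4)[OF g(1), of "U \<inter> L k" k] by simp
    then have "open (\<Union>k\<in>range m. U \<inter> L k)" by blast
    then show "open U" using un[of U] by simp
  qed
  ultimately show ph: "homeo \<psi>" by (simp add: phomeo_def bij_def)
  show "preserves \<psi>"
    unfolding preserves_def
  proof (intro allI impI ballI)
    fix U :: "'a set" and \<mu> assume U: "clopen U" and \<mu>: "\<mu> \<in> M"
    interpret prob_space \<mu> using \<mu> by (simp add: invariant_measures_def)
    have gUL: "clopen (g k ` (U \<inter> L k))" for k using phomeo_UNIV(3)[OF g(1)] U L by simp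
    have "g k ` (U \<inter> L k) \<subseteq> L k" if "k \<in> range m" for k using lev[OF that] by (auto simp: L_def)
    moreover have "L k \<inter> L l = {}" if "k \<noteq> l" for k l using that by (auto simp: L_def)
    ultimately have "disjoint_family_on (\<lambda>k. g k ` (U \<inter> L k)) (range m)"
      unfolding disjoint_family_on_def by (metis (no_types, lifting) Int_mono subset_empty)
    then have "measure \<mu> (\<psi> ` U) = (\<Sum>k\<in>range m. measure \<mu> (g k ` (U \<inter> L k)))"
      unfolding un' using gUL clopen_sets[OF M_borel_prob[OF \<mu>]] fin
      by (intro finite_measure_finite_Union) auto
    also have "\<dots> = (\<Sum>k\<in>range m. measure \<mu> (U \<inter> L k))"
      using preservesD[OF g(2) _ \<mu>] U L by (intro sum.cong) auto
    also have "\<dots> = measure \<mu> (\<Union>k\<in>range m. U \<inter> L k)"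
    proof (rule finite_measure_finite_Union[symmetric])
      show "disjoint_family_on (\<lambda>k. U \<inter> L k) (range m)"
        unfolding disjoint_family_on_def by (auto simp: L_def)
    qed (use U L clopen_sets[OF M_borel_prob[OF \<mu>]] fin in auto)
    finally show "measure \<mu> (\<psi> ` U) = measure \<mu> U" using un[of U] by simp
  qed
qed

text \<open>A height along the orbits, reset only where they pass through \<open>R\<close>. The set \<open>Z\<close> shifts the
  towers containing \<open>x1\<close>, which by aperiodicity do not contain \<open>T x1\<close>.\<close>

lemma height_function:
  assumes R: "clopen R" "x1 \<in> R"
  obtains m :: "'a \<Rightarrow> int" where "cts m" "\<And>x. x \<notin> R \<Longrightarrow> m (T x) = m x + 1"
    "m x1 = 0" "m (T x1) = 0"
proof -
  interpret T': minimal_cantor "inv_into UNIV T"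
    by unfold_locales (rule inverse_minimal_cantor_system[OF minimal])
  let ?S = "inv_into UNIV T"
  \<comment> \<open>The reset takes effect on leaving \<open>R\<close>, so towers start on the image
    of \<open>R\<close>. Below, \<open>j\<close> is the time since the last start and
    \<open>b\<close> the base point found by going back that far.\<close>
  define B where "B = T ` R"
  have B: "clopen B" "T x1 \<in> B" using R phomeo_UNIV(3)[OF T_phomeo] by (auto simp: B_def)
  have TB: "T x \<in> B \<longleftrightarrow> x \<in> R" for x
    using bij_is_inj[OF bij_T] by (auto simp: B_def inj_def)
  define j where "j x = (LEAST n. (?S ^^ n) x \<in> B)" for x
  have ex: "\<exists>n. (?S ^^ n) x \<in> B" for x using T'.visits[of B] B by (metis clopen_def empty_iff)
  have j: "(?S ^^ j x) x \<in> B" for x unfolding j_def by (rule LeastI_ex[OF ex])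
  have j_eq: "j x = n \<longleftrightarrow> (?S ^^ n) x \<in> B \<and> (\<forall>k<n. (?S ^^ k) x \<notin> B)" for x n
  proof
    assume "j x = n"
    then show "(?S ^^ n) x \<in> B \<and> (\<forall>k<n. (?S ^^ k) x \<notin> B)" using j not_less_Least unfolding j_def by blast
  next
    assume "(?S ^^ n) x \<in> B \<and> (\<forall>k<n. (?S ^^ k) x \<notin> B)"
    then show "j x = n" using j[of x] unfolding j_def by (intro Least_equality) (auto simp: not_less[symmetric])
  qed
  have ST: "(?S ^^ Suc n) (T x) = (?S ^^ n) x" for n x
    using bij_is_inj[OF bij_T] by (simp add: funpow_swap1)
  have jT: "j (T x) = Suc (j x)" if "x \<notin> R" for x
  proof -
    have "(?S ^^ k) (T x) \<notin> B" if "k < Suc (j x)" for k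
    proof (cases k)
      case 0
      then show ?thesis using TB \<open>x \<notin> R\<close> by simp
    next
      case (Suc i)
      then show ?thesis using that ST[of i x] j_eq[of x "j x"] by auto
    qed
    then show ?thesis using j_eq ST[of "j x" x] j[of x] by metis
  qed
  define b where "b x = (?S ^^ j x) x" for x
  have bT: "b (T x) = b x" if "x \<notin> R" for x using jT[OF that] ST[of "j x" x] by (simp only: b_def)
  have j0: "j (T x1) = 0" using B(2) j_eq[of "T x1" 0] by simp
  have "b x1 \<noteq> T x1"
  proof
    assume "b x1 = T x1"
    then have "x1 = (T ^^ j x1) (T x1)" using bij_inv_funpow(1)[OF bij_T, of "j x1" x1] by (simp add: b_def)
    then have "(T ^^ Suc (j x1)) x1 = x1" by (simp add: funpow_swap1)
    then show False using aperiodic[of "Suc (j x1)" x1] by blast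
  qed
  then obtain Z where Z: "clopen Z" "b x1 \<in> Z" "T x1 \<notin> Z" using clopen_separate by metis
  \<comment> \<open>Over bases in \<open>Z\<close> heights are counted from the level of
    \<open>x1\<close>. The point \<open>T x1\<close> is its own base, lies outside \<open>Z\<close>
    and so keeps height 0.\<close>
  define m where "m x = int (j x) - (if b x \<in> Z then int (j x1) else 0)" for x
  have "cts m"
  proof (rule continuous_discreteI)
    fix k
    define W where "W n = (if int n - int (j x1) = k then Z else {}) \<union> (if int n = k then - Z else {})" for n
    have "open {x. j x = n}" for n
    proof -
      have "{x. j x = n} = (?S ^^ n) -` B \<inter> (\<Inter>k\<in>{..<n}. (?S ^^ k) -` (- B))"
        unfolding j_eq by auto
      moreover have o: "open ((?S ^^ n) -` B)" "open ((?S ^^ n) -` (- B))" for n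
        using B(1) T'.Tn_continuous[of n] by (simp_all add: clopen_def open_Compl continuous_on_open_vimage)
      ultimately show ?thesis by (simp only:) (intro open_Int open_INT ballI o finite_lessThan)
    qed
    moreover have "open (W n)" for n using Z(1) by (auto simp: W_def clopen_def)
    then have "open ((?S ^^ n) -` W n)" for n
      using T'.Tn_continuous[of n] by (simp add: continuous_on_open_vimage)
    moreover have "m -` {k} = (\<Union>n. {x. j x = n} \<inter> (?S ^^ n) -` W n)"
      by (auto simp: m_def W_def b_def split: if_splits)
    ultimately show "open (m -` {k})" by auto
  qed
  moreover have "m (T x) = m x + 1" if "x \<notin> R" for x using jT[OF that] bT[OF that] by (simp add: m_def)
  moreover have "m x1 = 0" using Z(2) by (simp add: m_def)
  moreover have "m (T x1) = 0" using Z(3) j0 by (simp add: m_def b_def)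
  ultimately show ?thesis using that by blast
qed

text \<open>Replaces \<open>\<sigma>\<close> by a forward map that moves the finitely many sets in
  \<open>P\<close> in the same way. The induction splits \<open>A\<close> by one member of
  \<open>P\<close> at a time and treats both halves separately.\<close>

lemma forward_refinement:
  assumes \<sigma>: "homeo \<sigma>" "preserves \<sigma>" and fin: "finite P" "\<And>D. D \<in> P \<Longrightarrow> clopen D"
    and A: "clopen A"
  shows "\<exists>u. phomeo A (\<sigma> ` A) u \<and> (\<forall>x\<in>A. forward T x (u x)) \<and> (\<forall>D\<in>P. u ` (A \<inter> D) = \<sigma> ` (A \<inter> D))"
  using fin A
proof (induction P arbitrary: A rule: finite_induct)
  case empty
  show ?case
  proof (cases "A = {}")
    case True
    then show ?thesis by (auto simp: phomeo_def)
  next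
    case False
    then obtain a0 where a0: "a0 \<in> A" by blast
    have cl: "clopen (\<sigma> ` A)" using phomeo_UNIV(3)[OF \<sigma>(1)] empty by simp
    \<comment> \<open>The exceptional pair of \<open>forward_homeomorphism\<close> is chosen on one
      orbit, so that no exception remains; starting from \<open>T a0\<close> makes the time
      positive.\<close>
    obtain i where "(T ^^ i) (T a0) \<in> \<sigma> ` A"
      using visits[of "\<sigma> ` A"] cl False by (metis clopen_def image_is_empty)
    then have d0: "(T ^^ Suc i) a0 \<in> \<sigma> ` A" by (simp add: funpow_swap1)
    obtain u where "phomeo A (\<sigma> ` A) u" "u a0 = (T ^^ Suc i) a0" "\<And>x. x \<in> A \<Longrightarrow> x \<noteq> a0 \<Longrightarrow> forward T x (u x)"
      by (rule forward_homeomorphism[OF empty(2) a0 cl d0])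
         (use preservesD[OF \<sigma>(2)] empty in auto)
    then show ?thesis unfolding forward_def by (metis empty_iff zero_less_Suc)
  qed
next
  case (insert D P)
  have D: "clopen D" and P: "\<And>D. D \<in> P \<Longrightarrow> clopen D" using insert.prems by auto
  obtain u1 where u1: "phomeo (A \<inter> D) (\<sigma> ` (A \<inter> D)) u1" "\<forall>x\<in>A \<inter> D. forward T x (u1 x)"
    "\<And>E. E \<in> P \<Longrightarrow> u1 ` (A \<inter> D \<inter> E) = \<sigma> ` (A \<inter> D \<inter> E)"
    using insert.IH[OF P, of "A \<inter> D"] insert.prems D by auto
  obtain u2 where u2: "phomeo (A - D) (\<sigma> ` (A - D)) u2" "\<forall>x\<in>A - D. forward T x (u2 x)"
    "\<And>E. E \<in> P \<Longrightarrow> u2 ` ((A - D) \<inter> E) = \<sigma> ` ((A - D) \<inter> E)"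
    using insert.IH[OF P, of "A - D"] insert.prems D by auto
  define u where "u x = (if x \<in> D then u1 x else u2 x)" for x
  have p1: "phomeo (A \<inter> D) (\<sigma> ` (A \<inter> D)) u" by (rule phomeo_cong[OF u1(1)]) (simp add: u_def)
  have p2: "phomeo (A - D) (\<sigma> ` (A - D)) u" by (rule phomeo_cong[OF u2(1)]) (simp add: u_def)
  have "\<sigma> ` (A \<inter> D) \<inter> \<sigma> ` (A - D) = {}"
    using image_Int[OF bij_is_inj[OF phomeo_UNIV(1)[OF \<sigma>(1)]], of "A \<inter> D" "A - D"] by auto
  moreover have "open (A \<inter> D)" "open (A - D)" using D insert.prems by (auto simp: clopen_def)
  ultimately have "phomeo ((A \<inter> D) \<union> (A - D)) (\<sigma> ` (A \<inter> D) \<union> \<sigma> ` (A - D)) u"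
    by (intro phomeo_Un p1 p2)
  moreover have "(A \<inter> D) \<union> (A - D) = A" "\<sigma> ` (A \<inter> D) \<union> \<sigma> ` (A - D) = \<sigma> ` A" by auto
  ultimately have "phomeo A (\<sigma> ` A) u" by simp
  moreover have "\<forall>x\<in>A. forward T x (u x)" using u1(2) u2(2) by (simp add: u_def)
  moreover have "u ` (A \<inter> E) = \<sigma> ` (A \<inter> E)" if "E \<in> insert D P" for E
  proof (cases "E = D")
    case True
    then show ?thesis using phomeoD(3)[OF p1] by simp
  next
    case False
    then have E: "E \<in> P" using that by simp
    have "u ` (A \<inter> D \<inter> E) = u1 ` (A \<inter> D \<inter> E)" "u ` ((A - D) \<inter> E) = u2 ` ((A - D) \<inter> E)"
      by (auto intro!: image_cong simp: u_def)
    then have "u ` (A \<inter> D \<inter> E) \<union> u ` ((A - D) \<inter> E) = \<sigma> ` (A \<inter> D \<inter> E) \<union> \<sigma> ` ((A - D) \<inter> E)"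
      using u1(3)[OF E] u2(3)[OF E] by simp
    moreover have "A \<inter> E = (A \<inter> D \<inter> E) \<union> ((A - D) \<inter> E)" by auto
    ultimately show ?thesis by (metis image_Un)
  qed
  ultimately show ?case by blast
qed

end

lemma minimal_cantor_system_conjugate:
  fixes T :: "'a::topological_space \<Rightarrow> 'a" and h :: "'a \<Rightarrow> 'b::topological_space"
  assumes T: "minimal_cantor_system T" and h: "homeo h"
    and Y: "cantor_space (euclidean :: 'b topology)"
  shows "minimal_cantor_system (h \<circ> T \<circ> inv_into UNIV h)"
proof -
  interpret T: minimal_cantor T by unfold_locales fact
  define S where "S = h \<circ> T \<circ> inv_into UNIV h"
  have bij: "bij h" by (rule phomeo_UNIV(1)[OF h])
  have S: "homeo S"
    unfolding S_def by (rule phomeo_comp[OF phomeo_inv[OF h] phomeo_comp[OF T.T_phomeo h]])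
  have Sh: "S (h x) = h (T x)" for x using bij by (simp add: S_def bij_is_inj)
  have Shn: "(S ^^ n) (h x) = h ((T ^^ n) x)" for n x by (induction n) (simp_all add: Sh)
  have S'h: "inv_into UNIV S (h x) = h (inv_into UNIV T x)" for x
  proof -
    have "h x = S (h (inv_into UNIV T x))" unfolding Sh using T.bij_T by (simp add: bij_is_surj surj_f_inv_f)
    then show ?thesis using bij_is_inj[OF phomeo_UNIV(1)[OF S]] by (metis inv_f_f)
  qed
  have S'hn: "(inv_into UNIV S ^^ n) (h x) = h ((inv_into UNIV T ^^ n) x)" for n x
    by (induction n) (simp_all add: S'h)
  have "closure (orbit S y) = UNIV" for y
  proof (rule ccontr)
    assume "closure (orbit S y) \<noteq> UNIV"
    then have o: "open (- closure (orbit S y))" "- closure (orbit S y) \<noteq> {}" by auto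
    obtain x where x: "y = h x" using bij by (metis bij_is_surj surjD)
    let ?W = "h -` (- closure (orbit S y))"
    have "open ?W" using o(1) phomeo_UNIV(2)[OF h] by (simp add: continuous_on_open_vimage)
    moreover have "?W \<noteq> {}" using o(2) bij by (metis bij_is_surj surj_image_vimage_eq image_empty)
    ultimately obtain n where "(T ^^ n) x \<in> ?W \<or> (inv_into UNIV T ^^ n) x \<in> ?W"
      using T.orbit_meets by metis
    moreover have "h ((T ^^ n) x) \<in> orbit S y" "h ((inv_into UNIV T ^^ n) x) \<in> orbit S y"
      unfolding orbit_def x Shn[symmetric] S'hn[symmetric] by blast+
    ultimately show False using closure_subset by blast
  qed
  then show ?thesis unfolding S_def[symmetric] using S Y by (simp add: minimal_cantor_system_def homeomorphic_map_euclidean_iff)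
qed

section \<open>One conjugation step, and the limit of the conjugacies\<close>

context minimal_cantor
begin

lemma conjugate_UNIV:
  assumes "homeo \<psi>" "homeo \<sigma>"
  shows "homeo (\<psi> \<circ> \<sigma> \<circ> inv_into UNIV \<psi>)"
  by (rule phomeo_comp[OF phomeo_inv[OF assms(1)] phomeo_comp[OF assms(2,1)]])

text \<open>The map \<open>\<psi>\<close> intertwines \<open>\<sigma>\<close> with \<open>\<tau>\<close> outside \<open>R'\<close>. It maps every \<open>Q\<close> in \<open>QQ\<close> to itself because
  \<open>\<tau>\<close> and \<open>\<sigma>\<close> agree, as maps of sets, on the finitely many translates of \<open>Q\<close> that occur.\<close>

lemma conjugate_step:
  assumes \<sigma>: "minimal_cantor_system \<sigma>" "preserves \<sigma>"
    and R: "clopen R" "\<And>x. x \<notin> R \<Longrightarrow> forward T x (\<sigma> x)"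
    and R': "clopen R'" "x1 \<in> R'" "R' \<subseteq> R"
    and UU: "finite UU" "\<And>U. U \<in> UU \<Longrightarrow> clopen U"
  obtains \<psi> where "homeo \<psi>" "preserves \<psi>" "\<psi> x1 = x1" "\<psi> (\<sigma> x1) = \<sigma> x1"
    "\<And>U. U \<in> UU \<Longrightarrow> \<psi> ` U = U"
    "\<And>x. x \<notin> R \<Longrightarrow> (\<psi> \<circ> \<sigma> \<circ> inv_into UNIV \<psi>) x = \<sigma> x"
    "\<And>x. x \<notin> R' \<Longrightarrow> forward T x ((\<psi> \<circ> \<sigma> \<circ> inv_into UNIV \<psi>) x)"
proof -
  interpret S: minimal_cantor \<sigma> by unfold_locales fact
  note ph = S.T_phomeo and bij = S.bij_T
  \<comment> \<open>Height 0 at \<open>x1\<close> and at \<open>\<sigma> x1\<close> makes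
    \<open>\<psi>\<close> fix both points, which keeps the value of the conjugated map at
    \<open>x1\<close>.\<close>
  obtain m :: "'a \<Rightarrow> int" where m: "cts m" "\<And>x. x \<notin> R' \<Longrightarrow> m (\<sigma> x) = m x + 1"
    "m x1 = 0" "m (\<sigma> x1) = 0"
    using S.height_function[OF R'(1,2)] by blast
  obtain K where K: "K \<ge> 0" "\<And>x. \<bar>m x\<bar> \<le> K" using continuous_bounded[OF m(1)] by blast
  \<comment> \<open>Sets that \<open>\<psi>\<close> must map onto themselves: \<open>R'\<close>, so
    that points off it stay off it; the level sets of \<open>m\<close>, so that the pieces of
    \<open>\<psi>\<close> fit together; and the members of \<open>UU\<close>.\<close>
  define QQ where "QQ = insert R' (UU \<union> (\<lambda>k. m -` {k}) ` range m)"
  have QQ: "finite QQ" "\<And>Q. Q \<in> QQ \<Longrightarrow> clopen Q"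
    using UU R'(1) finite_range_discrete[OF m(1)] clopen_vimage_discrete[OF m(1)] by (auto simp: QQ_def)
  define P where "P = (\<lambda>(i, Q). zpow \<sigma> i ` Q) ` ({-K..K} \<times> QQ)"
  have P: "finite P" "\<And>D. D \<in> P \<Longrightarrow> clopen D"
    using QQ phomeo_UNIV(3)[OF phomeo_zpow[OF ph]] by (auto simp: P_def)
  \<comment> \<open>Off \<open>R\<close> the map already moves points forward, and \<open>R'\<close>
    is left for later; only the difference is treated now.\<close>
  define A where "A = R - R'"
  have A: "clopen A" using R(1) R'(1) by (simp add: A_def)
  from forward_refinement[OF ph \<sigma>(2) P A] obtain u where u0: "phomeo A (\<sigma> ` A) u \<and>
    (\<forall>x\<in>A. forward T x (u x)) \<and> (\<forall>D\<in>P. u ` (A \<inter> D) = \<sigma> ` (A \<inter> D))" ..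
  have u: "phomeo A (\<sigma> ` A) u" "\<And>x. x \<in> A \<Longrightarrow> forward T x (u x)" "\<And>D. D \<in> P \<Longrightarrow> u ` (A \<inter> D) = \<sigma> ` (A \<inter> D)"
    using u0 by simp_all
  define \<tau> where "\<tau> = (\<lambda>x. if x \<in> A then u x else \<sigma> x)"
  have ph\<tau>: "homeo \<tau>"
  proof -
    have "phomeo A (\<sigma> ` A) \<tau>" by (rule phomeo_cong[OF u(1)]) (simp add: \<tau>_def)
    moreover have "phomeo (- A) (\<sigma> ` (- A)) \<tau>"
      by (rule phomeo_cong[OF phomeo_subset[OF ph]]) (auto simp: \<tau>_def)
    moreover have "\<sigma> ` A \<inter> \<sigma> ` (- A) = {}" using image_Int[OF bij_is_inj[OF bij], of A "- A"] by simp
    moreover have "open A" "open (- A)" using A by (auto simp: clopen_def)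
    ultimately have "phomeo (A \<union> - A) (\<sigma> ` A \<union> \<sigma> ` (- A)) \<tau>" by (intro phomeo_Un)
    moreover have "\<sigma> ` A \<union> \<sigma> ` (- A) = UNIV" "A \<union> - A = UNIV"
      using bij_is_surj[OF bij] by (auto simp flip: image_Un)
    ultimately show ?thesis by simp
  qed
  have bij\<tau>: "bij \<tau>" by (rule phomeo_UNIV(1)[OF ph\<tau>])
  have pres\<tau>: "preserves \<tau>"
    unfolding \<tau>_def
    by (rule preserves_If[OF A ph\<tau>[unfolded \<tau>_def] _ \<sigma>(2)])
       (rule forward_phomeo_preserves[OF u(1) A _ _ u(2)])
  have \<tau>P: "\<tau> ` D = \<sigma> ` D" if "D \<in> P" for D
  proof -
    have "\<tau> ` (A \<inter> D) = u ` (A \<inter> D)" "\<tau> ` (D - A) = \<sigma> ` (D - A)"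
      by (auto simp: \<tau>_def intro!: image_cong)
    then have "\<tau> ` ((A \<inter> D) \<union> (D - A)) = \<sigma> ` ((A \<inter> D) \<union> (D - A))"
      unfolding image_Un using u(3)[OF that] by simp
    moreover have "(A \<inter> D) \<union> (D - A) = D" by auto
    ultimately show ?thesis by simp
  qed
  \<comment> \<open>Go down \<open>k\<close> levels of a tower by \<open>\<sigma>\<close> and climb
    back by \<open>\<tau>\<close>.\<close>
  define g where "g k = zpow \<tau> k \<circ> zpow \<sigma> (- k)" for k
  have g: "homeo (g k)" "preserves (g k)" for k
    unfolding g_def
    by (rule phomeo_comp[OF phomeo_zpow[OF ph] phomeo_zpow[OF ph\<tau>]])
       (rule preserves_comp[OF phomeo_zpow[OF ph] preserves_zpow[OF ph \<sigma>(2)] preserves_zpow[OF ph\<tau> pres\<tau>]])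
  have gQ: "g k ` Q = Q" if "Q \<in> QQ" "k \<in> range m" for k Q
  proof -
    have k: "- K \<le> k" "k \<le> K" using K(2) that(2) by (auto simp: abs_le_iff minus_le_iff)
    have "zpow \<tau> k ` zpow \<sigma> (- k) ` Q = zpow \<sigma> (- k + k) ` Q"
    proof (rule zpow_image_track[OF bij\<tau> bij])
      fix i assume "- K \<le> i" "i \<le> K"
      then have "zpow \<sigma> i ` Q \<in> P" using that(1) by (auto simp: P_def)
      then show "\<tau> ` zpow \<sigma> i ` Q = \<sigma> ` zpow \<sigma> i ` Q" by (rule \<tau>P)
    qed (use k K(1) in auto)
    then show ?thesis unfolding g_def image_comp[symmetric] by simp
  qed
  define \<psi> where "\<psi> = (\<lambda>x. g (m x) x)"
  have lev: "g k ` (m -` {k}) = m -` {k}" if "k \<in> range m" for k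
    by (rule gQ) (use that in \<open>auto simp: QQ_def\<close>)
  have ph\<psi>: "homeo \<psi>" unfolding \<psi>_def by (rule piecewise_homeo(1)[OF m(1) g lev])
  have pres\<psi>: "preserves \<psi>" unfolding \<psi>_def by (rule piecewise_homeo(2)[OF m(1) g lev])
  have \<psi>Q: "\<psi> ` Q = Q" if "Q \<in> QQ" for Q
    unfolding \<psi>_def by (rule piecewise_homeo(3)[OF m(1) g lev gQ[OF that]])
  have bij\<psi>: "bij \<psi>" by (rule phomeo_UNIV(1)[OF ph\<psi>])
  have comm: "\<psi> (\<sigma> x) = \<tau> (\<psi> x)" if "x \<notin> R'" for x
  proof -
    \<comment> \<open>Off \<open>R'\<close> the height grows by 1: the extra \<open>\<sigma>\<close>
      is absorbed on the way down, and one more \<open>\<tau>\<close> is left on the way up.\<close>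
    have "\<psi> (\<sigma> x) = zpow \<tau> (m x + 1) (zpow \<sigma> (- m x - 1) (\<sigma> x))"
      using m(2)[OF that] by (simp add: \<psi>_def g_def)
    also have "zpow \<sigma> (- m x - 1) (\<sigma> x) = zpow \<sigma> (- m x) x"
      using zpow_Suc(2)[OF bij, of "- m x - 1" x] by simp
    finally show ?thesis by (simp add: zpow_Suc(1)[OF bij\<tau>] \<psi>_def g_def)
  qed
  have conj: "(\<psi> \<circ> \<sigma> \<circ> inv_into UNIV \<psi>) x = \<tau> x" if "x \<notin> R'" for x
  proof -
    have x: "\<psi> (inv_into UNIV \<psi> x) = x" using bij\<psi> by (simp add: bij_is_surj surj_f_inv_f)
    have "inv_into UNIV \<psi> x \<notin> R'"
    proof
      assume "inv_into UNIV \<psi> x \<in> R'"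
      then have "\<psi> (inv_into UNIV \<psi> x) \<in> \<psi> ` R'" by blast
      then show False using x \<psi>Q[of R'] that by (simp add: QQ_def)
    qed
    then show ?thesis using comm x by simp
  qed
  show ?thesis
  proof (rule that[OF ph\<psi> pres\<psi>])
    show "\<psi> x1 = x1" "\<psi> (\<sigma> x1) = \<sigma> x1" using m by (simp_all add: \<psi>_def g_def)
    show "\<psi> ` U = U" if "U \<in> UU" for U using \<psi>Q that by (simp add: QQ_def)
    show "(\<psi> \<circ> \<sigma> \<circ> inv_into UNIV \<psi>) x = \<sigma> x" if "x \<notin> R" for x
      using conj[of x] that R'(3) by (auto simp: \<tau>_def A_def)
    show "forward T x ((\<psi> \<circ> \<sigma> \<circ> inv_into UNIV \<psi>) x)" if "x \<notin> R'" for x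
      unfolding conj[OF that] using u(2) R(2) that by (auto simp: \<tau>_def A_def)
  qed
qed

text \<open>A conjugacy that fixes \<open>x1\<close> and sends \<open>\<sigma> x1\<close> to
  \<open>T x1\<close>. It is the identity near \<open>x1\<close> and a forward homeomorphism of the
  complement with one prescribed value.\<close>

lemma conjugate_initial:
  assumes \<sigma>: "minimal_cantor_system \<sigma>" "preserves \<sigma>"
  obtains \<psi> where "homeo \<psi>" "preserves \<psi>" "(\<psi> \<circ> \<sigma> \<circ> inv_into UNIV \<psi>) x1 = T x1"
proof -
  interpret S: minimal_cantor \<sigma> by unfold_locales fact
  have ne: "\<sigma> x1 \<noteq> x1" "T x1 \<noteq> x1" using S.aperiodic[of 1 x1] aperiodic[of 1 x1] by auto
  obtain V where V: "clopen V" "x1 \<in> V" "V \<inter> {\<sigma> x1, T x1} = {}"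
    by (rule clopen_avoid_finite[of "{\<sigma> x1, T x1}" x1]) (use ne in simp_all)
  define A where "A = - V"
  have A: "clopen A" "\<sigma> x1 \<in> A" "T x1 \<in> A" "x1 \<notin> A" using V by (auto simp: A_def)
  obtain u where u: "phomeo A A u" "u (\<sigma> x1) = T x1" "\<And>x. x \<in> A \<Longrightarrow> x \<noteq> \<sigma> x1 \<Longrightarrow> forward T x (u x)"
    by (rule forward_homeomorphism[OF A(1,2) A(1,3)]) auto
  let ?\<psi> = "\<lambda>x. if x \<in> A then u x else x"
  have ph: "homeo ?\<psi>"
  proof -
    have "phomeo A A ?\<psi>" by (rule phomeo_cong[OF u(1)]) simp
    moreover have "phomeo (- A) (- A) ?\<psi>" by (rule phomeo_cong[OF phomeo_id]) simp
    ultimately have "phomeo (A \<union> - A) (A \<union> - A) ?\<psi>"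
      using A(1) by (intro phomeo_Un) (auto simp: clopen_def)
    then show ?thesis by simp
  qed
  have off: "measure \<mu> (u ` U) = measure \<mu> U"
    if "clopen U" "U \<subseteq> A" "\<sigma> x1 \<notin> U" "\<mu> \<in> M" for U \<mu>
    using that u(3) by (intro forward_phomeo_preserves[OF phomeo_subset[OF u(1)], of U U]) auto
  have "preserves ?\<psi>"
  proof (rule preserves_If[OF A(1) ph])
    fix U :: "'a set" and \<mu> assume U: "clopen U" "U \<subseteq> A" and \<mu>: "\<mu> \<in> M"
    show "measure \<mu> (u ` U) = measure \<mu> U"
    proof (cases "\<sigma> x1 \<in> U")
      case True
      have uU: "clopen (u ` U)" "u ` U \<subseteq> A"
        using phomeo_clopen_image[OF u(1) A(1) A(1) U] phomeoD(3)[OF u(1)] U(2) by auto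
      \<comment> \<open>\<open>u\<close> is not known to move \<open>\<sigma> x1\<close> forward, so
        a set containing this point is measured through its complement in \<open>A\<close>.\<close>
      have "u ` (A - U) = A - u ` U"
        using inj_on_image_set_diff[OF phomeoD(2)[OF u(1)], of A U] U(2) phomeoD(3)[OF u(1)] by auto
      then have "measure \<mu> (A - u ` U) = measure \<mu> (A - U)"
        using off[of "A - U" \<mu>] A U(1) True \<mu> by auto
      then show ?thesis using M_measure_Diff[OF \<mu> A(1) U] M_measure_Diff[OF \<mu> A(1) uU] by simp
    qed (use off U \<mu> in blast)
  qed (rule preserves_id)
  moreover have "(?\<psi> \<circ> \<sigma> \<circ> inv_into UNIV ?\<psi>) x1 = T x1"
  proof -
    have "inv_into UNIV ?\<psi> x1 = x1"
      using bij_is_inj[OF phomeo_UNIV(1)[OF ph]] A(4) by (metis (mono_tags, lifting) inv_f_f)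
    then show ?thesis using A u(2) by simp
  qed
  ultimately show ?thesis using that ph by blast
qed

text \<open>At stage \<open>n\<close> the conjugate of \<open>\<sigma>\<close> by \<open>H n\<close>
  moves points forward off \<open>R n\<close>, and later stages no longer change it there. At
  \<open>x1\<close> it has the value \<open>T x1\<close> at every stage. The maps \<open>H n\<close>
  stabilise on each clopen set, which is convergence in the sense of Stone duality.\<close>

lemma forward_conjugate_pointed:
  assumes \<sigma>: "minimal_cantor_system \<sigma>" "preserves \<sigma>" "\<sigma> x1 = T x1"
  obtains H where "homeo H" "\<And>x. forward T x ((H \<circ> \<sigma> \<circ> inv_into UNIV H) x)"
proof -
  interpret S: minimal_cantor \<sigma> by unfold_locales fact
  obtain c :: "nat \<Rightarrow> 'a set" where c: "range c = {U. clopen U}" using enumerate_clopen by blast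
  have cl_c: "clopen (c n)" for n using c by auto
  have c_ex: "\<exists>k. c k = W" if "clopen W" for W using c that by (metis mem_Collect_eq rangeE)
  define V where "V n = (if x1 \<in> c n then c n else - c n)" for n
  have V: "clopen (V n)" "x1 \<in> V n" for n using cl_c by (auto simp: V_def)
  define cj where "cj H = H \<circ> \<sigma> \<circ> inv_into UNIV H" for H :: "'a \<Rightarrow> 'a"
  define P where "P = (\<lambda>(H, R). homeo H \<and> preserves H \<and> H x1 = x1 \<and> H (T x1) = T x1 \<and>
    clopen R \<and> x1 \<in> R \<and> (\<forall>x. x \<notin> R \<longrightarrow> forward T x (cj H x)))"
  \<comment> \<open>Both images and preimages of \<open>c k\<close> are frozen: images define the
    limit on clopen sets, preimages show that it reaches all of them.\<close>
  define Q where "Q n = (\<lambda>(H, R) (H', R'). R' \<subseteq> R \<inter> V n \<and> (\<forall>k\<le>n. H' ` c k = H ` c k \<and> H' -` c k = H -` c k) \<and>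
    (\<forall>x. x \<notin> R \<longrightarrow> cj H' x = cj H x))" for n
  have step: "\<exists>y. P y \<and> Q n x y" if "P x" for x n
  proof -
    obtain H R where x: "x = (H, R)" by (cases x)
    have H: "homeo H" "preserves H" "H x1 = x1" "H (T x1) = T x1" "clopen R" "x1 \<in> R"
      "\<And>x. x \<notin> R \<Longrightarrow> forward T x (cj H x)" using \<open>P x\<close> x by (auto simp: P_def)
    have bijH: "bij H" by (rule phomeo_UNIV(1)[OF H(1)])
    have m: "minimal_cantor_system (cj H)"
      unfolding cj_def by (rule minimal_cantor_system_conjugate[OF \<sigma>(1) H(1) cantor])
    have pr: "preserves (cj H)"
      unfolding cj_def
      by (rule preserves_comp[OF phomeo_inv[OF H(1)] preserves_inv[OF H(1,2)] preserves_comp[OF S.T_phomeo \<sigma>(2) H(2)]])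
    have "inv_into UNIV H x1 = x1" using H(3) bijH by (metis bij_is_inj inv_f_f)
    then have cjx1: "cj H x1 = T x1" using H(4) \<sigma>(3) by (simp add: cj_def)
    \<comment> \<open>If \<open>\<psi>\<close> preserves \<open>c k\<close>, preimages of
      \<open>c k\<close> do not change; if it preserves the image of \<open>c k\<close> under
      \<open>H\<close>, images do not change.\<close>
    define UU where "UU = c ` {..n} \<union> (\<lambda>k. H ` c k) ` {..n}"
    have UU: "finite UU" "\<And>U. U \<in> UU \<Longrightarrow> clopen U"
      using cl_c phomeo_UNIV(3)[OF H(1)] by (auto simp: UU_def)
    have RV: "clopen (R \<inter> V n)" "x1 \<in> R \<inter> V n" "R \<inter> V n \<subseteq> R" using H(5,6) V by auto
    obtain \<psi> where \<psi>: "homeo \<psi>" "preserves \<psi>" "\<psi> x1 = x1" "\<psi> (cj H x1) = cj H x1"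
      "\<And>U. U \<in> UU \<Longrightarrow> \<psi> ` U = U"
      "\<And>x. x \<notin> R \<Longrightarrow> (\<psi> \<circ> cj H \<circ> inv_into UNIV \<psi>) x = cj H x"
      "\<And>x. x \<notin> R \<inter> V n \<Longrightarrow> forward T x ((\<psi> \<circ> cj H \<circ> inv_into UNIV \<psi>) x)"
      by (rule conjugate_step[OF m pr H(5,7) RV UU]) (assumption, assumption, (rule that; (assumption | simp only: simp_thms)))
    have bij\<psi>: "bij \<psi>" by (rule phomeo_UNIV(1)[OF \<psi>(1)])
    have cj': "cj (\<psi> \<circ> H) = \<psi> \<circ> cj H \<circ> inv_into UNIV \<psi>"
      unfolding cj_def o_inv_distrib[OF bij\<psi> bijH] by (simp add: o_assoc)
    have "(\<psi> \<circ> H) ` c k = H ` c k" if "k \<le> n" for k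
      using \<psi>(5)[of "H ` c k"] that by (simp add: UU_def image_comp)
    moreover have "(\<psi> \<circ> H) -` c k = H -` c k" if "k \<le> n" for k
    proof -
      have "\<psi> -` c k = \<psi> -` (\<psi> ` c k)" using \<psi>(5)[of "c k"] that by (simp add: UU_def)
      then have "\<psi> -` c k = c k" using bij\<psi> by (simp add: bij_is_inj inj_vimage_image_eq)
      then show ?thesis by (simp add: vimage_comp[symmetric])
    qed
    ultimately have "Q n x (\<psi> \<circ> H, R \<inter> V n)"
      using \<psi>(6) RV(3) by (simp add: x Q_def cj')
    moreover have "P (\<psi> \<circ> H, R \<inter> V n)"
      using phomeo_comp[OF H(1) \<psi>(1)] preserves_comp[OF H(1,2) \<psi>(2)] H(3,4) \<psi>(3,4,7) cjx1 RV
      by (simp add: P_def cj')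
    ultimately show ?thesis by blast
  qed
  have init: "P (\<lambda>x. x, UNIV)" by (simp add: P_def phomeo_id preserves_id)
  have "\<exists>s. \<forall>n. P (s n) \<and> Q n (s n) (s (Suc n))"
  proof (rule dependent_nat_choice)
    show "\<exists>x. P x" using init by (rule exI)
    show "\<exists>y. P y \<and> Q n x y" if "P x" for x n using that by (rule step)
  qed
  then obtain s where s: "\<forall>n. P (s n) \<and> Q n (s n) (s (Suc n))" ..
  define H R where "H n = fst (s n)" and "R n = snd (s n)" for n
  have sn: "s n = (H n, R n)" for n by (simp add: H_def R_def)
  have P: "homeo (H n)" "H n x1 = x1" "H n (T x1) = T x1" "clopen (R n)" "x1 \<in> R n"
    "\<And>x. x \<notin> R n \<Longrightarrow> forward T x (cj (H n) x)" for n
    using s[THEN spec, THEN conjunct1, of n] unfolding sn P_def by auto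
  have Q: "R (Suc n) \<subseteq> R n \<inter> V n" "\<And>k. k \<le> n \<Longrightarrow> H (Suc n) ` c k = H n ` c k"
    "\<And>k. k \<le> n \<Longrightarrow> H (Suc n) -` c k = H n -` c k" "\<And>x. x \<notin> R n \<Longrightarrow> cj (H (Suc n)) x = cj (H n) x" for n
    using s[THEN spec, THEN conjunct2, of n] unfolding sn Q_def by auto
  have bijH: "bij (H n)" for n by (rule phomeo_UNIV(1)[OF P(1)])
  have im: "H n ` c k = H k ` c k" and vim: "H n -` c k = H k -` c k" if "k \<le> n" for k n
    using that by (induction rule: dec_induct) (simp_all add: Q)
  have antiR: "R n \<subseteq> R k" if "k \<le> n" for k n
    using that by (induction rule: dec_induct) (use Q(1) in blast)+
  have cj_stable: "cj (H n) x = cj (H k) x" if "k \<le> n" "x \<notin> R k" for k n x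
    using that(1)
  proof (induction rule: dec_induct)
    case (step n)
    then show ?case using Q(4)[of x n] antiR[of k n] that(2) by auto
  qed simp
  \<comment> \<open>The final image of \<open>c k\<close>, since no stage after \<open>k\<close>
    alters it.\<close>
  define d where "d k = H k ` c k" for k
  have d: "clopen (d k)" for k using phomeo_UNIV(3)[OF P(1)] cl_c by (simp add: d_def)
  have d_ex: "\<exists>k. d k = c j \<and> c k = H j -` c j" for j
  proof -
    obtain k where k: "c k = H j -` c j" using c_ex phomeo_UNIV(4)[OF P(1)] cl_c by metis
    have "d k = H (max j k) ` c k" unfolding d_def by (rule im[symmetric]) simp
    also have "\<dots> = H (max j k) ` (H (max j k) -` c j)" unfolding k by (subst vim[of j "max j k"]) simp_all
    also have "\<dots> = c j" using bijH by (simp add: bij_is_surj surj_image_vimage_eq)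
    finally show ?thesis using k by blast
  qed
  have fin: "\<forall>i\<in>J. x \<in> c i \<longleftrightarrow> H (Max (insert 0 J)) x \<in> d i" if "finite J" for J x
  proof
    fix i assume "i \<in> J"
    then have "d i = H (Max (insert 0 J)) ` c i" unfolding d_def using that by (intro im[symmetric]) simp
    then show "x \<in> c i \<longleftrightarrow> H (Max (insert 0 J)) x \<in> d i" using bijH by (simp add: bij_is_inj inj_image_mem_iff)
  qed
  obtain F where F: "homeo F" "\<And>i x. F x \<in> d i \<longleftrightarrow> x \<in> c i"
  proof (rule Stone_duality[OF cantor cantor cl_c d])
    show "W \<in> range c" if "clopen W" for W using c that by simp
    show "W \<in> range d" if "clopen W" for W using c_ex[OF that] d_ex by (metis rangeI)
    show "\<exists>y. \<forall>i\<in>J. x \<in> c i \<longleftrightarrow> y \<in> d i" if "finite J" for J x using fin[OF that] by blast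
    show "\<exists>x. \<forall>i\<in>J. x \<in> c i \<longleftrightarrow> y \<in> d i" if "finite J" for J y
    proof -
      obtain x where "y = H (Max (insert 0 J)) x" using bijH by (metis bij_is_surj surjD)
      then show ?thesis using fin[OF that] by blast
    qed
  qed blast
  have lim: "F x \<in> c j \<longleftrightarrow> H n x \<in> c j" if "j \<le> n" for x j n
  proof -
    obtain k where k: "d k = c j" "c k = H j -` c j" using d_ex by blast
    have "F x \<in> c j \<longleftrightarrow> x \<in> H j -` c j" using F(2)[of x k] k by simp
    also have "H j -` c j = H n -` c j" using vim[OF that] by simp
    finally show ?thesis by simp
  qed
  have eqI: "x = y" if "\<And>j. x \<in> c j \<longleftrightarrow> y \<in> c j" for x y
    using clopen_separate[of x y] c_ex that by metis
  have lim': "F x \<in> c j \<longleftrightarrow> H j x \<in> c j" for x j by (rule lim) simp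
  have Ffix: "F x1 = x1" "F (T x1) = T x1"
    by (rule eqI, simp add: lim' P(2,3))+
  have bijF: "bij F" by (rule phomeo_UNIV(1)[OF F(1)])
  have "forward T x (cj F x)" for x
  proof (cases "x = x1")
    case True
    then have "inv_into UNIV F x = x1" using Ffix(1) bijF by (metis bij_is_inj inv_f_f)
    then have "cj F x = T x" using True \<sigma>(3) Ffix(2) by (simp add: cj_def)
    then show ?thesis unfolding forward_def by (intro exI[of _ 1]) simp
  next
    case False
    obtain i where i: "x1 \<in> c i" "x \<notin> c i" using clopen_separate[of x1 x] False c_ex by metis
    \<comment> \<open>\<open>R (Suc i)\<close> lies in \<open>V i\<close>, which is
      \<open>c i\<close> because \<open>x1\<close> belongs to \<open>c i\<close>; hence it misses
      \<open>x\<close>.\<close>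
    define n where "n = Suc i"
    have xR: "x \<notin> R n" using i Q(1)[of i] by (auto simp: V_def n_def)
    define z where "z = inv_into UNIV F x"
    have Fz: "F z = x" using bijF by (simp add: z_def bij_is_surj surj_f_inv_f)
    have cjH: "cj (H m) (H m z) = H m (\<sigma> z)" for m z using bijH by (simp add: cj_def bij_is_inj)
    have ph_cj: "homeo (cj (H n))"
      unfolding cj_def by (rule conjugate_UNIV[OF P(1) S.T_phomeo])
    have "cj F x = cj (H n) x"
    proof (rule eqI)
      fix j
      \<comment> \<open>For points off \<open>R n\<close>, being sent into \<open>c j\<close> is
        membership in a clopen set. At a late stage \<open>m\<close> the point \<open>H m z\<close>
        agrees with \<open>x\<close> about the two clopen sets involved, so the values at these
        points can be compared although the points may differ.\<close>
      have "clopen (- R n \<inter> cj (H n) -` c j)" "clopen (- R n)"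
        using P(4) phomeo_UNIV(4)[OF ph_cj] cl_c by auto
      then obtain a b where ab: "c a = - R n \<inter> cj (H n) -` c j" "c b = - R n" using c_ex by metis
      define m where "m = max (max n j) (max a b)"
      have le: "n \<le> m" "j \<le> m" "a \<le> m" "b \<le> m" by (auto simp: m_def)
      have Rm: "H m z \<notin> R n" using lim[OF le(4), of z] ab(2) Fz xR by auto
      have "cj F x \<in> c j \<longleftrightarrow> F (\<sigma> z) \<in> c j" by (simp add: cj_def z_def)
      also have "\<dots> \<longleftrightarrow> cj (H m) (H m z) \<in> c j" using lim[OF le(2)] cjH by simp
      also have "\<dots> \<longleftrightarrow> H m z \<in> c a" using cj_stable[OF le(1) Rm] Rm ab(1) by simp
      also have "\<dots> \<longleftrightarrow> x \<in> c a" using lim[OF le(3), of z] Fz by simp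
      also have "\<dots> \<longleftrightarrow> cj (H n) x \<in> c j" using ab(1) xR by simp
      finally show "cj F x \<in> c j \<longleftrightarrow> cj (H n) x \<in> c j" .
    qed
    then show ?thesis using P(6)[OF xR] by simp
  qed
  then show ?thesis using that F(1) unfolding cj_def by blast
qed

lemma forward_conjugate:
  assumes \<sigma>: "minimal_cantor_system \<sigma>" "preserves \<sigma>"
  obtains H where "homeo H" "\<And>x. forward T x (H (\<sigma> (inv_into UNIV H x)))"
proof -
  fix x1 :: 'a
  interpret S: minimal_cantor \<sigma> by unfold_locales fact
  obtain \<psi> where \<psi>: "homeo \<psi>" "preserves \<psi>" "(\<psi> \<circ> \<sigma> \<circ> inv_into UNIV \<psi>) x1 = T x1"
    using conjugate_initial[OF \<sigma>] by blast
  have m: "minimal_cantor_system (\<psi> \<circ> \<sigma> \<circ> inv_into UNIV \<psi>)"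
    by (rule minimal_cantor_system_conjugate[OF \<sigma>(1) \<psi>(1) cantor])
  have pr: "preserves (\<psi> \<circ> \<sigma> \<circ> inv_into UNIV \<psi>)"
    by (rule preserves_comp[OF phomeo_inv[OF \<psi>(1)] preserves_inv[OF \<psi>(1,2)] preserves_comp[OF S.T_phomeo \<sigma>(2) \<psi>(2)]])
  obtain H where H: "homeo H"
    "\<And>x. forward T x ((H \<circ> (\<psi> \<circ> \<sigma> \<circ> inv_into UNIV \<psi>) \<circ> inv_into UNIV H) x)"
    by (rule forward_conjugate_pointed[OF m pr \<psi>(3)]) (rule that; (assumption | simp only: simp_thms))
  have "inv_into UNIV (H \<circ> \<psi>) = inv_into UNIV \<psi> \<circ> inv_into UNIV H"
    by (rule o_inv_distrib[OF phomeo_UNIV(1)[OF H(1)] phomeo_UNIV(1)[OF \<psi>(1)]])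
  then show ?thesis using that[OF phomeo_comp[OF \<psi>(1) H(1)]] H(2) by simp
qed

end

section \<open>Speedups and embeddings of invariant measures\<close>

lemma inj_on_distr_phomeo:
  fixes F :: "'a::topological_space \<Rightarrow> 'b::topological_space"
  assumes F: "homeo F" and N: "\<And>\<mu>. \<mu> \<in> N \<Longrightarrow> borel_prob \<mu>"
  shows "inj_on (\<lambda>\<mu>. distr \<mu> borel F) N"
proof (rule inj_on_inverseI[where g = "\<lambda>\<nu>. distr \<nu> borel (inv_into UNIV F)"])
  fix \<mu> assume "\<mu> \<in> N"
  then have \<mu>: "borel_prob \<mu>" by (rule N)
  have Fm: "F \<in> measurable \<mu> borel" by (rule borel_prob_measurable[OF phomeo_UNIV(2)[OF F] \<mu>])
  have F'm: "inv_into UNIV F \<in> measurable borel borel"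
    by (rule borel_measurable_continuous_onI[OF phomeo_UNIV(2)[OF phomeo_inv[OF F]]])
  have "distr (distr \<mu> borel F) borel (inv_into UNIV F) = distr \<mu> borel (inv_into UNIV F \<circ> F)"
    by (rule distr_distr[OF F'm Fm])
  also have "inv_into UNIV F \<circ> F = (\<lambda>x. x)" using phomeo_UNIV(1)[OF F] by (auto simp: bij_is_inj)
  also have "distr \<mu> borel (\<lambda>x. x) = \<mu>" using \<mu> by (intro distr_id2) (simp add: borel_prob_def)
  finally show "distr (distr \<mu> borel F) borel (inv_into UNIV F) = \<mu>" .
qed

section \<open>Two systems: from speedups to embeddings of measures and back\<close>

locale cantor_pair = S: minimal_cantor S + T: minimal_cantor T
  for S :: "'b::topological_space \<Rightarrow> 'b" and T :: "'a::topological_space \<Rightarrow> 'a"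
begin

definition embeds :: "('a \<Rightarrow> 'b) \<Rightarrow> bool" where
  "embeds F \<longleftrightarrow> homeo F \<and> (\<forall>\<mu>\<in>T.M. distr \<mu> borel F \<in> S.M)"

lemma distr_F:
  assumes "homeo F" "\<mu> \<in> T.M"
  shows "F \<in> measurable \<mu> borel" "borel_prob (distr \<mu> borel F)"
    "\<And>A. clopen A \<Longrightarrow> measure (distr \<mu> borel F) A = measure \<mu> (F -` A)"
proof -
  show Fm: "F \<in> measurable \<mu> borel"
    by (rule borel_prob_measurable[OF phomeo_UNIV(2)[OF assms(1)] T.M_borel_prob[OF assms(2)]])
  show "borel_prob (distr \<mu> borel F)" by (rule borel_prob_distr[OF Fm T.M_borel_prob[OF assms(2)]])
  show "measure (distr \<mu> borel F) A = measure \<mu> (F -` A)" if "clopen A" for A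
    by (rule measure_distr_borel[OF Fm T.M_borel_prob[OF assms(2)] that])
qed

lemma embeds_iff:
  "(\<exists>F :: 'a \<Rightarrow> 'b. homeomorphic_map euclidean euclidean F \<and>
      (\<lambda>\<mu>. distr \<mu> borel F) ` invariant_measures T \<subseteq> invariant_measures S \<and>
      inj_on (\<lambda>\<mu>. distr \<mu> borel F) (invariant_measures T)) \<longleftrightarrow> (\<exists>F. embeds F)"
  unfolding embeds_def homeomorphic_map_euclidean_iff
  using inj_on_distr_phomeo T.M_borel_prob by blast

text \<open>Both sides of the invariance equation are Borel probabilities, so clopen sets decide
  it.\<close>

lemma embeds_iff_clopen:
  assumes "homeo F"
  shows "embeds F \<longleftrightarrow> (\<forall>\<mu>\<in>T.M. \<forall>W. clopen W \<longrightarrow> measure \<mu> (F -` S -` W) = measure \<mu> (F -` W))"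
proof -
  have "distr \<mu> borel F \<in> S.M \<longleftrightarrow> (\<forall>W. clopen W \<longrightarrow> measure \<mu> (F -` S -` W) = measure \<mu> (F -` W))"
    if \<mu>: "\<mu> \<in> T.M" for \<mu>
  proof -
    note F = distr_F[OF assms \<mu>]
    let ?n = "distr \<mu> borel F"
    have Sm: "S \<in> measurable ?n borel" by (rule borel_prob_measurable[OF S.T_continuous F(2)])
    have SnB: "borel_prob (distr ?n borel S)" by (rule borel_prob_distr[OF Sm F(2)])
    have SnW: "measure (distr ?n borel S) W = measure \<mu> (F -` S -` W)" if "clopen W" for W
      using measure_distr_borel[OF Sm F(2) that] F(3)[of "S -` W"] phomeo_UNIV(4)[OF S.T_phomeo] that by simp
    have "?n \<in> S.M \<longleftrightarrow> distr ?n borel S = ?n"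
      using F(2) by (simp add: invariant_measures_def borel_prob_def)
    also have "\<dots> \<longleftrightarrow> (\<forall>W. clopen W \<longrightarrow> measure (distr ?n borel S) W = measure ?n W)"
      using S.borel_prob_eqI[OF SnB F(2)] by auto
    finally show ?thesis using SnW F(3) by simp
  qed
  then show ?thesis using assms by (simp add: embeds_def)
qed

text \<open>The conjugacy \<open>h\<close> itself embeds the measures. That \<open>T'\<close> is a
  homeomorphism is inherited from \<open>S\<close> through \<open>h\<close>, since nothing about
  \<open>p\<close> would show it; then \<open>T'\<close> is a forward homeomorphism and preserves
  every measure in \<open>T.M\<close>.\<close>

lemma speedup_imp_embeds:
  assumes "is_speedup_of S T"
  shows "\<exists>F. embeds F"
proof -
  obtain p h where p: "\<And>x. p x > (0::nat)" and h: "homeo h" "\<And>x. h ((T ^^ p x) x) = S (h x)"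
    using assms unfolding is_speedup_of_def topologically_conjugate_def homeomorphic_map_euclidean_iff by blast
  define T' where "T' x = (T ^^ p x) x" for x
  have bijh: "bij h" by (rule phomeo_UNIV(1)[OF h(1)])
  have "T' x = (inv_into UNIV h \<circ> (S \<circ> h)) x" for x
    using h(2)[of x] bijh by (simp add: T'_def) (metis bij_is_inj inv_f_f)
  then have "T' = inv_into UNIV h \<circ> (S \<circ> h)" by auto
  then have T': "homeo T'"
    using phomeo_comp[OF phomeo_comp[OF h(1) S.T_phomeo] phomeo_inv[OF h(1)]] by simp
  have fw: "forward T x (T' x)" for x using p[of x] by (auto simp: forward_def T'_def)
  have "embeds h"
    unfolding embeds_iff_clopen[OF h(1)]
  proof (intro ballI allI impI)
    fix \<mu> and W :: "'b set" assume \<mu>: "\<mu> \<in> T.M" and W: "clopen W"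
    let ?U = "h -` S -` W"
    have U: "clopen ?U" using phomeo_UNIV(4)[OF h(1)] phomeo_UNIV(4)[OF S.T_phomeo] W by simp
    have "?U = T' -` h -` W" using h(2) by (auto simp: T'_def)
    then have "T' ` ?U = h -` W" using phomeo_UNIV(1)[OF T'] by (simp add: bij_is_surj surj_image_vimage_eq)
    then show "measure \<mu> ?U = measure \<mu> (h -` W)"
      using T.forward_phomeo_preserves[OF T' _ U _ fw \<mu>] by simp
  qed
  then show ?thesis by blast
qed

text \<open>Transported to \<open>X\<close> by \<open>F\<close>, the map \<open>S\<close> becomes a
  minimal homeomorphism that preserves every measure in \<open>T.M\<close>. A conjugate of it that
  moves each point forward along its \<open>T\<close>-orbit is a speedup, the times being chosen
  point by point.\<close>

lemma embeds_imp_speedup: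
  assumes "embeds F"
  shows "is_speedup_of S T"
proof -
  have F: "homeo F" using assms by (simp add: embeds_def)
  have bijF: "bij F" by (rule phomeo_UNIV(1)[OF F])
  have F': "homeo (inv_into UNIV F)" by (rule phomeo_inv[OF F])
  define \<sigma> where "\<sigma> = inv_into UNIV F \<circ> S \<circ> F"
  have min: "minimal_cantor_system \<sigma>"
    using minimal_cantor_system_conjugate[OF S.minimal F' T.cantor] bijF by (simp add: \<sigma>_def inv_inv_eq)
  have F\<sigma>: "F (\<sigma> x) = S (F x)" for x using bijF by (simp add: \<sigma>_def bij_is_surj surj_f_inv_f)
  have bij\<sigma>: "bij \<sigma>" using min minimal_cantor.bij_T minimal_cantor.intro by blast
  have "T.preserves \<sigma>"
    unfolding T.preserves_def
  proof (intro allI impI ballI)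
    fix U :: "'a set" and \<mu> assume U: "clopen U" and \<mu>: "\<mu> \<in> T.M"
    let ?W = "F ` \<sigma> ` U"
    have inj: "inj F" "inj \<sigma>" using bijF bij\<sigma> by (auto simp: bij_is_inj)
    have "F -` S -` ?W = \<sigma> -` F -` ?W" by (auto simp: F\<sigma>[symmetric])
    also have "\<dots> = U" using inj by (simp add: inj_vimage_image_eq)
    finally have 1: "F -` S -` ?W = U" .
    have 2: "F -` ?W = \<sigma> ` U" using inj by (simp add: inj_vimage_image_eq)
    have "\<sigma> = inv_into UNIV F \<circ> (S \<circ> F)" by (simp add: \<sigma>_def o_assoc)
    then have "homeo \<sigma>" using phomeo_comp[OF phomeo_comp[OF F S.T_phomeo] F'] by simp
    then have "clopen ?W" using phomeo_UNIV(3)[OF F] phomeo_UNIV(3) U by blast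
    then show "measure \<mu> (\<sigma> ` U) = measure \<mu> U"
      using assms[unfolded embeds_iff_clopen[OF F]] \<mu> 1 2 by metis
  qed
  then obtain H where H: "homeo H" and fw: "\<And>x. forward T x (H (\<sigma> (inv_into UNIV H x)))"
    using T.forward_conjugate[OF min] by metis
  obtain p where p: "\<And>x. p x > 0" "\<And>x. H (\<sigma> (inv_into UNIV H x)) = (T ^^ p x) x"
    using fw unfolding forward_def by metis
  have bijH: "bij H" by (rule phomeo_UNIV(1)[OF H])
  have "(F \<circ> inv_into UNIV H) ((T ^^ p x) x) = S ((F \<circ> inv_into UNIV H) x)" for x
    using bijH F\<sigma> by (simp add: p(2)[symmetric] bij_is_inj)
  then show ?thesis
    unfolding is_speedup_of_def topologically_conjugate_def homeomorphic_map_euclidean_iff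
    using p(1) phomeo_comp[OF phomeo_inv[OF H] F] by blast
qed

end

text \<open>For an exhaustive epimorphism \<open>\<phi>\<close>, the number \<open>J \<mu> f\<close> is the common \<open>\<mu>\<close>-integral of the functions
  representing \<open>\<phi> [f]\<close>.\<close>

locale exhaustive_functional = cantor_pair S T
  for S :: "'b::topological_space \<Rightarrow> 'b" and T :: "'a::topological_space \<Rightarrow> 'a" +
  fixes J :: "'a measure \<Rightarrow> ('b \<Rightarrow> int) \<Rightarrow> real"
  assumes J_add: "\<And>\<mu> f g. \<mu> \<in> T.M \<Longrightarrow> cts f \<Longrightarrow> cts g \<Longrightarrow>
      J \<mu> (\<lambda>x. f x + g x) = J \<mu> f + J \<mu> g"
    and J_rep: "\<And>f. cts f \<Longrightarrow> (\<And>x. f x \<ge> 0) \<Longrightarrow>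
      \<exists>k. cts k \<and> (\<forall>x. k x \<ge> 0) \<and> (\<forall>\<mu>\<in>T.M. J \<mu> f = integral_Z \<mu> k)"
    and J_one: "\<And>\<mu>. \<mu> \<in> T.M \<Longrightarrow> J \<mu> (\<lambda>_. 1) = 1"
    and J_cong: "\<And>\<mu> f g. \<mu> \<in> T.M \<Longrightarrow> cts f \<Longrightarrow> cts g \<Longrightarrow>
      (\<And>\<nu>. \<nu> \<in> S.M \<Longrightarrow> integral_Z \<nu> f = integral_Z \<nu> g) \<Longrightarrow> J \<mu> f = J \<mu> g"
    and J_exhaust: "\<And>B h k x y. clopen B \<Longrightarrow> cts h \<Longrightarrow> cts k \<Longrightarrow>
      (\<And>x. h x \<ge> 0) \<Longrightarrow> (\<And>x. k x \<ge> 0) \<Longrightarrow> h x \<noteq> 0 \<Longrightarrow> k y \<noteq> 0 \<Longrightarrow>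
      (\<And>\<mu>. \<mu> \<in> T.M \<Longrightarrow> J \<mu> (\<lambda>y. of_bool (y \<in> B)) = integral_Z \<mu> h + integral_Z \<mu> k) \<Longrightarrow>
      \<exists>f. cts f \<and> (\<forall>x. f x \<ge> 0) \<and>
        (\<forall>\<nu>\<in>S.M. integral_Z \<nu> f < measure \<nu> B) \<and> (\<forall>\<mu>\<in>T.M. J \<mu> f = integral_Z \<mu> h)"
begin

section \<open>Back-and-forth between the clopen algebras\<close>

abbreviation ind :: "'c set \<Rightarrow> 'c \<Rightarrow> int" where "ind B \<equiv> (\<lambda>y. of_bool (y \<in> B))"

lemma J_nonneg: "\<mu> \<in> T.M \<Longrightarrow> cts f \<Longrightarrow> (\<And>x. f x \<ge> 0) \<Longrightarrow> J \<mu> f \<ge> 0"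
  using J_rep[of f] unfolding integral_Z_def by (metis Bochner_Integration.integral_nonneg of_int_0_le_iff)

lemma J_Un:
  assumes "\<mu> \<in> T.M" "clopen A" "clopen B" "A \<inter> B = {}"
  shows "J \<mu> (ind (A \<union> B)) = J \<mu> (ind A) + J \<mu> (ind B)"
proof -
  have "ind (A \<union> B) = (\<lambda>y. ind A y + ind B y)" using assms(4) by (auto simp: fun_eq_iff)
  then show ?thesis using J_add[OF assms(1) continuous_of_bool[OF assms(2)] continuous_of_bool[OF assms(3)]] by simp
qed

lemma J_empty: "\<mu> \<in> T.M \<Longrightarrow> J \<mu> (ind {}) = 0"
  using J_Un[of \<mu> "{}" "{}"] by simp

lemma J_scale:
  assumes "\<mu> \<in> T.M" "cts f"
  shows "J \<mu> (\<lambda>x. int n * f x) = real n * J \<mu> f"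
proof (induction n)
  case 0
  then show ?case using J_empty[OF assms(1)] by simp
next
  case (Suc n)
  have "cts (\<lambda>x. int n * f x)" by (rule continuous_discrete_comp[OF assms(2)])
  from J_add[OF assms(1,2) this] Suc show ?case by (simp add: algebra_simps)
qed

text \<open>Finitely many copies of \<open>B\<close> dominate the order unit: the constant 1 has the
  same integrals as some function below \<open>Suc N\<close> times the indicator of
  \<open>B\<close>. Hence 1 is at most \<open>Suc N\<close> times
  \<open>J \<mu> (ind B)\<close>.\<close>

lemma J_pos:
  assumes \<mu>: "\<mu> \<in> T.M" and B: "clopen B" "B \<noteq> {}"
  shows "J \<mu> (ind B) > 0"
proof -
  obtain N :: nat where N: "\<And>\<nu>. \<nu> \<in> S.M \<Longrightarrow> 1 \<le> real N * measure \<nu> B" using S.positive_measure[OF B] by metis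
  have cB: "cts (ind B)" by (rule continuous_of_bool[OF B(1)])
  \<comment> \<open>One copy more than \<open>N\<close> makes the inequality of integrals
    strict.\<close>
  let ?g = "\<lambda>x. int (Suc N) * ind B x"
  have cg: "cts ?g" by (rule continuous_discrete_comp[OF cB])
  have less: "integral_Z \<nu> (\<lambda>_. 1) < integral_Z \<nu> ?g" if \<nu>: "\<nu> \<in> S.M" for \<nu>
  proof -
    have b: "borel_prob \<nu>" by (rule S.M_borel_prob[OF \<nu>])
    have "integral_Z \<nu> ?g = real (Suc N) * measure \<nu> B"
      unfolding S.integral_Z_of_bool[OF b B(1), symmetric] by (simp add: integral_Z_def)
    moreover have "measure \<nu> B > 0" by (rule S.positive_clopen[OF B \<nu>])
    ultimately show ?thesis using N[OF \<nu>] S.integral_Z_const[OF b, of 1] by (simp add: algebra_simps)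
  qed
  obtain f' where f': "cts f'" "\<And>x. f' x \<le> ?g x"
    "\<And>\<nu>. \<nu> \<in> S.M \<Longrightarrow> integral_Z \<nu> f' = integral_Z \<nu> (\<lambda>_. 1)"
    by (rule S.cohomologous_below[OF _ _ cg _ less]) auto
  have "1 = J \<mu> f'" using J_cong[OF \<mu> f'(1) _ f'(3)] J_one[OF \<mu>] by simp
  also have "\<dots> \<le> J \<mu> f' + J \<mu> (\<lambda>x. ?g x - f' x)"
    using J_nonneg[OF \<mu> continuous_Z_diff[OF cg f'(1)]] f'(2) by simp
  also have "\<dots> = J \<mu> ?g" using J_add[OF \<mu> f'(1) continuous_Z_diff[OF cg f'(1)]] by simp
  also have "\<dots> = real (Suc N) * J \<mu> (ind B)" by (rule J_scale[OF \<mu> cB])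
  finally show ?thesis by (metis zero_less_mult_pos zero_less_one order_less_le_trans of_nat_0_less_iff zero_less_Suc)
qed

lemma indicator_between:
  assumes "cts f" "\<And>x. 0 \<le> f x" "\<And>x. f x \<le> ind A x"
  obtains U where "clopen U" "U \<subseteq> A" "f = ind U"
proof (rule that)
  show "clopen (f -` {1})" by (rule clopen_vimage_discrete[OF assms(1)])
  have "f x = 0 \<or> f x = 1 \<and> x \<in> A" for x using assms(2,3)[of x] by (cases "x \<in> A") auto
  then show "f -` {1} \<subseteq> A" "f = ind (f -` {1})" by (force simp: fun_eq_iff)+
qed

text \<open>\<open>J\<close> is positive on \<open>B - V\<close>, so a nonnegative representative of
  the class attached to \<open>V\<close> has smaller integrals than \<open>ind A\<close>. It can be
  moved below \<open>ind A\<close>, where it is the indicator of a clopen set.\<close>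

lemma match_source:
  assumes A: "clopen A" and B: "clopen B" and eq: "\<And>\<mu>. \<mu> \<in> T.M \<Longrightarrow> J \<mu> (ind B) = measure \<mu> A"
    and V: "clopen V" "V \<subseteq> B"
  shows "\<exists>U. clopen U \<and> U \<subseteq> A \<and> (\<forall>\<mu>\<in>T.M. J \<mu> (ind V) = measure \<mu> U)"
proof (cases "V = B")
  case True
  then show ?thesis using A eq by blast
next
  case False
  have cV: "cts (ind V)" by (rule continuous_of_bool[OF V(1)])
  obtain k where k: "cts k" "\<And>x. k x \<ge> 0" "\<And>\<mu>. \<mu> \<in> T.M \<Longrightarrow> J \<mu> (ind V) = integral_Z \<mu> k"
    using J_rep[OF cV] by auto
  have less: "integral_Z \<mu> k < integral_Z \<mu> (ind A)" if \<mu>: "\<mu> \<in> T.M" for \<mu>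
  proof -
    have "B - V \<noteq> {}" "V \<union> (B - V) = B" using False V(2) by auto
    then have "J \<mu> (ind B) = J \<mu> (ind V) + J \<mu> (ind (B - V))" "J \<mu> (ind (B - V)) > 0"
      using J_Un[OF \<mu> V(1), of "B - V"] J_pos[OF \<mu>, of "B - V"] B V(1) by auto
    then show ?thesis using k(3)[OF \<mu>] eq[OF \<mu>] T.M_integral_of_bool[OF \<mu> A] by simp
  qed
  obtain f' where f': "cts f'" "\<And>x. 0 \<le> f' x" "\<And>x. f' x \<le> ind A x"
    "\<And>\<mu>. \<mu> \<in> T.M \<Longrightarrow> integral_Z \<mu> f' = integral_Z \<mu> k"
    by (rule T.cohomologous_below[OF k(1,2) continuous_of_bool[OF A] _ less]) auto
  obtain U where U: "clopen U" "U \<subseteq> A" "f' = ind U" using indicator_between[OF f'(1-3)] by blast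
  have "J \<mu> (ind V) = measure \<mu> U" if \<mu>: "\<mu> \<in> T.M" for \<mu>
    using T.M_integral_of_bool[OF \<mu> U(1)] f'(4)[OF \<mu>] U(3) k(3)[OF \<mu>] by simp
  then show ?thesis using U by blast
qed

text \<open>The class of \<open>U\<close> must be lifted to a class on the other side that stays
  below that of \<open>B\<close>. Exhaustiveness provides the lift, and
  \<open>cohomologous_below\<close> turns it into a clopen subset of \<open>B\<close>.\<close>

lemma match_target:
  assumes A: "clopen A" and B: "clopen B" and eq: "\<And>\<mu>. \<mu> \<in> T.M \<Longrightarrow> J \<mu> (ind B) = measure \<mu> A"
    and U: "clopen U" "U \<subseteq> A"
  shows "\<exists>V. clopen V \<and> V \<subseteq> B \<and> (\<forall>\<mu>\<in>T.M. J \<mu> (ind V) = measure \<mu> U)"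
proof -
  consider "U = A" | "U = {}" | "U \<noteq> A" "U \<noteq> {}" by blast
  then show ?thesis
  proof cases
    case 1
    then show ?thesis using B eq by blast
  next
    case 2
    then show ?thesis using J_empty by (intro exI[of _ "{}"]) auto
  next
    case 3
    \<comment> \<open>Witnesses for the two strict inequalities that exhaustiveness asks for; the
      extreme cases have been split off.\<close>
    obtain x y where xy: "x \<in> U" "y \<in> A - U" using 3 U(2) by blast
    have AU: "clopen (A - U)" using A U(1) by simp
    have sum: "J \<mu> (ind B) = integral_Z \<mu> (ind U) + integral_Z \<mu> (ind (A - U))" if \<mu>: "\<mu> \<in> T.M" for \<mu>
      using T.M_integral_of_bool[OF \<mu>] U(1) AU eq[OF \<mu>] T.M_measure_Diff[OF \<mu> A U] by (simp del: Diff_iff)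
    obtain f where f: "cts f" "\<And>x. f x \<ge> 0" "\<And>\<nu>. \<nu> \<in> S.M \<Longrightarrow> integral_Z \<nu> f < measure \<nu> B"
      "\<And>\<mu>. \<mu> \<in> T.M \<Longrightarrow> J \<mu> f = integral_Z \<mu> (ind U)"
      using J_exhaust[OF B continuous_of_bool[OF U(1)] continuous_of_bool[OF AU] _ _ _ _ sum, of x y] xy by auto
    have less: "integral_Z \<nu> f < integral_Z \<nu> (ind B)" if "\<nu> \<in> S.M" for \<nu>
      using f(3)[OF that] S.M_integral_of_bool[OF that B] by simp
    obtain f' where f': "cts f'" "\<And>x. 0 \<le> f' x" "\<And>x. f' x \<le> ind B x"
      "\<And>\<nu>. \<nu> \<in> S.M \<Longrightarrow> integral_Z \<nu> f' = integral_Z \<nu> f"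
      by (rule S.cohomologous_below[OF f(1,2) continuous_of_bool[OF B] _ less]) auto
    obtain V where V: "clopen V" "V \<subseteq> B" "f' = ind V" using indicator_between[OF f'(1-3)] by blast
    have "J \<mu> (ind V) = measure \<mu> U" if \<mu>: "\<mu> \<in> T.M" for \<mu>
      using J_cong[OF \<mu> f'(1) f(1) f'(4)] f(4)[OF \<mu>] V(3) T.M_integral_of_bool[OF \<mu> U(1)] by simp
    then show ?thesis using V by blast
  qed
qed

text \<open>Labellings by natural numbers code finite clopen partitions of both spaces; blocks with
  the same label have the same mass, where \<open>J\<close> plays the part of the measure on the
  second space.\<close>

definition matched :: "('a \<Rightarrow> nat) \<Rightarrow> ('b \<Rightarrow> nat) \<Rightarrow> bool" where
  "matched a b \<longleftrightarrow> cts a \<and> cts b \<and>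
     (\<forall>\<mu>\<in>T.M. \<forall>k. J \<mu> (ind (b -` {k})) = measure \<mu> (a -` {k}))"

lemma J_vimage_finite:
  assumes b: "cts b" and a: "cts a" and \<mu>: "\<mu> \<in> T.M" and K: "finite K"
    and eq: "\<And>k. k \<in> K \<Longrightarrow> J \<mu> (ind (b -` {k::nat})) = measure \<mu> (a -` {k})"
  shows "J \<mu> (ind (b -` K)) = measure \<mu> (a -` K)"
  using K eq
proof (induction K rule: finite_induct)
  case empty
  then show ?case using J_empty[OF \<mu>] by simp
next
  case (insert k K)
  have b': "clopen (b -` L)" and a': "clopen (a -` L)" for L
    using clopen_vimage_discrete[OF b] clopen_vimage_discrete[OF a] by auto
  have "b -` insert k K = b -` {k} \<union> b -` K" "a -` insert k K = a -` {k} \<union> a -` K" by auto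
  moreover have "b -` {k} \<inter> b -` K = {}" "a -` {k} \<inter> a -` K = {}" using insert.hyps by auto
  ultimately show ?case
    using J_Un[OF \<mu> b' b', of "{k}" K] T.M_measure_Un[OF \<mu> a' a', of "{k}" K] insert by (simp del: Un_iff vimage_insert)
qed

lemma matched_vimage:
  assumes "matched a b" "\<mu> \<in> T.M"
  shows "J \<mu> (ind (b -` K)) = measure \<mu> (a -` K)"
proof -
  have a: "cts a" and b: "cts b" using assms(1) by (auto simp: matched_def)
  have "finite (K \<inter> (range a \<union> range b))"
    using T.finite_range_discrete[OF a] S.finite_range_discrete[OF b] by simp
  then have "J \<mu> (ind (b -` (K \<inter> (range a \<union> range b)))) = measure \<mu> (a -` (K \<inter> (range a \<union> range b)))"
    by (rule J_vimage_finite[OF b a assms(2)]) (use assms in \<open>simp add: matched_def\<close>)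
  moreover have "b -` (K \<inter> (range a \<union> range b)) = b -` K" "a -` (K \<inter> (range a \<union> range b)) = a -` K" by auto
  ultimately show ?thesis by simp
qed

text \<open>Nonempty clopen sets have positive mass on both sides, so the same labels occur. This is
  the consistency that \<open>Stone_duality\<close> asks for.\<close>

lemma matched_empty_iff:
  assumes "matched a b"
  shows "a -` {k} = {} \<longleftrightarrow> b -` {k} = {}"
proof -
  obtain \<mu> where \<mu>: "\<mu> \<in> T.M" using T.M_nonempty by blast
  have a: "cts a" and b: "cts b" using assms by (auto simp: matched_def)
  have eq: "J \<mu> (ind (b -` {k})) = measure \<mu> (a -` {k})" by (rule matched_vimage[OF assms \<mu>])
  have "b -` {k} \<noteq> {} \<Longrightarrow> J \<mu> (ind (b -` {k})) > 0" by (rule J_pos[OF \<mu> clopen_vimage_discrete[OF b]])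
  moreover have "a -` {k} \<noteq> {} \<Longrightarrow> measure \<mu> (a -` {k}) > 0"
    by (rule T.positive_clopen[OF clopen_vimage_discrete[OF a] _ \<mu>])
  moreover have "J \<mu> (ind {}) = 0" by (rule J_empty[OF \<mu>])
  ultimately show ?thesis using eq by (metis less_irrefl measure_empty)
qed

text \<open>Appending a binary digit to each label refines the partitions and keeps the whole
  history readable from the label.\<close>

lemma matched_extend:
  assumes ab: "matched a b" and U: "clopen U" and V: "clopen V"
    and eq: "\<And>\<mu> k. \<mu> \<in> T.M \<Longrightarrow> J \<mu> (ind (V \<inter> b -` {k})) = measure \<mu> (U \<inter> a -` {k})"
  shows "matched (\<lambda>x. 2 * a x + of_bool (x \<in> U)) (\<lambda>y. 2 * b y + of_bool (y \<in> V))"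
proof -
  let ?a = "\<lambda>x. 2 * a x + of_bool (x \<in> U)" and ?b = "\<lambda>y. 2 * b y + of_bool (y \<in> V)"
  have a: "cts a" and b: "cts b" using ab by (auto simp: matched_def)
  have bits: "2 * i + of_bool p = Suc (2 * k) \<longleftrightarrow> p \<and> i = k" "2 * i + of_bool p = 2 * k \<longleftrightarrow> \<not> p \<and> i = k"
    for i k :: nat and p by (cases p; simp; presburger)+
  have "cts ?a"
    by (rule continuous_discrete_comp2[where g = "\<lambda>m n. 2 * m + n", OF a continuous_of_bool[OF U]])
  moreover have "cts ?b"
    by (rule continuous_discrete_comp2[where g = "\<lambda>m n. 2 * m + n", OF b continuous_of_bool[OF V]])
  moreover have "J \<mu> (ind (?b -` {n})) = measure \<mu> (?a -` {n})" if \<mu>: "\<mu> \<in> T.M" for \<mu> n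
  proof -
    define k where "k = n div 2"
    have ak: "clopen (a -` {k})" and bk: "clopen (b -` {k})"
      using clopen_vimage_discrete[OF a] clopen_vimage_discrete[OF b] by auto
    show ?thesis
    proof (cases "odd n")
      case True
      then have n: "n = 2 * k + 1" by (simp add: k_def)
      have "?b -` {n} = V \<inter> b -` {k}" "?a -` {n} = U \<inter> a -` {k}"
        unfolding n by (auto simp: bits)
      then show ?thesis using eq[OF \<mu>] by simp
    next
      case False
      then have n: "n = 2 * k" by (simp add: k_def)
      have 1: "?b -` {n} = b -` {k} - V \<inter> b -` {k}" "?a -` {n} = a -` {k} - U \<inter> a -` {k}"
        unfolding n by (auto simp: bits)
      have cl: "clopen (V \<inter> b -` {k})" "clopen (b -` {k} - V \<inter> b -` {k})" using V bk by auto
      have "(V \<inter> b -` {k}) \<union> (b -` {k} - V \<inter> b -` {k}) = b -` {k}" by auto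
      then have "J \<mu> (ind (b -` {k})) = J \<mu> (ind (V \<inter> b -` {k})) + J \<mu> (ind (b -` {k} - V \<inter> b -` {k}))"
        using J_Un[OF \<mu> cl] by (metis Diff_disjoint)
      moreover have "measure \<mu> (a -` {k} - U \<inter> a -` {k}) = measure \<mu> (a -` {k}) - measure \<mu> (U \<inter> a -` {k})"
        using U ak by (intro T.M_measure_Diff[OF \<mu>]) auto
      ultimately show ?thesis unfolding 1 using eq[OF \<mu>, of k] matched_vimage[OF ab \<mu>, of "{k}"] by linarith
    qed
  qed
  ultimately show ?thesis by (simp add: matched_def)
qed

text \<open>Each block of \<open>b\<close> is cut by \<open>V\<close>, and
  \<open>match_source\<close> cuts the block of \<open>a\<close> with the same label accordingly.
  Only finitely many labels occur, so the union of the parts is clopen.\<close>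

lemma matched_extend_target:
  assumes ab: "matched a b" and V: "clopen V"
  shows "\<exists>U. clopen U \<and> matched (\<lambda>x. 2 * a x + of_bool (x \<in> U)) (\<lambda>y. 2 * b y + of_bool (y \<in> V))"
proof -
  have a: "cts a" and b: "cts b" using ab by (auto simp: matched_def)
  have ak: "clopen (a -` {k})" and bk: "clopen (b -` {k})" for k
    using clopen_vimage_discrete[OF a] clopen_vimage_discrete[OF b] by auto
  have "\<exists>U. clopen U \<and> U \<subseteq> a -` {k} \<and> (\<forall>\<mu>\<in>T.M. J \<mu> (ind (V \<inter> b -` {k})) = measure \<mu> U)" for k
    by (rule match_source[OF ak[of k] bk[of k] matched_vimage[OF ab]]) (use V bk[of k] in auto)
  then obtain U where U: "\<And>k. clopen (U k)" "\<And>k. U k \<subseteq> a -` {k}"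
    "\<And>k \<mu>. \<mu> \<in> T.M \<Longrightarrow> J \<mu> (ind (V \<inter> b -` {k})) = measure \<mu> (U k)" by metis
  define W where "W = (\<Union>k\<in>range a. U k)"
  have W: "clopen W" unfolding W_def by (rule clopen_UN[OF T.finite_range_discrete[OF a] U(1)])
  have "a x = k" if "x \<in> U k" for x k using U(2) that by blast
  then have Wk: "W \<inter> a -` {k} = U k" for k by (auto simp: W_def)
  show ?thesis by (intro exI conjI, rule W, rule matched_extend[OF ab W V]) (simp only: U(3) Wk)
qed

lemma matched_extend_source:
  assumes ab: "matched a b" and U: "clopen U"
  shows "\<exists>V. clopen V \<and> matched (\<lambda>x. 2 * a x + of_bool (x \<in> U)) (\<lambda>y. 2 * b y + of_bool (y \<in> V))"
proof -
  have a: "cts a" and b: "cts b" using ab by (auto simp: matched_def)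
  have ak: "clopen (a -` {k})" and bk: "clopen (b -` {k})" for k
    using clopen_vimage_discrete[OF a] clopen_vimage_discrete[OF b] by auto
  have "\<exists>V. clopen V \<and> V \<subseteq> b -` {k} \<and> (\<forall>\<mu>\<in>T.M. J \<mu> (ind V) = measure \<mu> (U \<inter> a -` {k}))" for k
    by (rule match_target[OF ak[of k] bk[of k] matched_vimage[OF ab]]) (use U ak[of k] in auto)
  then obtain V where V: "\<And>k. clopen (V k)" "\<And>k. V k \<subseteq> b -` {k}"
    "\<And>k \<mu>. \<mu> \<in> T.M \<Longrightarrow> J \<mu> (ind (V k)) = measure \<mu> (U \<inter> a -` {k})" by metis
  define W where "W = (\<Union>k\<in>range b. V k)"
  have W: "clopen W" unfolding W_def by (rule clopen_UN[OF S.finite_range_discrete[OF b] V(1)])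
  have "b x = k" if "x \<in> V k" for x k using V(2) that by blast
  then have Wk: "W \<inter> b -` {k} = V k" for k by (auto simp: W_def)
  show ?thesis by (intro exI conjI, rule W, rule matched_extend[OF ab U W]) (simp only: V(3) Wk)
qed

text \<open>Even stages split by the clopen sets of the second space, odd stages by those of the
  first, so both algebras are exhausted. The resulting \<open>F\<close> satisfies \<open>JF\<close>:
  on clopen sets \<open>J \<mu>\<close> is the image measure of \<open>\<mu>\<close>.\<close>

lemma exists_embedding: "\<exists>F. embeds F"
proof -
  obtain cX :: "nat \<Rightarrow> 'a set" where cX: "range cX = {U. clopen U}" using T.enumerate_clopen by blast
  obtain cY :: "nat \<Rightarrow> 'b set" where cY: "range cY = {U. clopen U}" using S.enumerate_clopen by blast
  have cX': "\<exists>n. W = cX n" if "clopen W" for W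
  proof -
    have "W \<in> range cX" unfolding cX using that by simp
    then show ?thesis by auto
  qed
  have cY': "\<exists>n. W = cY n" if "clopen W" for W
  proof -
    have "W \<in> range cY" unfolding cY using that by simp
    then show ?thesis by auto
  qed
  define P where "P = (\<lambda>(a, b). matched a b)"
  define Q where "Q n = (\<lambda>(a, b) (a' :: 'a \<Rightarrow> nat, b' :: 'b \<Rightarrow> nat). \<exists>U V. clopen U \<and> clopen V \<and>
    a' = (\<lambda>x. 2 * a x + of_bool (x \<in> U)) \<and> b' = (\<lambda>y. 2 * b y + of_bool (y \<in> V)) \<and>
    (if even n then V = cY (n div 2) else U = cX (n div 2)))" for n :: nat
  have step: "\<exists>y. P y \<and> Q n x y" if "P x" for x n
  proof -
    obtain a b where x: "x = (a, b)" by (cases x)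
    have ab: "matched a b" using that x by (simp add: P_def)
    show ?thesis
    proof (cases "even n")
      case True
      have V: "clopen (cY (n div 2))" using cY by auto
      obtain U where "clopen U" "matched (\<lambda>x. 2 * a x + of_bool (x \<in> U)) (\<lambda>y. 2 * b y + of_bool (y \<in> cY (n div 2)))"
        using matched_extend_target[OF ab V] by blast
      then show ?thesis using V True unfolding x P_def Q_def
        by (intro exI[of _ "(\<lambda>x. 2 * a x + of_bool (x \<in> U), \<lambda>y. 2 * b y + of_bool (y \<in> cY (n div 2)))"]) auto
    next
      case False
      have U: "clopen (cX (n div 2))" using cX by auto
      obtain V where "clopen V" "matched (\<lambda>x. 2 * a x + of_bool (x \<in> cX (n div 2))) (\<lambda>y. 2 * b y + of_bool (y \<in> V))"
        using matched_extend_source[OF ab U] by blast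
      then show ?thesis using U False unfolding x P_def Q_def
        by (intro exI[of _ "(\<lambda>x. 2 * a x + of_bool (x \<in> cX (n div 2)), \<lambda>y. 2 * b y + of_bool (y \<in> V))"]) auto
    qed
  qed
  have init: "P (\<lambda>_. 0, \<lambda>_. 0)"
  proof -
    have *: "J \<mu> (ind ((\<lambda>_::'b. 0::nat) -` {k})) = measure \<mu> ((\<lambda>_::'a. 0::nat) -` {k})" if \<mu>: "\<mu> \<in> T.M" for \<mu> k
    proof -
      interpret prob_space \<mu> using \<mu> by (simp add: invariant_measures_def)
      have "measure \<mu> UNIV = 1" using prob_space borel_prob_space[OF T.M_borel_prob[OF \<mu>]] by simp
      then show ?thesis using J_one[OF \<mu>] J_empty[OF \<mu>] by (cases "k = 0") (auto simp: vimage_def)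
    qed
    show ?thesis unfolding P_def prod.case matched_def
      by (intro conjI ballI allI continuous_on_const) (rule *)
  qed
  have "\<exists>s. \<forall>n. P (s n) \<and> Q n (s n) (s (Suc n))"
  proof (rule dependent_nat_choice)
    show "\<exists>x. P x" using init by (rule exI)
    show "\<exists>y. P y \<and> Q n x y" if "P x" for x n using that by (rule step)
  qed
  then obtain s where s: "\<forall>n. P (s n) \<and> Q n (s n) (s (Suc n))" ..
  define a b where "a n = fst (s n)" and "b n = snd (s n)" for n
  have sn: "s n = (a n, b n)" for n by (simp add: a_def b_def)
  have m: "matched (a n) (b n)" for n
    using s[THEN spec, THEN conjunct1, of n] unfolding sn P_def by simp
  have "\<exists>U V. clopen U \<and> clopen V \<and> a (Suc n) = (\<lambda>x. 2 * a n x + of_bool (x \<in> U)) \<and>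
    b (Suc n) = (\<lambda>y. 2 * b n y + of_bool (y \<in> V)) \<and> (if even n then V = cY (n div 2) else U = cX (n div 2))" for n
    using s[THEN spec, THEN conjunct2, of n] unfolding sn Q_def by simp
  note Qn = this
  \<comment> \<open>The splitting sets of stage \<open>n\<close> are recovered as the last binary
    digit of the next labels.\<close>
  define U V where "U n = {x. odd (a (Suc n) x)}" and "V n = {y. odd (b (Suc n) y)}" for n
  have "clopen (U n) \<and> clopen (V n) \<and> a (Suc n) = (\<lambda>x. 2 * a n x + of_bool (x \<in> U n)) \<and>
    b (Suc n) = (\<lambda>y. 2 * b n y + of_bool (y \<in> V n)) \<and> (if even n then V n = cY (n div 2) else U n = cX (n div 2))" for n
  proof -
    obtain U' V' where *: "clopen U'" "clopen V'" "a (Suc n) = (\<lambda>x. 2 * a n x + of_bool (x \<in> U'))"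
      "b (Suc n) = (\<lambda>y. 2 * b n y + of_bool (y \<in> V'))" "if even n then V' = cY (n div 2) else U' = cX (n div 2)"
      using Qn[of n] by (elim exE conjE)
    have "U n = U'" "V n = V'" unfolding U_def V_def *(3,4) by auto
    then show ?thesis using * by simp
  qed
  then have UV: "\<And>n. clopen (U n)" "\<And>n. clopen (V n)"
    "\<And>n. a (Suc n) = (\<lambda>x. 2 * a n x + of_bool (x \<in> U n))" "\<And>n. b (Suc n) = (\<lambda>y. 2 * b n y + of_bool (y \<in> V n))"
    "\<And>n. if even n then V n = cY (n div 2) else U n = cX (n div 2)" by simp_all
  \<comment> \<open>Equal labels at stage \<open>N\<close> have equal digits at all earlier
    stages.\<close>
  have agree: "x \<in> U i \<longleftrightarrow> y \<in> V i" if "i < N" "a N x = b N y" for i N x y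
    using that
  proof (induction N)
    case (Suc N)
    have e: "2 * a N x + of_bool (x \<in> U N) = 2 * b N y + of_bool (y \<in> V N)"
      using Suc.prems(2) by (simp add: UV)
    then have "a N x = b N y" "x \<in> U N \<longleftrightarrow> y \<in> V N" by (auto simp: of_bool_def split: if_splits) presburger+
    then show ?case using Suc by (cases "i = N") auto
  qed simp
  have bound: "\<forall>i\<in>J. i < Suc (Max (insert 0 J))" if "finite J" for J :: "nat set"
    using that by (simp add: less_Suc_eq_le)
  obtain F where F: "homeo F" "\<And>i x. F x \<in> V i \<longleftrightarrow> x \<in> U i"
  proof (rule Stone_duality[OF T.cantor S.cantor UV(1,2)])
    show "W \<in> range U" if W: "clopen W" for W
    proof -
      obtain n where "W = cX n" using cX'[OF W] ..
      then have "W = U (2 * n + 1)" using UV(5)[of "2 * n + 1"] by simp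
      then show ?thesis by blast
    qed
    show "W \<in> range V" if W: "clopen W" for W
    proof -
      obtain n where "W = cY n" using cY'[OF W] ..
      then have "W = V (2 * n)" using UV(5)[of "2 * n"] by simp
      then show ?thesis by blast
    qed
    show "\<exists>y. \<forall>i\<in>I. x \<in> U i \<longleftrightarrow> y \<in> V i" if "finite I" for I x
    proof -
      let ?N = "Suc (Max (insert 0 I))"
      have "b ?N -` {a ?N x} \<noteq> {}" using matched_empty_iff[OF m[of ?N], of "a ?N x"] by auto
      then obtain y where "b ?N y = a ?N x" by auto
      then have y: "a ?N x = b ?N y" by (rule sym)
      show ?thesis
      proof (intro exI[of _ y] ballI)
        fix i assume "i \<in> I"
        then have "i < ?N" using bound[OF that] by blast
        then show "x \<in> U i \<longleftrightarrow> y \<in> V i" using y by (rule agree)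
      qed
    qed
    show "\<exists>x. \<forall>i\<in>I. x \<in> U i \<longleftrightarrow> y \<in> V i" if "finite I" for I y
    proof -
      let ?N = "Suc (Max (insert 0 I))"
      have "a ?N -` {b ?N y} \<noteq> {}" using matched_empty_iff[OF m[of ?N], of "b ?N y"] by auto
      then obtain x where x: "a ?N x = b ?N y" by auto
      show ?thesis
      proof (intro exI[of _ x] ballI)
        fix i assume "i \<in> I"
        then have "i < ?N" using bound[OF that] by blast
        then show "x \<in> U i \<longleftrightarrow> y \<in> V i" using x by (rule agree)
      qed
    qed
  qed blast
  have JF: "J \<mu> (ind W) = measure \<mu> (F -` W)" if \<mu>: "\<mu> \<in> T.M" and W: "clopen W" for \<mu> W
  proof -
    obtain n where "W = cY n" using cY'[OF W] ..
    then have n: "W = V (2 * n)" using UV(5)[of "2 * n"] by simp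
    have "b (Suc i) -` {k. odd k} = V i" "a (Suc i) -` {k. odd k} = U i" for i by (auto simp: UV(3,4))
    then have "J \<mu> (ind (V (2 * n))) = measure \<mu> (U (2 * n))" using matched_vimage[OF m \<mu>, of "Suc (2 * n)" "{k. odd k}"] by simp
    moreover have "F -` V (2 * n) = U (2 * n)" using F(2) by auto
    ultimately show ?thesis using n by simp
  qed
  have "embeds F"
    unfolding embeds_iff_clopen[OF F(1)]
  proof (intro ballI allI impI)
    fix \<mu> and W :: "'b set" assume \<mu>: "\<mu> \<in> T.M" and W: "clopen W"
    have SW: "clopen (S -` W)" using phomeo_UNIV(4)[OF S.T_phomeo] W by simp
    \<comment> \<open>The two indicators have the same integral for every \<open>S\<close>-invariant
      measure, and \<open>J\<close> depends on nothing else. This is where the image measures become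
      \<open>S\<close>-invariant.\<close>
    have "J \<mu> (ind (S -` W)) = J \<mu> (ind W)"
    proof (rule J_cong[OF \<mu> continuous_of_bool[OF SW] continuous_of_bool[OF W]])
      fix \<nu> assume "\<nu> \<in> S.M"
      from S.M_integral_Tn[OF this continuous_of_bool[OF W], of 1]
      show "integral_Z \<nu> (ind (S -` W)) = integral_Z \<nu> (ind W)" by simp
    qed
    then show "measure \<mu> (F -` S -` W) = measure \<mu> (F -` W)" using JF[OF \<mu> SW] JF[OF \<mu> W] by simp
  qed
  then show ?thesis by blast
qed

end

section \<open>The ordered group modulo infinitesimals\<close>

lemma CZ_simps [simp]:
  "f \<in> carrier CZ \<longleftrightarrow> cts f"
  "f \<otimes>\<^bsub>CZ\<^esub> g = (\<lambda>x. f x + g x)"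
  "\<one>\<^bsub>CZ\<^esub> = (\<lambda>x. 0)"
  by (simp_all add: CZ_def)

lemma continuous_Z_minus: "cts f \<Longrightarrow> cts (\<lambda>x. - f x :: int)"
  by (rule continuous_discrete_comp)

lemma comm_group_CZ: "comm_group (CZ :: ('a::topological_space \<Rightarrow> int) monoid)"
proof (rule comm_groupI)
  fix f :: "'a \<Rightarrow> int" assume f: "f \<in> carrier CZ"
  have "cts (\<lambda>x. - f x)" using f by (simp add: continuous_Z_minus)
  then show "\<exists>g\<in>carrier CZ. g \<otimes>\<^bsub>CZ\<^esub> f = \<one>\<^bsub>CZ\<^esub>"
    by (intro bexI[of _ "\<lambda>x. - f x"]) auto
qed (auto simp: continuous_Z_add algebra_simps)

lemma integral_Z_0 [simp]: "integral_Z \<mu> (\<lambda>x. 0) = 0"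
  by (simp add: integral_Z_def)

lemma inv_CZ:
  fixes f :: "'a::topological_space \<Rightarrow> int"
  assumes "cts f"
  shows "inv\<^bsub>CZ\<^esub> f = (\<lambda>x. - f x)"
proof -
  interpret comm_group "CZ :: ('a \<Rightarrow> int) monoid" by (rule comm_group_CZ)
  have "cts (\<lambda>x. - f x)" by (rule continuous_discrete_comp[OF assms])
  then show ?thesis using assms by (intro inv_equality) auto
qed

section \<open>The quotient group described by integrals\<close>

context minimal_cantor
begin

abbreviation cls :: "('a \<Rightarrow> int) \<Rightarrow> ('a \<Rightarrow> int) set" where
  "cls f \<equiv> Inf_subgroup T #>\<^bsub>CZ\<^esub> f"

lemma Inf_subgroup_iff:
  "f \<in> Inf_subgroup T \<longleftrightarrow> cts f \<and> (\<forall>\<mu>\<in>M. integral_Z \<mu> f = 0)"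
  by (simp add: Inf_subgroup_def integral_Z_def)

lemma Inf_normal: "Inf_subgroup T \<lhd> CZ"
proof -
  interpret comm_group "CZ :: ('a \<Rightarrow> int) monoid" by (rule comm_group_CZ)
  have "subgroup (Inf_subgroup T) CZ"
  proof (rule subgroupI)
    have "(\<lambda>x. 0) \<in> Inf_subgroup T" by (simp add: Inf_subgroup_iff integral_Z_def)
    then show "Inf_subgroup T \<noteq> {}" by blast
    fix f assume f: "f \<in> Inf_subgroup T"
    then have "cts (\<lambda>x. - f x)"
      by (simp add: Inf_subgroup_iff continuous_Z_minus)
    then show "inv\<^bsub>CZ\<^esub> f \<in> Inf_subgroup T"
      using f by (simp add: inv_CZ Inf_subgroup_iff integral_Z_minus)
    fix g assume g: "g \<in> Inf_subgroup T"
    show "f \<otimes>\<^bsub>CZ\<^esub> g \<in> Inf_subgroup T"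
      using f g by (simp add: Inf_subgroup_iff continuous_Z_add integral_Z_add M_borel_prob)
  qed (auto simp: Inf_subgroup_iff)
  then show ?thesis by (rule subgroup_imp_normal)
qed

text \<open>The subgroup is the common kernel of the integrals, so a class is determined by the
  integrals of any representative.\<close>

lemma cls_eq_iff:
  assumes f: "cts f" and g: "cts g"
  shows "cls f = cls g \<longleftrightarrow> (\<forall>\<mu>\<in>M. integral_Z \<mu> f = integral_Z \<mu> g)"
proof -
  interpret normal "Inf_subgroup T" "CZ :: ('a \<Rightarrow> int) monoid" by (rule Inf_normal)
  have "cls f = cls g \<longleftrightarrow> f \<in> cls g"
    using rcos_self[OF _ subgroup_axioms, of f] repr_independence[OF _ _ subgroup_axioms, of f g] f g by auto
  also have "\<dots> \<longleftrightarrow> (\<lambda>x. f x - g x) \<in> Inf_subgroup T"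
  proof
    assume "f \<in> cls g"
    then obtain h where "h \<in> Inf_subgroup T" "f = (\<lambda>x. h x + g x)" by (auto simp: r_coset_def)
    then show "(\<lambda>x. f x - g x) \<in> Inf_subgroup T" by simp
  next
    assume *: "(\<lambda>x. f x - g x) \<in> Inf_subgroup T"
    show "f \<in> cls g" unfolding r_coset_def
      by (rule UN_I[OF *]) simp
  qed
  also have "\<dots> \<longleftrightarrow> (\<forall>\<mu>\<in>M. integral_Z \<mu> f = integral_Z \<mu> g)"
    using f g by (auto simp: Inf_subgroup_iff continuous_Z_diff integral_Z_diff M_borel_prob)
  finally show ?thesis .
qed

abbreviation G where "G \<equiv> G_mod_Inf T"

lemma G_carrier: "carrier G = {cls f | f. cts f}"
  by (auto simp: G_mod_Inf_def FactGroup_def RCOSETS_def)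

lemma G_one: "\<one>\<^bsub>G\<^esub> = cls (\<lambda>x. 0)"
proof -
  interpret normal "Inf_subgroup T" "CZ :: ('a \<Rightarrow> int) monoid" by (rule Inf_normal)
  show ?thesis using coset_mult_one[OF subset] by (simp add: G_mod_Inf_def FactGroup_def)
qed

lemma G_mult:
  assumes "cts f" "cts g"
  shows "cls f \<otimes>\<^bsub>G\<^esub> cls g = cls (\<lambda>x. f x + g x)"
proof -
  interpret normal "Inf_subgroup T" "CZ :: ('a \<Rightarrow> int) monoid" by (rule Inf_normal)
  show ?thesis using rcos_sum[of f g] assms by (simp add: G_mod_Inf_def FactGroup_def)
qed

lemma G_pos_cone: "pos_cone G = {cls f | f. cts f \<and> (\<forall>x. f x \<ge> 0)}"
  by (simp add: G_mod_Inf_def)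

lemma G_order_unit: "order_unit G = cls (\<lambda>x. 1)"
  by (simp add: G_mod_Inf_def)

text \<open>The fields agree with those of the factor group, but the record has two more of them;
  the axioms are carried over by unfolding.\<close>

lemma G_group: "group G"
proof -
  interpret normal "Inf_subgroup T" "CZ :: ('a \<Rightarrow> int) monoid" by (rule Inf_normal)
  show ?thesis using factorgroup_is_group
    by (simp add: group_def monoid_def group_axioms_def Units_def G_mod_Inf_def)
qed

lemma G_inv:
  assumes f: "cts f"
  shows "inv\<^bsub>G\<^esub> cls f = cls (\<lambda>x. - f x)"
proof -
  interpret group G by (rule G_group)
  show ?thesis
    using f continuous_Z_minus[OF f] by (intro inv_equality) (auto simp: G_carrier G_mult G_one)
qed

text \<open>A nonnegative function that is not identically 0 has positive integrals by minimality,
  so its class is not 0. Strict order is therefore witnessed by such a function.\<close>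

lemma ordered_less_iff:
  assumes f: "cts f" and g: "cts g"
  shows "ordered_less G (cls f) (cls g) \<longleftrightarrow>
    (\<exists>k. cts k \<and> (\<forall>x. k x \<ge> 0) \<and> (\<exists>x. k x \<noteq> 0) \<and>
      (\<forall>\<mu>\<in>M. integral_Z \<mu> g = integral_Z \<mu> f + integral_Z \<mu> k))"
proof -
  have ne: "cls k \<noteq> cls (\<lambda>x. 0) \<longleftrightarrow> (\<exists>x. k x \<noteq> 0)" if k: "cts k" "\<And>x. k x \<ge> 0" for k
  proof -
    obtain \<mu> where \<mu>: "\<mu> \<in> M" using M_nonempty by blast
    have "\<exists>x. k x \<noteq> 0" if ne: "cls k \<noteq> cls (\<lambda>x. 0)"
    proof (rule ccontr)
      assume "\<nexists>x. k x \<noteq> 0"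
      then have "k = (\<lambda>x. 0)" by auto
      then show False using ne by simp
    qed
    moreover have "cls k \<noteq> cls (\<lambda>x. 0)" if "k x \<noteq> 0" for x
      using positive_integral[OF k that \<mu>] \<mu> cls_eq_iff[OF k(1) continuous_on_const[of UNIV 0]]
      by auto
    ultimately show ?thesis by blast
  qed
  have eq: "cls (\<lambda>x. g x - f x) = cls k \<longleftrightarrow> (\<forall>\<mu>\<in>M. integral_Z \<mu> g = integral_Z \<mu> f + integral_Z \<mu> k)"
    if k: "cts k" for k
    unfolding cls_eq_iff[OF continuous_Z_diff[OF g f] k]
  proof (rule ball_cong[OF refl])
    fix \<mu> assume "\<mu> \<in> M"
    then show "integral_Z \<mu> (\<lambda>x. g x - f x) = integral_Z \<mu> k \<longleftrightarrow> integral_Z \<mu> g = integral_Z \<mu> f + integral_Z \<mu> k"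
      using integral_Z_diff[OF g f M_borel_prob] by auto
  qed
  have "ordered_less G (cls f) (cls g) \<longleftrightarrow> cls (\<lambda>x. g x - f x) \<in> pos_cone G - {cls (\<lambda>x. 0)}"
    using f g continuous_Z_minus[OF f] by (simp add: ordered_less_def G_inv G_mult G_one)
  also have "\<dots> \<longleftrightarrow> (\<exists>k. cts k \<and> (\<forall>x. k x \<ge> 0) \<and> cls (\<lambda>x. g x - f x) = cls k \<and> cls k \<noteq> cls (\<lambda>x. 0))"
    by (auto simp: G_pos_cone)
  also have "\<dots> \<longleftrightarrow> (\<exists>k. cts k \<and> (\<forall>x. k x \<ge> 0) \<and> (\<exists>x. k x \<noteq> 0) \<and>
      (\<forall>\<mu>\<in>M. integral_Z \<mu> g = integral_Z \<mu> f + integral_Z \<mu> k))"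
  proof (rule ex_cong1, rule conj_cong[OF refl], rule conj_cong[OF refl])
    fix k :: "'a \<Rightarrow> int" assume k: "cts k" "\<forall>x. k x \<ge> 0"
    show "cls (\<lambda>x. g x - f x) = cls k \<and> cls k \<noteq> cls (\<lambda>x. 0) \<longleftrightarrow>
      (\<exists>x. k x \<noteq> 0) \<and> (\<forall>\<mu>\<in>M. integral_Z \<mu> g = integral_Z \<mu> f + integral_Z \<mu> k)"
      unfolding eq[OF k(1)] ne[OF k(1) k(2)[rule_format]] by (rule conj_commute)
  qed
  finally show ?thesis .
qed

end

section \<open>Composition with a homeomorphism, and the functional of an epimorphism\<close>

context cantor_pair
begin

text \<open>The epimorphism is composition with \<open>F\<close>. For exhaustiveness, a function
  with the class of \<open>h\<close> is moved below the composite of \<open>g0\<close> with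
  \<open>F\<close> by the dynamics of \<open>T\<close>.\<close>

lemma embeds_imp_exhaustive:
  assumes "embeds F"
  shows "\<exists>\<phi> \<in> unital_ordered_epi S.G T.G. exhaustive S.G T.G \<phi>"
proof -
  have F: "homeo F" and FM: "\<And>\<mu>. \<mu> \<in> T.M \<Longrightarrow> distr \<mu> borel F \<in> S.M"
    using assms by (auto simp: embeds_def)
  let ?F' = "inv_into UNIV F"
  have cF: "cts (\<lambda>x. f (F x))" if "cts f" for f :: "'b \<Rightarrow> int"
    by (rule continuous_comp_UNIV[OF that phomeo_UNIV(2)[OF F]])
  have cF': "cts (\<lambda>x. f (?F' x))" if "cts f" for f :: "'a \<Rightarrow> int"
    by (rule continuous_comp_UNIV[OF that phomeo_UNIV(2)[OF phomeo_inv[OF F]]])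
  have F'F: "?F' (F x) = x" for x using phomeo_UNIV(1)[OF F] by (simp add: bij_is_inj)
  have int: "integral_Z \<mu> (\<lambda>x. f (F x)) = integral_Z (distr \<mu> borel F) f"
    if "\<mu> \<in> T.M" "cts f" for \<mu> and f :: "'b \<Rightarrow> int"
    by (rule integral_Z_distr[OF that(2) distr_F(1)[OF F that(1)], symmetric])
  \<comment> \<open>A representative of the coset is chosen; as \<open>F\<close> carries measures in
    \<open>T.M\<close> to measures in \<open>S.M\<close>, the result does not depend on the
    choice.\<close>
  define \<phi> where "\<phi> K = T.cls (\<lambda>x. (SOME f. cts f \<and> K = S.cls f) (F x))" for K
  have \<phi>: "\<phi> (S.cls f) = T.cls (\<lambda>x. f (F x))" if f: "cts f" for f
  proof -
    define f' where "f' = (SOME f'. cts f' \<and> S.cls f = S.cls f')"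
    have f': "cts f' \<and> S.cls f = S.cls f'"
      unfolding f'_def
      by (rule someI_ex[of "\<lambda>f'. cts f' \<and> S.cls f = S.cls f'"]) (use f in blast)
    then have "\<And>\<nu>. \<nu> \<in> S.M \<Longrightarrow> integral_Z \<nu> f' = integral_Z \<nu> f" using S.cls_eq_iff[of f f'] f by auto
    then have "\<And>\<mu>. \<mu> \<in> T.M \<Longrightarrow> integral_Z \<mu> (\<lambda>x. f' (F x)) = integral_Z \<mu> (\<lambda>x. f (F x))"
      using FM int f f' by simp
    then have "T.cls (\<lambda>x. f' (F x)) = T.cls (\<lambda>x. f (F x))" using T.cls_eq_iff cF f f' by simp
    then show ?thesis by (simp add: \<phi>_def f'_def)
  qed
  have "\<phi> \<in> hom S.G T.G"
  proof (rule homI)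
    fix x assume "x \<in> carrier S.G"
    then show "\<phi> x \<in> carrier T.G" using cF by (auto simp: S.G_carrier T.G_carrier \<phi>)
  next
    fix x y assume "x \<in> carrier S.G" "y \<in> carrier S.G"
    then obtain f g where fg: "x = S.cls f" "cts f" "y = S.cls g" "cts g"
      by (auto simp: S.G_carrier)
    then show "\<phi> (x \<otimes>\<^bsub>S.G\<^esub> y) = \<phi> x \<otimes>\<^bsub>T.G\<^esub> \<phi> y"
      by (simp add: S.G_mult T.G_mult \<phi> continuous_Z_add cF)
  qed
  moreover have "\<phi> ` carrier S.G = carrier T.G"
  proof
    show "\<phi> ` carrier S.G \<subseteq> carrier T.G"
      using cF by (auto simp: S.G_carrier T.G_carrier \<phi>)
    show "carrier T.G \<subseteq> \<phi> ` carrier S.G"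
    proof
      fix x assume "x \<in> carrier T.G"
      then obtain f where f: "x = T.cls f" "cts f" by (auto simp: T.G_carrier)
      then have "\<phi> (S.cls (\<lambda>y. f (?F' y))) = x" by (simp add: \<phi> cF' F'F)
      moreover have "S.cls (\<lambda>y. f (?F' y)) \<in> carrier S.G" using f cF' by (auto simp: S.G_carrier)
      ultimately show "x \<in> \<phi> ` carrier S.G" by blast
    qed
  qed
  moreover have "\<phi> ` pos_cone S.G \<subseteq> pos_cone T.G"
    using cF by (auto simp: S.G_pos_cone T.G_pos_cone \<phi>)
  moreover have "\<phi> (order_unit S.G) = order_unit T.G"
    by (simp add: S.G_order_unit T.G_order_unit \<phi>)
  ultimately have epi: "\<phi> \<in> unital_ordered_epi S.G T.G"
    by (simp add: unital_ordered_epi_def epi_def)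
  have "exhaustive S.G T.G \<phi>"
    unfolding exhaustive_def
  proof (intro ballI impI)
    fix g h assume "g \<in> pos_cone S.G" "h \<in> carrier T.G"
    then obtain g0 h0 where g: "g = S.cls g0" "cts g0" "\<And>x. g0 x \<ge> 0"
      and h: "h = T.cls h0" "cts h0" by (auto simp: S.G_pos_cone T.G_carrier)
    assume "ordered_less T.G \<one>\<^bsub>T.G\<^esub> h \<and> ordered_less T.G h (\<phi> g)"
    then have less: "ordered_less T.G (T.cls (\<lambda>x. 0)) (T.cls h0)"
      "ordered_less T.G (T.cls h0) (T.cls (\<lambda>x. g0 (F x)))"
      using g h by (simp_all add: T.G_one \<phi>)
    obtain k1 where k1: "cts k1" "\<And>x. k1 x \<ge> 0" "\<exists>x. k1 x \<noteq> 0"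
      "\<And>\<mu>. \<mu> \<in> T.M \<Longrightarrow> integral_Z \<mu> h0 = integral_Z \<mu> k1"
      using less(1) unfolding T.ordered_less_iff[OF continuous_on_const h(2)] by auto
    obtain k2 where k2: "cts k2" "\<And>x. k2 x \<ge> 0" "\<exists>x. k2 x \<noteq> 0"
      "\<And>\<mu>. \<mu> \<in> T.M \<Longrightarrow> integral_Z \<mu> (\<lambda>x. g0 (F x)) = integral_Z \<mu> h0 + integral_Z \<mu> k2"
      using less(2) T.ordered_less_iff[OF h(2) cF[OF g(2)]] by auto
    have pos: "integral_Z \<mu> k1 > 0" "integral_Z \<mu> k2 > 0" if "\<mu> \<in> T.M" for \<mu>
      using T.positive_integral[OF k1(1,2) _ that] T.positive_integral[OF k2(1,2) _ that] k1(3) k2(3) by auto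
    have lt: "integral_Z \<mu> k1 < integral_Z \<mu> (\<lambda>x. g0 (F x))" if "\<mu> \<in> T.M" for \<mu>
      using pos[OF that] k1(4)[OF that] k2(4)[OF that] by simp
    obtain f' where f': "cts f'" "\<And>x. 0 \<le> f' x" "\<And>x. f' x \<le> g0 (F x)"
      "\<And>\<mu>. \<mu> \<in> T.M \<Longrightarrow> integral_Z \<mu> f' = integral_Z \<mu> k1"
      by (rule T.cohomologous_below[OF k1(1,2) cF[OF g(2)] _ lt]) (use g(3) in auto)
    obtain \<mu> where \<mu>: "\<mu> \<in> T.M" using T.M_nonempty by blast
    \<comment> \<open>Measures in \<open>S.M\<close> need not come from \<open>T.M\<close>, so
      inequalities of integrals in \<open>X\<close> would not suffice in \<open>Y\<close>. The
      pointwise bound of \<open>f'\<close> transfers, and it gives the order relation for all of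
      \<open>S.M\<close>.\<close>
    define f where "f y = f' (?F' y)" for y
    have f: "cts f" unfolding f_def by (rule cF'[OF f'(1)])
    have fF: "f (F x) = f' x" for x by (simp add: f_def F'F)
    have FF': "F (?F' y) = y" for y using phomeo_UNIV(1)[OF F] by (simp add: bij_is_surj surj_f_inv_f)
    have fle: "0 \<le> f y" "f y \<le> g0 y" for y using f'(2,3)[of "?F' y"] FF' by (simp_all add: f_def)
    have "T.cls f' = h" unfolding h(1) using f' k1(4) h(2) by (simp add: T.cls_eq_iff)
    then have "\<phi> (S.cls f) = h" using \<phi>[OF f] fF by simp
    moreover have "\<exists>y. f y \<noteq> 0"
    proof (rule ccontr)
      assume "\<nexists>y. f y \<noteq> 0"
      then have "f' x = 0" for x using fF[of x] by simp
      then show False using pos(1)[OF \<mu>] f'(4)[OF \<mu>] by (simp add: integral_Z_def)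
    qed
    then have "ordered_less S.G \<one>\<^bsub>S.G\<^esub> (S.cls f)"
      unfolding S.G_one S.ordered_less_iff[OF continuous_on_const f]
      using f fle(1) by (intro exI[of _ f]) auto
    moreover have "\<exists>y. g0 y - f y \<noteq> 0"
    proof (rule ccontr)
      assume "\<nexists>y. g0 y - f y \<noteq> 0"
      then have "g0 (F x) = f' x" for x using fF[of x] by (metis eq_iff_diff_eq_0)
      then show False using lt[OF \<mu>] f'(4)[OF \<mu>] by simp
    qed
    then have "ordered_less S.G (S.cls f) (S.cls g0)"
      unfolding S.ordered_less_iff[OF f g(2)]
      using continuous_Z_diff[OF g(2) f] fle(2) S.integral_Z_diff[OF g(2) f] S.M_borel_prob
      by (intro exI[of _ "\<lambda>y. g0 y - f y"]) auto
    moreover have "S.cls f \<in> carrier S.G" using f by (auto simp: S.G_carrier)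
    ultimately show "\<exists>g'\<in>carrier S.G. \<phi> g' = h \<and> ordered_less S.G \<one>\<^bsub>S.G\<^esub> g' \<and>
        ordered_less S.G g' g"
      using g(1) by blast
  qed
  then show ?thesis using epi by blast
qed

lemma exhaustive_imp_embeds:
  assumes epi: "\<phi> \<in> unital_ordered_epi S.G T.G"
    and exh: "exhaustive S.G T.G \<phi>"
  shows "\<exists>F. embeds F"
proof -
  have hom: "\<phi> \<in> hom S.G T.G"
    and pos: "\<phi> ` pos_cone S.G \<subseteq> pos_cone T.G"
    and unit: "\<phi> (S.cls (\<lambda>x. 1)) = T.cls (\<lambda>x. 1)"
    using epi by (auto simp: unital_ordered_epi_def epi_def S.G_order_unit T.G_order_unit)
  have clsS: "S.cls f \<in> carrier S.G" if "cts f" for f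
    using that by (auto simp: S.G_carrier)
  have "\<exists>g. cts f \<longrightarrow> cts g \<and> \<phi> (S.cls f) = T.cls g" for f
  proof (cases "cts f")
    case True
    then have "\<phi> (S.cls f) \<in> carrier T.G" using hom_in_carrier[OF hom] clsS by blast
    then show ?thesis by (auto simp: T.G_carrier)
  qed simp
  then obtain \<Phi> where \<Phi>: "\<And>f. cts f \<Longrightarrow> cts (\<Phi> f)"
    "\<And>f. cts f \<Longrightarrow> \<phi> (S.cls f) = T.cls (\<Phi> f)" by metis
  \<comment> \<open>Equal classes have equal integrals, so the choice of \<open>\<Phi> f\<close>
    does not matter.\<close>
  define J where "J \<mu> f = integral_Z \<mu> (\<Phi> f)" for \<mu> f
  have J: "J \<mu> f = integral_Z \<mu> k"
    if "\<phi> (S.cls f) = T.cls k" "cts f" "cts k" "\<mu> \<in> T.M" for \<mu> f k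
    using that \<Phi>[OF that(2)] T.cls_eq_iff[of "\<Phi> f" k] by (simp add: J_def)
  interpret exhaustive_functional S T J
  proof
    fix \<mu> and f g :: "'b \<Rightarrow> int" assume \<mu>: "\<mu> \<in> T.M" and f: "cts f" and g: "cts g"
    have "\<phi> (S.cls (\<lambda>x. f x + g x)) = T.cls (\<lambda>x. \<Phi> f x + \<Phi> g x)"
      using hom_mult[OF hom clsS[OF f] clsS[OF g]] f g \<Phi> by (simp add: S.G_mult T.G_mult)
    then have "J \<mu> (\<lambda>x. f x + g x) = integral_Z \<mu> (\<lambda>x. \<Phi> f x + \<Phi> g x)"
      using f g \<Phi>(1) \<mu> by (intro J) (auto intro: continuous_Z_add)
    then show "J \<mu> (\<lambda>x. f x + g x) = J \<mu> f + J \<mu> g"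
      using T.integral_Z_add[OF \<Phi>(1)[OF f] \<Phi>(1)[OF g] T.M_borel_prob[OF \<mu>]] by (simp add: J_def)
  next
    fix f :: "'b \<Rightarrow> int" assume f: "cts f" "\<And>x. f x \<ge> 0"
    then have "\<phi> (S.cls f) \<in> pos_cone T.G" using pos by (auto simp: S.G_pos_cone)
    then obtain k where "cts k" "\<And>x. k x \<ge> 0" "\<phi> (S.cls f) = T.cls k"
      by (auto simp: T.G_pos_cone)
    then show "\<exists>k. cts k \<and> (\<forall>x. k x \<ge> 0) \<and> (\<forall>\<mu>\<in>T.M. J \<mu> f = integral_Z \<mu> k)"
      using J f by blast
  next
    fix \<mu> assume \<mu>: "\<mu> \<in> T.M"
    show "J \<mu> (\<lambda>_. 1) = 1"
      using J[OF unit _ _ \<mu>] T.integral_Z_const[OF T.M_borel_prob[OF \<mu>], of 1] by simp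
  next
    fix \<mu> and f g :: "'b \<Rightarrow> int" assume \<mu>: "\<mu> \<in> T.M" and f: "cts f" and g: "cts g"
      and eq: "\<And>\<nu>. \<nu> \<in> S.M \<Longrightarrow> integral_Z \<nu> f = integral_Z \<nu> g"
    have "S.cls f = S.cls g" using S.cls_eq_iff[OF f g] eq by blast
    then show "J \<mu> f = J \<mu> g" using J[OF _ f \<Phi>(1)[OF g] \<mu>] \<Phi>(2)[OF g] by (simp add: J_def)
  next
    fix B :: "'b set" and h k :: "'a \<Rightarrow> int" and x y
    assume B: "clopen B" and h: "cts h" and k: "cts k"
      and nn: "\<And>x. h x \<ge> 0" "\<And>x. k x \<ge> 0" and xy: "h x \<noteq> 0" "k y \<noteq> 0"
      and eq: "\<And>\<mu>. \<mu> \<in> T.M \<Longrightarrow> J \<mu> (\<lambda>y. of_bool (y \<in> B)) = integral_Z \<mu> h + integral_Z \<mu> k"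
    let ?B = "\<lambda>y. of_bool (y \<in> B) :: int"
    have cB: "cts ?B" by (rule continuous_of_bool[OF B])
    have 1: "ordered_less T.G \<one>\<^bsub>T.G\<^esub> (T.cls h)"
      unfolding T.G_one T.ordered_less_iff[OF continuous_on_const h]
      using h nn xy by (intro exI[of _ h]) auto
    have 2: "ordered_less T.G (T.cls h) (\<phi> (S.cls ?B))"
      unfolding \<Phi>(2)[OF cB] T.ordered_less_iff[OF h \<Phi>(1)[OF cB]]
      using k nn xy eq by (intro exI[of _ k]) (auto simp: J_def)
    have 3: "S.cls ?B \<in> pos_cone S.G" using cB by (force simp: S.G_pos_cone)
    have 4: "T.cls h \<in> carrier T.G" using h by (auto simp: T.G_carrier)
    obtain g' where g': "g' \<in> carrier S.G" "\<phi> g' = T.cls h"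
      "ordered_less S.G \<one>\<^bsub>S.G\<^esub> g'" "ordered_less S.G g' (S.cls ?B)"
      using exh 1 2 3 4 unfolding exhaustive_def by blast
    obtain f0 where f0: "g' = S.cls f0" "cts f0" using g'(1) by (auto simp: S.G_carrier)
    \<comment> \<open>The representative \<open>f0\<close> of \<open>g'\<close> may change sign;
      positivity of \<open>g'\<close> supplies a nonnegative one.\<close>
    obtain f where f: "cts f" "\<And>x. f x \<ge> 0" "\<And>\<nu>. \<nu> \<in> S.M \<Longrightarrow> integral_Z \<nu> f0 = integral_Z \<nu> f"
      using g'(3) unfolding f0(1) S.G_one S.ordered_less_iff[OF continuous_on_const f0(2)] by auto
    have cls_f: "S.cls f = g'" unfolding f0(1) using S.cls_eq_iff[OF f(1) f0(2)] f(3) by simp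
    obtain l where l: "cts l" "\<And>x. l x \<ge> 0" "\<exists>x. l x \<noteq> 0"
      "\<And>\<nu>. \<nu> \<in> S.M \<Longrightarrow> integral_Z \<nu> ?B = integral_Z \<nu> f + integral_Z \<nu> l"
      using g'(4) S.ordered_less_iff[OF f(1) cB] unfolding cls_f[symmetric] by auto
    have "integral_Z \<nu> f < measure \<nu> B" if \<nu>: "\<nu> \<in> S.M" for \<nu>
      using l(4)[OF \<nu>] S.positive_integral[OF l(1,2) _ \<nu>] l(3) S.M_integral_of_bool[OF \<nu> B] by auto
    moreover have "J \<mu> f = integral_Z \<mu> h" if "\<mu> \<in> T.M" for \<mu>
      using J[OF _ f(1) h that] cls_f g'(2) by simp
    ultimately show "\<exists>f. cts f \<and> (\<forall>x. f x \<ge> 0) \<and>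
        (\<forall>\<nu>\<in>S.M. integral_Z \<nu> f < measure \<nu> B) \<and> (\<forall>\<mu>\<in>T.M. J \<mu> f = integral_Z \<mu> h)"
      using f(1,2) by blast
  qed
  show ?thesis by (rule exists_embedding)
qed

end

theorem theorem1:
  fixes S :: "'b::topological_space \<Rightarrow> 'b" and T :: "'a::topological_space \<Rightarrow> 'a"
  assumes "minimal_cantor_system S" and "minimal_cantor_system T"
  shows "(is_speedup_of S T \<longleftrightarrow>
            (\<exists>\<phi> \<in> unital_ordered_epi (G_mod_Inf S) (G_mod_Inf T).
               exhaustive (G_mod_Inf S) (G_mod_Inf T) \<phi>)) \<and>
         ((\<exists>\<phi> \<in> unital_ordered_epi (G_mod_Inf S) (G_mod_Inf T).
               exhaustive (G_mod_Inf S) (G_mod_Inf T) \<phi>) \<longleftrightarrow>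
            (\<exists>F :: 'a \<Rightarrow> 'b. homeomorphic_map euclidean euclidean F \<and>
               (\<lambda>\<mu>. distr \<mu> borel F) ` invariant_measures T \<subseteq> invariant_measures S \<and>
               inj_on (\<lambda>\<mu>. distr \<mu> borel F) (invariant_measures T)))"
proof -
  interpret cantor_pair S T using assms by unfold_locales
  have "is_speedup_of S T \<longleftrightarrow> (\<exists>F. embeds F)"
    using speedup_imp_embeds embeds_imp_speedup by blast
  moreover have "(\<exists>\<phi> \<in> unital_ordered_epi (G_mod_Inf S) (G_mod_Inf T).
      exhaustive (G_mod_Inf S) (G_mod_Inf T) \<phi>) \<longleftrightarrow> (\<exists>F. embeds F)"
    using embeds_imp_exhaustive exhaustive_imp_embeds by blast
  ultimately show ?thesis unfolding embeds_iff by blast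
qed

end
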